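(* Let $0<\sigma<\infty$. (i) Let $r>1$ and $a>-1$, let $\tau\in\mathbb{R}$, and let $a_n(\epsilon)$ ($n\ge1$) be real-valued functions of $\epsilon$ such that $$a_n(\epsilon)\log n\to\tau\quad\text{as } n\to\infty \text{ and } \epsilon\nearrow 1/\sqrt{r-1}.$$ Assume that $\mathsf{E}X=0$, $\mathsf{E}X^2=\sigma^2$ and $\mathsf{E}|X|^{2+\eta}<\infty$ for some $0<\eta<1$. Then $$\lim_{\epsilon\nearrow 1/\sqrt{r-1}}\big[\epsilon^{-2}-(r-1)\big]^{a+1}\sum_{n=1}^{\infty}n^{r-2}(\log n)^a\,\mathsf{P}\Big\{M_n\le\sigma\phi(n)\big(\epsilon+a_n(\epsilon)\big)\Big\}=\frac{4}{\pi}\exp\{2\tau(r-1)^{3/2}\}\,\Gamma(a+1).\qquad( * )$$ (ii) Conversely, if $( * )$ holds for some $r>1$, some $a>-1$, some $\tau\in\mathbb{R}$ and some real-valued functions $a_n(\epsilon)$ ($n\ge1$) satisfying $a_n(\epsilon)\log n\to\tau$ as $n\to\infty$ and $\epsilon\nearrow 1/\sqrt{r-1}$, then $\mathsf{E}X=0$ and $\mathrm{Var}\,X=\sigma^2$.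
   Context: $X,X_1,X_2,\ldots$ are i.i.d. real random variables; $S_n=\sum_{k=1}^nX_k$ and $M_n=\max_{1\le k\le n}|S_k|$ for $n\ge1$. Conventions: $\log x=\ln(\max(x,e))$ and $\phi(x)=\sqrt{\pi^2x/(8\log x)}$. $\Gamma(\cdot)$ is the gamma function. The limit "as $n\to\infty$ and $\epsilon\nearrow1/\sqrt{r-1}$" is a joint (double) limit, with $\epsilon$ approaching $1/\sqrt{r-1}$ from below; $\epsilon$ ranges over $(0,1/\sqrt{r-1})$. *)

theory Defs
  imports "HOL-Probability.Probability"
begin

definition lg :: "real \<Rightarrow> real" where
  "lg x = ln (max x (exp 1))"

definition phi :: "real \<Rightarrow> real" where
  "phi x = sqrt (pi\<^sup>2 * x / (8 * lg x))"

text \<open>The family \<open>X\<close> is indexed from \<open>0\<close>: the entry \<open>X 0\<close> is the generic variable \<open>X\<close> of the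
  i.i.d. family \<open>X, X\<^sub>1, X\<^sub>2, \<dots>\<close>, so it does not enter the partial sums.\<close>

definition partial_sum :: "(nat \<Rightarrow> 'a \<Rightarrow> real) \<Rightarrow> nat \<Rightarrow> 'a \<Rightarrow> real" where
  "partial_sum X n \<omega> = (\<Sum>k=1..n. X k \<omega>)"

text \<open>Only meaningful for \<open>n \<ge> 1\<close>.\<close>

definition max_abs_sum :: "(nat \<Rightarrow> 'a \<Rightarrow> real) \<Rightarrow> nat \<Rightarrow> 'a \<Rightarrow> real" where
  "max_abs_sum X n \<omega> = Max ((\<lambda>k. \<bar>partial_sum X k \<omega>\<bar>) ` {1..n})"

text \<open>The series has nonnegative terms and may diverge, so it is taken in \<open>[0, \<infinity>]\<close>; its index is
  shifted so that \<open>Suc n\<close> runs over \<open>1, 2, \<dots>\<close>.\<close>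

definition weighted_series ::
  "'a measure \<Rightarrow> (nat \<Rightarrow> 'a \<Rightarrow> real) \<Rightarrow> real \<Rightarrow> real \<Rightarrow> real \<Rightarrow> (nat \<Rightarrow> real \<Rightarrow> real) \<Rightarrow> real \<Rightarrow> ennreal"
  where
  "weighted_series M X \<sigma> r a b \<epsilon> =
     (\<Sum>n. (\<lambda>m. ennreal (real m powr (r - 2) * lg (real m) powr a *
        measure M {\<omega> \<in> space M. max_abs_sum X m \<omega> \<le> \<sigma> * phi (real m) * (\<epsilon> + b m \<epsilon>)})) (Suc n))"

text \<open>The joint limit \<open>n \<rightarrow> \<infinity>\<close>, \<open>\<epsilon> \<nearrow> 1 / sqrt (r - 1)\<close>. Only \<open>b n \<epsilon>\<close> for \<open>\<epsilon>\<close> just below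
  \<open>1 / sqrt (r - 1)\<close> (in particular, for positive \<open>\<epsilon>\<close>) matters.\<close>

definition perturbation :: "real \<Rightarrow> real \<Rightarrow> (nat \<Rightarrow> real \<Rightarrow> real) \<Rightarrow> bool" where
  "perturbation r \<tau> b \<longleftrightarrow>
     ((\<lambda>(n, \<epsilon>). b n \<epsilon> * lg (real n)) \<longlongrightarrow> \<tau>)
       (sequentially \<times>\<^sub>F at_left (1 / sqrt (r - 1)))"

text \<open>As the limit is finite, convergence in \<open>[0, \<infinity>]\<close> entails that the series converges
  for all \<open>\<epsilon>\<close> sufficiently close to \<open>1 / sqrt (r - 1)\<close> from below.\<close>

definition precise_asymptotics ::
  "'a measure \<Rightarrow> (nat \<Rightarrow> 'a \<Rightarrow> real) \<Rightarrow> real \<Rightarrow> real \<Rightarrow> real \<Rightarrow> real \<Rightarrow> (nat \<Rightarrow> real \<Rightarrow> real) \<Rightarrow> bool"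
  where
  "precise_asymptotics M X \<sigma> r a \<tau> b \<longleftrightarrow>
     ((\<lambda>\<epsilon>. ennreal ((1 / \<epsilon>\<^sup>2 - (r - 1)) powr (a + 1)) * weighted_series M X \<sigma> r a b \<epsilon>)
       \<longlongrightarrow> ennreal (4 / pi * exp (2 * \<tau> * (r - 1) powr (3/2)) * Gamma (a + 1)))
       (at_left (1 / sqrt (r - 1)))"

end

theory Submission
  imports Defs "HOL-Real_Asymp.Real_Asymp"
begin

text \<open>Write \<open>p\<close> for the probability that a walk stays in \<open>[-x, x]\<close> for \<open>n\<close> steps and \<open>t = pi / (2 x)\<close>.
  The function \<open>cos (t s)\<close> is an approximate eigenfunction of the walk killed outside \<open>[-x, x]\<close>, with eigenvalue
  the real part of the characteristic function at \<open>t\<close>, and so are the higher harmonics \<open>cos ((2 k + 1) t s)\<close>, with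
  smaller eigenvalues. Expanding the indicator of \<open>[-x, x]\<close> in these harmonics, where the first one has coefficient
  \<open>4 / pi\<close>, gives \<open>p exp (n t\<^sup>2 \<sigma>\<^sup>2 / 2) \<longlonglongrightarrow> 4 / pi\<close> in the range of moderate deviations. For
  \<open>x = \<sigma> phi n (\<epsilon> + a\<^sub>n)\<close> the exponential is \<open>n\<close> to the power \<open>1 / \<epsilon>\<^sup>2\<close> up to a convergent factor, and the
  series is compared with the Gamma integral in the variable \<open>ln n\<close>.

  For the converse, an infinite variance or a nonzero mean makes \<open>p\<close> decay faster than every power of \<open>n\<close>, as can be
  seen from blocks of \<open>n / (A ln n)\<close> steps, while a finite variance other than \<open>\<sigma>\<^sup>2\<close> changes the power of \<open>n\<close>; in
  all cases the normalised series tends to \<open>0\<close> or is infinite.\<close>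

section \<open>The walk killed outside an interval\<close>

text \<open>The obstacle is the overshoot. A step may leave [-x, x] for a point where
  \<open>cos (t * s)\<close> has any sign, so the eigenvalue relation holds only up to exit terms
  and, as the law may be asymmetric, a sine term. For jumps of at most \<open>2 * x\<close> the exit
  point lies where the first harmonic is nonpositive: such exits only add to it, and the amount
  added bounds the exit terms of all harmonics. Longer jumps and the sine term cost a multiple of
  \<open>t powr (2 + \<eta>)\<close> per step, relative to the probability of staying. Near the ends
  of the interval the first harmonic does not control that probability, so a bound with a loss of
  \<open>t powr - kap\<close> comes before the sharp one; inside the error terms this loss is
  harmless, because \<open>n * t\<^sup>2\<close> is only of order \<open>ln n\<close>. A second
  difficulty is that no finite sum of harmonics is close to the indicator up to the ends. In the
  converse at most second moments are at hand, but crude exponents suffice there, since any fixed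
  change of the power of \<open>n\<close> destroys the limit.\<close>

locale iid_walk = prob_space M for M :: "'a measure" +
  fixes X :: "nat \<Rightarrow> 'a \<Rightarrow> real"
  assumes indep: "indep_vars (\<lambda>_. borel) X UNIV"
    and ident: "\<And>k. distr M borel (X k) = distr M borel (X 0)"
begin

lemma X_measurable [measurable]: "X k \<in> borel_measurable M"
  using indep unfolding indep_vars_def by auto

lemma partial_sum_measurable [measurable]: "partial_sum X n \<in> borel_measurable M"
  unfolding partial_sum_def[abs_def] by measurable

lemma partial_sum_0 [simp]: "partial_sum X 0 \<omega> = 0"
  by (simp add: partial_sum_def)

lemma partial_sum_Suc: "partial_sum X (Suc n) \<omega> = partial_sum X n \<omega> + X (Suc n) \<omega>"
  by (simp add: partial_sum_def)

text \<open>At \<open>n = 0\<close> there is no constraint, whatever the sign of \<open>x\<close>,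
  so that recursions can start from probability 1; a \<open>Max\<close> over the empty set would
  give nothing usable there.\<close>

definition stay :: "real \<Rightarrow> nat \<Rightarrow> 'a set" where
  "stay x n = {\<omega> \<in> space M. \<forall>k\<in>{1..n}. \<bar>partial_sum X k \<omega>\<bar> \<le> x}"

lemma stay_sets [measurable]: "stay x n \<in> sets M"
  unfolding stay_def by measurable

lemma stay_0 [simp]: "stay x 0 = space M"
  by (auto simp: stay_def)

lemma stay_antimono: "m \<le> n \<Longrightarrow> stay x n \<subseteq> stay x m"
  by (auto simp: stay_def)

lemma stay_Suc: "stay x (Suc n) = {\<omega> \<in> stay x n. \<bar>partial_sum X (Suc n) \<omega>\<bar> \<le> x}"
  by (auto simp: stay_def le_Suc_eq)

lemma stay_bound: "\<omega> \<in> stay x n \<Longrightarrow> 0 \<le> x \<Longrightarrow> \<bar>partial_sum X n \<omega>\<bar> \<le> x"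
  by (cases n) (auto simp: stay_def)

lemma max_abs_sum_le_eq_stay:
  assumes "n \<ge> 1"
  shows "{\<omega> \<in> space M. max_abs_sum X n \<omega> \<le> x} = stay x n"
  using assms by (auto simp: stay_def max_abs_sum_def)

abbreviation pstay :: "real \<Rightarrow> nat \<Rightarrow> real" where
  "pstay x n \<equiv> prob (stay x n)"

lemma pstay_antimono: "m \<le> n \<Longrightarrow> pstay x n \<le> pstay x m"
  by (intro finite_measure_mono stay_antimono) auto

lemma expectation_ident:
  fixes f :: "real \<Rightarrow> 'b::{banach, second_countable_topology}"
  assumes [measurable]: "f \<in> borel_measurable borel"
  shows "expectation (\<lambda>\<omega>. f (X k \<omega>)) = expectation (\<lambda>\<omega>. f (X 0 \<omega>))"
proof -
  have "expectation (\<lambda>\<omega>. f (X k \<omega>)) = integral\<^sup>L (distr M borel (X k)) f"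
    by (subst integral_distr) auto
  also have "\<dots> = integral\<^sup>L (distr M borel (X 0)) f"
    by (simp only: ident[of k])
  also have "\<dots> = expectation (\<lambda>\<omega>. f (X 0 \<omega>))"
    by (subst integral_distr) auto
  finally show ?thesis .
qed

text \<open>The event and the partial sum are a function \<open>F\<close> of the coordinates up to
  \<open>l\<close>, and \<open>g\<close> reads coordinate \<open>l + 1\<close> alone, so
  independence of the two restrictions applies. Allowing \<open>j < l\<close> lets the walk run
  unconstrained after time \<open>j\<close>, as the block estimates require; the scalar type covers
  cosines as well as complex exponentials.\<close>

lemma expectation_stay_mult:
  fixes f g :: "real \<Rightarrow> 'b::{real_normed_field, banach, second_countable_topology}"
  assumes "j \<le> l"
    and [measurable]: "f \<in> borel_measurable borel" "g \<in> borel_measurable borel"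
    and bf: "\<And>s. norm (f s) \<le> K" and bg: "\<And>s. norm (g s) \<le> L"
  shows "expectation (\<lambda>\<omega>. of_real (indicator (stay x j) \<omega>) * f (partial_sum X l \<omega>) * g (X (Suc l) \<omega>))
    = expectation (\<lambda>\<omega>. of_real (indicator (stay x j) \<omega>) * f (partial_sum X l \<omega>))
      * expectation (\<lambda>\<omega>. g (X 0 \<omega>))"
proof -
  define R1 where "R1 = (\<lambda>\<omega>. restrict (\<lambda>i. X i \<omega>) {1..l})"
  define R2 where "R2 = (\<lambda>\<omega>. restrict (\<lambda>i. X i \<omega>) {Suc l})"
  define F where "F = (\<lambda>h :: nat \<Rightarrow> real. if \<forall>k\<in>{1..j}. \<bar>\<Sum>i=1..k. h i\<bar> \<le> x then f (\<Sum>i=1..l. h i) else 0)"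
  define G where "G = (\<lambda>h :: nat \<Rightarrow> real. g (h (Suc l)))"
  have ind: "indep_var (PiM {1..l} (\<lambda>_. borel)) R1 (PiM {Suc l} (\<lambda>_. borel)) R2"
    unfolding R1_def R2_def by (rule indep_var_restrict[OF indep]) auto
  have summ: "(\<lambda>h. \<Sum>i=1..k. h i) \<in> borel_measurable (PiM {1..l} (\<lambda>_. borel :: real measure))"
    if "k \<le> l" for k
    using that by (intro borel_measurable_sum measurable_component_singleton) auto
  have Fm: "F \<in> borel_measurable (PiM {1..l} (\<lambda>_. borel))"
    unfolding F_def
  proof (intro measurable_If)
    have "Measurable.pred (Pi\<^sub>M {1..l} (\<lambda>_. borel)) (\<lambda>h :: nat \<Rightarrow> real. \<forall>k\<in>{1..j}. \<bar>\<Sum>i=1..k. h i\<bar> \<le> x)"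
    proof (rule pred_intros_finite(3))
      fix k assume k: "k \<in> {1..j}"
      then have "k \<le> l" using assms(1) by auto
      then have [measurable]: "(\<lambda>h. \<Sum>i=1..k. h i) \<in> borel_measurable (PiM {1..l} (\<lambda>_. borel :: real measure))"
        by (rule summ)
      show "Measurable.pred (Pi\<^sub>M {1..l} (\<lambda>_. borel)) (\<lambda>h :: nat \<Rightarrow> real. \<bar>\<Sum>i=1..k. h i\<bar> \<le> x)"
        by measurable
    qed auto
    then show "{h \<in> space (Pi\<^sub>M {1..l} (\<lambda>_. borel)). \<forall>k\<in>{1..j}. \<bar>\<Sum>i=1..k. h i :: real\<bar> \<le> x} \<in> sets (Pi\<^sub>M {1..l} (\<lambda>_. borel))"
      by (simp add: pred_def)
    have [measurable]: "(\<lambda>h. \<Sum>i=1..l. h i) \<in> borel_measurable (PiM {1..l} (\<lambda>_. borel :: real measure))"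
      by (rule summ) simp
    show "(\<lambda>h. f (\<Sum>i=1..l. h i)) \<in> borel_measurable (Pi\<^sub>M {1..l} (\<lambda>_. borel))"
      by measurable
  qed auto
  have Gm: "G \<in> borel_measurable (PiM {Suc l} (\<lambda>_. borel))"
    unfolding G_def by measurable
  have ind': "indep_var borel (F \<circ> R1) borel (G \<circ> R2)"
    by (rule indep_var_compose[OF ind Fm Gm])
  have F1: "(F \<circ> R1) \<omega> = of_real (indicator (stay x j) \<omega>) * f (partial_sum X l \<omega>)" if "\<omega> \<in> space M" for \<omega>
  proof -
    have *: "(\<Sum>i=1..k. R1 \<omega> i) = partial_sum X k \<omega>" if "k \<le> l" for k
      unfolding R1_def partial_sum_def using that by (intro sum.cong) auto
    have "(\<forall>k\<in>{1..j}. \<bar>\<Sum>i=1..k. R1 \<omega> i\<bar> \<le> x) \<longleftrightarrow> \<omega> \<in> stay x j"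
    proof -
      have "(\<forall>k\<in>{1..j}. \<bar>\<Sum>i=1..k. R1 \<omega> i\<bar> \<le> x) \<longleftrightarrow> (\<forall>k\<in>{1..j}. \<bar>partial_sum X k \<omega>\<bar> \<le> x)"
        using assms(1) by (intro ball_cong refl) (subst *, auto)
      then show ?thesis unfolding stay_def using that by blast
    qed
    then show ?thesis using *[of l] by (simp add: F_def indicator_def)
  qed
  have G1: "(G \<circ> R2) \<omega> = g (X (Suc l) \<omega>)" for \<omega>
    by (simp add: G_def R2_def)
  have i1: "integrable M (F \<circ> R1)"
  proof (rule integrable_const_bound[where B="max K 0"])
    show "F \<circ> R1 \<in> borel_measurable M"
      by (rule measurable_comp[OF indep_var_rv1[OF ind] Fm])
  qed (use bf in \<open>auto simp: F_def intro: max.coboundedI1\<close>)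
  have i2: "integrable M (G \<circ> R2)"
  proof (rule integrable_const_bound[where B=L])
    show "G \<circ> R2 \<in> borel_measurable M"
      by (rule measurable_comp[OF indep_var_rv2[OF ind] Gm])
  qed (use bg in \<open>auto simp: G_def\<close>)
  have "expectation (\<lambda>\<omega>. of_real (indicator (stay x j) \<omega>) * f (partial_sum X l \<omega>) * g (X (Suc l) \<omega>))
    = expectation (\<lambda>\<omega>. (F \<circ> R1) \<omega> * (G \<circ> R2) \<omega>)"
    by (intro Bochner_Integration.integral_cong refl) (simp add: F1[symmetric] G1[symmetric] del: o_apply)
  also have "\<dots> = expectation (F \<circ> R1) * expectation (G \<circ> R2)"
    by (rule indep_var_lebesgue_integral[OF ind' i1 i2])
  also have "expectation (F \<circ> R1) = expectation (\<lambda>\<omega>. of_real (indicator (stay x j) \<omega>) * f (partial_sum X l \<omega>))"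
    by (intro Bochner_Integration.integral_cong refl F1)
  also have "expectation (G \<circ> R2) = expectation (\<lambda>\<omega>. g (X (Suc l) \<omega>))"
    by (intro Bochner_Integration.integral_cong refl G1)
  also have "\<dots> = expectation (\<lambda>\<omega>. g (X 0 \<omega>))"
    by (rule expectation_ident) simp
  finally show ?thesis .
qed

text \<open>Two time indices: the constraint is imposed up to \<open>j\<close>, the function is
  evaluated at \<open>l\<close>. Passing from \<open>(j, j)\<close> to \<open>(j, j + 1)\<close> is
  exact algebra; passing on to \<open>(j + 1, j + 1)\<close> loses the exit term.\<close>

definition ev :: "real \<Rightarrow> nat \<Rightarrow> (real \<Rightarrow> real) \<Rightarrow> nat \<Rightarrow> real" where
  "ev x j f l = expectation (\<lambda>\<omega>. indicator (stay x j) \<omega> * f (partial_sum X l \<omega>))"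

definition exit_ev :: "real \<Rightarrow> nat \<Rightarrow> (real \<Rightarrow> real) \<Rightarrow> real" where
  "exit_ev x j f = expectation (\<lambda>\<omega>. indicator (stay x j - stay x (Suc j)) \<omega> * f (partial_sum X (Suc j) \<omega>))"

text \<open>Real and imaginary part of the characteristic function \<open>psi\<close>:
  \<open>cosm t\<close> acts as the eigenvalue of \<open>cos (t * s)\<close>, and
  \<open>sinm t\<close> measures the asymmetry of the law.\<close>

definition cosm :: "real \<Rightarrow> real" where "cosm t = expectation (\<lambda>\<omega>. cos (t * X 0 \<omega>))"
definition sinm :: "real \<Rightarrow> real" where "sinm t = expectation (\<lambda>\<omega>. sin (t * X 0 \<omega>))"
definition psi :: "real \<Rightarrow> complex" where "psi t = expectation (\<lambda>\<omega>. iexp (t * X 0 \<omega>))"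

lemma integrable_stay [intro]:
  assumes [measurable]: "f \<in> borel_measurable borel" "A \<in> sets M" and "\<And>s. \<bar>f s\<bar> \<le> K"
  shows "integrable M (\<lambda>\<omega>. indicator A \<omega> * f (partial_sum X l \<omega>) :: real)"
proof (rule integrable_const_bound[where B="max K 0"])
  show "AE \<omega> in M. norm (indicator A \<omega> * f (partial_sum X l \<omega>)) \<le> max K 0"
    using assms(3) by (auto simp: indicator_def intro: max.coboundedI1)
qed measurable

lemma ev_Suc:
  assumes [measurable]: "f \<in> borel_measurable borel" and "\<And>s. \<bar>f s\<bar> \<le> K"
  shows "ev x (Suc j) f (Suc j) = ev x j f (Suc j) - exit_ev x j f"
proof -
  have "ev x (Suc j) f (Suc j) + exit_ev x j f = expectation (\<lambda>\<omega>. indicator (stay x (Suc j)) \<omega> * f (partial_sum X (Suc j) \<omega>)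
      + indicator (stay x j - stay x (Suc j)) \<omega> * f (partial_sum X (Suc j) \<omega>))"
    unfolding ev_def exit_ev_def
    by (rule Bochner_Integration.integral_add[symmetric]) (rule integrable_stay; (fact assms | measurable))+
  also have "\<dots> = ev x j f (Suc j)"
    unfolding ev_def
    by (intro Bochner_Integration.integral_cong refl) (auto simp: stay_Suc indicator_def)
  finally have "ev x (Suc j) f (Suc j) + exit_ev x j f = ev x j f (Suc j)" .
  then show ?thesis by simp
qed

lemma ev_0: "f 0 = 1 \<Longrightarrow> ev x 0 f 0 = 1"
  by (simp add: ev_def cong: Bochner_Integration.integral_cong)
     (use prob_space in \<open>simp add: prob_space\<close>)

lemma ev_one: "ev x j (\<lambda>_. 1) l = pstay x j"
  by (simp add: ev_def)

lemma ev_mono: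
  assumes [measurable]: "f \<in> borel_measurable borel" "g \<in> borel_measurable borel"
    and "\<And>s. \<bar>f s\<bar> \<le> K" "\<And>s. \<bar>g s\<bar> \<le> L" and "0 \<le> x" and le: "\<And>s. \<bar>s\<bar> \<le> x \<Longrightarrow> f s \<le> g s"
  shows "ev x j f j \<le> ev x j g j"
  unfolding ev_def
proof (intro integral_mono integrable_stay)
  fix \<omega> assume "\<omega> \<in> space M"
  show "indicator (stay x j) \<omega> * f (partial_sum X j \<omega>) \<le> indicator (stay x j) \<omega> * g (partial_sum X j \<omega>)"
    using stay_bound[of \<omega> x j] assms(5) le by (auto simp: indicator_def)
qed (use assms in auto)

lemma ev_mono_all:
  assumes [measurable]: "f \<in> borel_measurable borel" "g \<in> borel_measurable borel"
    and "\<And>s. \<bar>f s\<bar> \<le> K" "\<And>s. \<bar>g s\<bar> \<le> L" and le: "\<And>s. f s \<le> g s"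
  shows "ev x j f l \<le> ev x j g l"
  unfolding ev_def
  by (intro integral_mono integrable_stay) (use assms in \<open>auto simp: indicator_def\<close>)

lemma ev_add:
  assumes "f \<in> borel_measurable borel" "g \<in> borel_measurable borel"
    and "\<And>s. \<bar>f s\<bar> \<le> K" "\<And>s. \<bar>g s\<bar> \<le> L"
  shows "ev x j (\<lambda>s. f s + g s) l = ev x j f l + ev x j g l"
  unfolding ev_def distrib_left
  by (rule Bochner_Integration.integral_add) (rule integrable_stay; fact assms stay_sets)+

lemma ev_cmult: "ev x j (\<lambda>s. c * f s) l = c * ev x j f l"
  unfolding ev_def by (subst integral_mult_right_zero[symmetric]) (simp add: algebra_simps)

lemma ev_sum:
  assumes "\<And>k. k \<in> A \<Longrightarrow> f k \<in> borel_measurable borel" "\<And>k s. k \<in> A \<Longrightarrow> \<bar>f k s\<bar> \<le> K k"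
  shows "ev x j (\<lambda>s. \<Sum>k\<in>A. f k s) l = (\<Sum>k\<in>A. ev x j (f k) l)"
  unfolding ev_def
  by (subst Bochner_Integration.integral_sum[symmetric])
     (auto intro!: integrable_stay assms simp: sum_distrib_left)

lemma abs_ev_le:
  assumes [measurable]: "f \<in> borel_measurable borel" and "\<And>s. \<bar>f s\<bar> \<le> K"
  shows "\<bar>ev x j f l\<bar> \<le> K * pstay x j"
proof -
  have K: "0 \<le> K" using assms(2)[of 0] by simp
  have "f s \<le> K * 1" "- K * 1 \<le> f s" for s
    using assms(2)[of s] by auto
  then have "ev x j f l \<le> ev x j (\<lambda>_. K * 1) l" "ev x j (\<lambda>_. - K * 1) l \<le> ev x j f l"
    using K by (intro ev_mono_all[where K=K and L=K] assms; simp)+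
  then show ?thesis unfolding ev_cmult ev_one by simp
qed

text \<open>The addition theorem splits off the new step, which is independent of the past. The sine
  term vanishes for symmetric laws; in general it is an error, small when the mean is zero.\<close>

lemma ev_cos_Suc:
  assumes "j \<le> l"
  shows "ev x j (\<lambda>s. cos (t * s)) (Suc l)
    = cosm t * ev x j (\<lambda>s. cos (t * s)) l - sinm t * ev x j (\<lambda>s. sin (t * s)) l"
proof -
  have *: "expectation (\<lambda>\<omega>. indicator (stay x j) \<omega> * cos (t * partial_sum X l \<omega>) * cos (t * X (Suc l) \<omega>))
     = ev x j (\<lambda>s. cos (t * s)) l * cosm t"
    unfolding ev_def cosm_def
    using expectation_stay_mult[where f="\<lambda>s. cos (t * s)" and g="\<lambda>s. cos (t * s)" and K=1 and L=1 and j=j and l=l and x=x] assms by simp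
  have **: "expectation (\<lambda>\<omega>. indicator (stay x j) \<omega> * sin (t * partial_sum X l \<omega>) * sin (t * X (Suc l) \<omega>))
     = ev x j (\<lambda>s. sin (t * s)) l * sinm t"
    unfolding ev_def sinm_def
    using expectation_stay_mult[where f="\<lambda>s. sin (t * s)" and g="\<lambda>s. sin (t * s)" and K=1 and L=1 and j=j and l=l and x=x] assms by simp
  have b: "\<bar>indicator (stay x j) \<omega> * u * v\<bar> \<le> 1" if "\<bar>u\<bar> \<le> 1" "\<bar>v\<bar> \<le> 1" for u v :: real and \<omega>
    using mult_mono[OF that] by (auto simp: indicator_def abs_mult)
  have "ev x j (\<lambda>s. cos (t * s)) (Suc l) =
    expectation (\<lambda>\<omega>. indicator (stay x j) \<omega> * cos (t * partial_sum X l \<omega>) * cos (t * X (Suc l) \<omega>)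
      - indicator (stay x j) \<omega> * sin (t * partial_sum X l \<omega>) * sin (t * X (Suc l) \<omega>))"
    unfolding ev_def
    by (intro Bochner_Integration.integral_cong refl)
       (simp add: partial_sum_Suc distrib_left cos_add algebra_simps)
  also have "\<dots> = expectation (\<lambda>\<omega>. indicator (stay x j) \<omega> * cos (t * partial_sum X l \<omega>) * cos (t * X (Suc l) \<omega>))
      - expectation (\<lambda>\<omega>. indicator (stay x j) \<omega> * sin (t * partial_sum X l \<omega>) * sin (t * X (Suc l) \<omega>))"
    by (intro Bochner_Integration.integral_diff integrable_const_bound[where B=1])
       (measurable, auto intro!: b AE_I2)
  finally show ?thesis unfolding * ** by (simp only: mult.commute)
qed

lemma prob_stay_jump:
  "expectation (\<lambda>\<omega>. indicator (stay x j) \<omega> * indicator {v. \<bar>v\<bar> > y} (X (Suc j) \<omega>))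
    = pstay x j * prob {\<omega> \<in> space M. \<bar>X 0 \<omega>\<bar> > y}"
proof -
  have "expectation (\<lambda>\<omega>. indicator {v. \<bar>v\<bar> > y} (X 0 \<omega>)) = prob {\<omega> \<in> space M. \<bar>X 0 \<omega>\<bar> > y}"
  proof -
    have "expectation (\<lambda>\<omega>. indicator {v. \<bar>v\<bar> > y} (X 0 \<omega>)) = expectation (indicat_real {\<omega> \<in> space M. \<bar>X 0 \<omega>\<bar> > y})"
      by (intro Bochner_Integration.integral_cong refl) (simp add: indicator_def)
    then show ?thesis by (simp add: Int_def conj_commute)
  qed
  then show ?thesis
    using expectation_stay_mult[where f="\<lambda>_. 1::real" and g="indicator {v. \<bar>v\<bar> > y}" and K=1 and L=1 and j=j and l=j and x=x]
    by simp
qed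

text \<open>A jump beyond \<open>y\<close> is the only way to leave \<open>[-x, x]\<close> for a point where \<open>- f\<close> fails to dominate \<open>h\<close>.\<close>

lemma exit_ev_le:
  assumes [measurable]: "f \<in> borel_measurable borel" "h \<in> borel_measurable borel"
    and "\<And>s. \<bar>f s\<bar> \<le> K" "\<And>s. \<bar>h s\<bar> \<le> L" and "0 \<le> x"
    and le: "\<And>s v. \<bar>s\<bar> \<le> x \<Longrightarrow> \<bar>v\<bar> > x \<Longrightarrow> f v \<le> - h v + (if \<bar>v - s\<bar> > y then c else 0)"
  shows "exit_ev x j f \<le> - exit_ev x j h + max c 0 * (pstay x j * prob {\<omega> \<in> space M. \<bar>X 0 \<omega>\<bar> > y})"
proof -
  define A where "A = stay x j - stay x (Suc j)"
  have [measurable]: "A \<in> sets M" by (simp add: A_def)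
  have "exit_ev x j f + exit_ev x j h =
     expectation (\<lambda>\<omega>. indicator A \<omega> * (f (partial_sum X (Suc j) \<omega>) + h (partial_sum X (Suc j) \<omega>)))"
    unfolding exit_ev_def A_def[symmetric]
    by (subst Bochner_Integration.integral_add[symmetric])
       (auto intro!: integrable_stay assms simp: distrib_left)
  also have "\<dots> \<le> expectation (\<lambda>\<omega>. max c 0 * (indicator (stay x j) \<omega> * indicator {v. \<bar>v\<bar> > y} (X (Suc j) \<omega>)))"
  proof (intro integral_mono)
    show "integrable M (\<lambda>\<omega>. indicator A \<omega> * (f (partial_sum X (Suc j) \<omega>) + h (partial_sum X (Suc j) \<omega>)))"
      unfolding distrib_left
      by (intro Bochner_Integration.integrable_add integrable_stay) (use assms in auto)
    show "integrable M (\<lambda>\<omega>. max c 0 * (indicator (stay x j) \<omega> * indicator {v. \<bar>v\<bar> > y} (X (Suc j) \<omega>)))"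
      by (intro integrable_const_bound[where B="max c 0"]) (auto simp: indicator_def)
    fix \<omega> assume "\<omega> \<in> space M"
    show "indicator A \<omega> * (f (partial_sum X (Suc j) \<omega>) + h (partial_sum X (Suc j) \<omega>))
       \<le> max c 0 * (indicator (stay x j) \<omega> * indicator {v. \<bar>v\<bar> > y} (X (Suc j) \<omega>))"
    proof (cases "\<omega> \<in> A")
      case True
      then have 1: "\<omega> \<in> stay x j" and 2: "\<bar>partial_sum X (Suc j) \<omega>\<bar> > x"
        by (auto simp: A_def stay_Suc)
      have "f (partial_sum X (Suc j) \<omega>) + h (partial_sum X (Suc j) \<omega>)
         \<le> (if \<bar>X (Suc j) \<omega>\<bar> > y then c else 0)"
        using le[OF stay_bound[OF 1 \<open>0 \<le> x\<close>] 2] by (simp add: partial_sum_Suc split: if_splits)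
      then show ?thesis using True 1 by (auto simp: indicator_def split: if_splits)
    qed (auto simp: indicator_def)
  qed
  also have "\<dots> = max c 0 * (pstay x j * prob {\<omega> \<in> space M. \<bar>X 0 \<omega>\<bar> > y})"
    by (simp add: prob_stay_jump)
  finally show ?thesis by simp
qed

end

section \<open>Odd cosine polynomials approximating a square wave\<close>

text \<open>The Taylor coefficients of \<open>1 / sqrt (1 - z)\<close>, hence those of
  \<open>1 / cos u\<close> in powers of \<open>z = (sin u)\<^sup>2\<close>. They are also the mean
  values of \<open>sin u ^ (2 * n)\<close> over a period, and in this role they return in
  \<open>ev_sin_power_block_le\<close>.\<close>

definition central_coeff :: "nat \<Rightarrow> real" where
  "central_coeff n = real (2 * n choose n) / 4 ^ n"

lemma central_coeff_0 [simp]: "central_coeff 0 = 1"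
  by (simp add: central_coeff_def)

lemma central_coeff_Suc: "central_coeff (Suc n) * (2 * real n + 2) = central_coeff n * (2 * real n + 1)"
proof -
  have 1: "real (2 * Suc n choose Suc n) = fact (2 * n + 2) / (fact (Suc n) * fact (Suc n))"
    by (subst binomial_fact) (auto simp del: fact_Suc simp: mult_2)
  have 2: "real (2 * n choose n) = fact (2 * n) / (fact n * fact n)"
    by (subst binomial_fact) (auto simp: mult_2)
  have f: "fact (2 * n + 2) = (2 * real n + 2) * (2 * real n + 1) * fact (2 * n)"
    by (simp add: algebra_simps)
  have g: "fact (Suc n) = (real n + 1) * fact n"
    by simp
  have p: "(fact n :: real) \<noteq> 0" "real n + 1 \<noteq> 0" by (auto simp: add_eq_0_iff)
  have q: "2 * e * w * b / (e * c * (e * c)) / (4 * d) * (2 * e) = b / (c * c) / d * w"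
    if "e \<noteq> 0" "c \<noteq> 0" "d \<noteq> 0" for w b c d e :: real
    using that by (simp add: divide_simps)
  have r: "2 * real n + 2 = 2 * (real n + 1)" by simp
  show ?thesis
    unfolding central_coeff_def 1 2 f g power_Suc r by (rule q) (use p in auto)
qed

lemma central_coeff_pos: "0 < central_coeff n"
  by (simp add: central_coeff_def)

text \<open>The squared ratio of consecutive coefficients is at most
  \<open>(2 n + 1) / (2 n + 3)\<close>, because
  \<open>(2 n + 1) (2 n + 3) \<le> (2 n + 2)\<^sup>2\<close>; the product of these ratios
  telescopes.\<close>

lemma central_coeff_le: "(central_coeff n)\<^sup>2 \<le> 1 / (2 * real n + 1)"
proof (induction n)
  case (Suc n)
  have e: "central_coeff (Suc n) = central_coeff n * (2 * real n + 1) / (2 * real n + 2)"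
    using central_coeff_Suc[of n] by (simp add: field_simps)
  have "(central_coeff (Suc n))\<^sup>2 = (central_coeff n)\<^sup>2 * ((2 * real n + 1) / (2 * real n + 2))\<^sup>2"
    unfolding e by (simp add: power_mult_distrib power_divide)
  also have "\<dots> \<le> 1 / (2 * real n + 1) * ((2 * real n + 1) / (2 * real n + 2))\<^sup>2"
    by (intro mult_right_mono Suc) auto
  also have "\<dots> \<le> 1 / (2 * real (Suc n) + 1)"
    by (simp add: divide_simps power2_eq_square) (simp add: algebra_simps)
  finally show ?case .
qed simp

lemma central_coeff_le_1: "central_coeff n \<le> 1"
proof -
  have "(central_coeff n)\<^sup>2 \<le> 1\<^sup>2"
    by (rule order_trans[OF central_coeff_le]) simp
  then show ?thesis by (rule power2_le_imp_le) simp
qed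

lemma central_coeff_tendsto_0: "central_coeff \<longlonglongrightarrow> 0"
proof (rule real_tendsto_sandwich[where f="\<lambda>_. 0" and h="\<lambda>n. sqrt (1 / (2 * real n + 1))"])
  show "\<forall>\<^sub>F n in sequentially. central_coeff n \<le> sqrt (1 / (2 * real n + 1))"
    by (intro always_eventually allI real_le_rsqrt central_coeff_le)
  show "(\<lambda>n. sqrt (1 / (2 * real n + 1))) \<longlonglongrightarrow> 0"
    by real_asymp
  show "\<forall>\<^sub>F n in sequentially. 0 \<le> central_coeff n"
    by (intro always_eventually allI less_imp_le central_coeff_pos)
qed auto

text \<open>The partial sums of the expansion of \<open>1 / cos u\<close> in powers of \<open>sin\<^sup>2 u\<close>, multiplied by \<open>cos u\<close>:
  odd cosine polynomials approximating the indicator of \<open>[-pi/2, pi/2]\<close> on that interval.\<close>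

definition square_wave :: "nat \<Rightarrow> real \<Rightarrow> real" where
  "square_wave N u = cos u * (\<Sum>i<N. central_coeff i * sin u ^ (2 * i))"

text \<open>The full series sums to the constant 1, so the derivative of a partial sum consists of a
  remainder only: by \<open>central_coeff_Suc\<close> each new term cancels the remainder left so
  far and leaves one with a higher power of the sine.\<close>

lemma square_wave_deriv:
  "(square_wave (Suc N) has_real_derivative
     - (2 * real N + 2) * central_coeff (Suc N) * sin u ^ (2 * N + 1)) (at u)"
proof (induction N)
  case 0
  have "square_wave (Suc 0) = cos" by (auto simp: square_wave_def)
  moreover have "central_coeff (Suc 0) = 1 / 2" by (simp add: central_coeff_def)
  ultimately show ?case by (auto intro!: derivative_eq_intros)
next
  case (Suc N)
  let ?c = "central_coeff (Suc N)"
  have e: "square_wave (Suc (Suc N)) = (\<lambda>u. square_wave (Suc N) u + ?c * (cos u * sin u ^ (2 * N + 2)))"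
    by (auto simp: square_wave_def algebra_simps)
  have "(square_wave (Suc (Suc N)) has_real_derivative
      - (2 * real N + 2) * ?c * sin u ^ (2 * N + 1)
      + ?c * (- sin u * sin u ^ (2 * N + 2) + cos u * (real (2 * N + 2) * sin u ^ (2 * N + 1) * cos u))) (at u)"
    unfolding e by (rule derivative_eq_intros Suc refl | simp)+
  also have "- (2 * real N + 2) * ?c * sin u ^ (2 * N + 1)
      + ?c * (- sin u * sin u ^ (2 * N + 2) + cos u * (real (2 * N + 2) * sin u ^ (2 * N + 1) * cos u))
     = ?c * sin u ^ (2 * N + 1) * (- (2 * real N + 2) * (1 - (cos u)\<^sup>2) - (sin u)\<^sup>2)"
    by (simp add: algebra_simps power2_eq_square)
  also have "\<dots> = ?c * sin u ^ (2 * N + 1) * (- (2 * real N + 2) * (sin u)\<^sup>2 - (sin u)\<^sup>2)"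
    by (simp only: sin_squared_eq)
  also have "\<dots> = - (central_coeff (Suc N) * (2 * real (Suc N) + 1)) * sin u ^ (2 * Suc N + 1)"
    by (simp add: algebra_simps power2_eq_square)
  also have "\<dots> = - (2 * real (Suc N) + 2) * central_coeff (Suc (Suc N)) * sin u ^ (2 * Suc N + 1)"
    unfolding central_coeff_Suc[symmetric] by (simp add: algebra_simps)
  finally show ?case .
qed

text \<open>On [0, pi / 2] the derivative is nonpositive and the value at 0 is 1, which gives the
  first bound. For the second, the difference \<open>g\<close> of the two sides vanishes at 0 and at
  \<open>pi / 2\<close>, and its derivative has the sign of \<open>cos w - central_coeff N\<close>;
  so \<open>g\<close> rises up to the \<open>arccos\<close> of that coefficient and falls
  afterwards. Evenness covers negative arguments.\<close>

lemma square_wave_bounds: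
  assumes "N \<ge> 1" "\<bar>u\<bar> \<le> pi / 2"
  shows "0 \<le> 1 - square_wave N u" "1 - square_wave N u \<le> sin u ^ (2 * N)"
proof -
  obtain n where N: "N = Suc n" using assms(1) by (cases N) auto
  have ev: "square_wave N (- v) = square_wave N v" for v
    by (simp add: square_wave_def power_mult)
  have z: "square_wave N 0 = 1"
    by (simp add: square_wave_def N sum.lessThan_Suc_shift del: sum.lessThan_Suc)
  let ?c = "central_coeff N"
  have main: "0 \<le> 1 - square_wave N v \<and> 1 - square_wave N v \<le> sin v ^ (2 * N)"
    if v: "0 \<le> v" "v \<le> pi / 2" for v
  proof
    have "square_wave N v \<le> square_wave N 0"
    proof (rule DERIV_nonpos_imp_nonincreasing[OF v(1)])
      fix w assume w: "0 \<le> w" "w \<le> v"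
      have "0 \<le> sin w" using w v by (intro sin_ge_zero) auto
      then have "- (2 * real n + 2) * central_coeff (Suc n) * sin w ^ (2 * n + 1) \<le> 0"
        using central_coeff_pos[of "Suc n"] by (intro mult_nonpos_nonneg) (auto simp: mult_nonpos_nonneg)
      then show "\<exists>y. (square_wave N has_real_derivative y) (at w) \<and> y \<le> 0"
        using square_wave_deriv[of n w] N by blast
    qed
    then show "0 \<le> 1 - square_wave N v" by (simp add: z)
    define g where "g w = sin w ^ (2 * N) - 1 + square_wave N w" for w
    have dg: "(g has_real_derivative (2 * real n + 2) * sin w ^ (2 * n + 1) * (cos w - ?c)) (at w)" for w
      unfolding g_def N
      by (rule derivative_eq_intros square_wave_deriv refl | simp)+ (simp add: algebra_simps)
    define a where "a = arccos ?c"
    have c01: "0 \<le> ?c" "?c \<le> 1" using central_coeff_pos[of N] central_coeff_le_1[of N] by auto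
    have a: "0 \<le> a" "a \<le> pi / 2" "cos a = ?c"
      unfolding a_def by (rule arccos_lbound arccos_le_pi2 cos_arccos; use c01 in linarith)+
    have "0 \<le> g v"
    proof (cases "v \<le> a")
      case True
      have "g 0 \<le> g v"
      proof (rule DERIV_nonneg_imp_nondecreasing[OF v(1)])
        fix w assume w: "0 \<le> w" "w \<le> v"
        have "0 \<le> sin w" using w v by (intro sin_ge_zero) auto
        moreover have "cos a \<le> cos w" using w True a v by (intro cos_monotone_0_pi_le) auto
        ultimately show "\<exists>y. (g has_real_derivative y) (at w) \<and> 0 \<le> y"
          using dg[of w] a by (intro exI[of _ "(2 * real n + 2) * sin w ^ (2 * n + 1) * (cos w - ?c)"]) auto
      qed
      then show ?thesis using z N by (simp add: g_def)
    next
      case False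
      have "g (pi / 2) \<le> g v"
      proof (rule DERIV_nonpos_imp_nonincreasing[OF v(2)])
        fix w assume w: "v \<le> w" "w \<le> pi / 2"
        have "0 \<le> sin w" using w v by (intro sin_ge_zero) auto
        moreover have "cos w \<le> cos a" using w False a v by (intro cos_monotone_0_pi_le) auto
        ultimately show "\<exists>y. (g has_real_derivative y) (at w) \<and> y \<le> 0"
          using dg[of w] a
          by (intro exI[of _ "(2 * real n + 2) * sin w ^ (2 * n + 1) * (cos w - ?c)"])
             (auto intro!: mult_nonneg_nonpos)
      qed
      then show ?thesis by (simp add: g_def square_wave_def)
    qed
    then show "1 - square_wave N v \<le> sin v ^ (2 * N)" by (simp add: g_def)
  qed
  show "0 \<le> 1 - square_wave N u" "1 - square_wave N u \<le> sin u ^ (2 * N)"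
    using main[of "\<bar>u\<bar>"] assms(2) ev[of u]
    by (cases "u \<ge> 0"; simp add: power_mult)+
qed

section \<open>Odd cosine polynomials and the coefficient 4 / pi\<close>

definition odd_cos_poly :: "(real \<Rightarrow> real) \<Rightarrow> bool" where
  "odd_cos_poly f \<longleftrightarrow> (\<exists>c K. \<forall>u. f u = (\<Sum>k<K. c k * cos ((2 * real k + 1) * u)))"

lemma odd_cos_poly_cos: "odd_cos_poly (\<lambda>u. cos ((2 * real k + 1) * u))"
  unfolding odd_cos_poly_def
  by (rule exI[of _ "\<lambda>i. if i = k then 1 else 0"], rule exI[of _ "Suc k"])
     (auto simp: if_distrib[of "\<lambda>x. x * _"] cong: if_cong)

lemma odd_cos_poly_cmult: "odd_cos_poly f \<Longrightarrow> odd_cos_poly (\<lambda>u. a * f u)"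
  unfolding odd_cos_poly_def
proof (elim exE)
  fix c K assume "\<forall>u. f u = (\<Sum>k<K. c k * cos ((2 * real k + 1) * u))"
  then have "\<forall>u. a * f u = (\<Sum>k<K. (a * c k) * cos ((2 * real k + 1) * u))"
    by (simp add: sum_distrib_left mult.assoc)
  then show "\<exists>c K. \<forall>u. a * f u = (\<Sum>k<K. c k * cos ((2 * real k + 1) * u))"
    by (intro exI[of _ "\<lambda>k. a * c k"] exI[of _ K])
qed

lemma odd_cos_poly_add:
  assumes "odd_cos_poly f" "odd_cos_poly g"
  shows "odd_cos_poly (\<lambda>u. f u + g u)"
proof -
  obtain c K where f: "\<And>u. f u = (\<Sum>k<K. c k * cos ((2 * real k + 1) * u))"
    using assms(1) unfolding odd_cos_poly_def by blast
  obtain d L where g: "\<And>u. g u = (\<Sum>k<L. d k * cos ((2 * real k + 1) * u))"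
    using assms(2) unfolding odd_cos_poly_def by blast
  have pad: "(\<Sum>k<K. c k * cos ((2 * real k + 1) * u))
     = (\<Sum>k<max K L. (if k < K then c k else 0) * cos ((2 * real k + 1) * u))" for c :: "nat \<Rightarrow> real" and K L :: nat and u :: real
    by (rule sum.mono_neutral_cong_left) auto
  have "f u + g u = (\<Sum>k<max K L. ((if k < K then c k else 0) + (if k < L then d k else 0)) * cos ((2 * real k + 1) * u))" for u
    unfolding f g pad[where c=c and K=K and L=L] pad[where c=d and K=L and L=K] max.commute[of L K]
    by (simp only: sum.distrib[symmetric]) (intro sum.cong refl distrib_right[symmetric])
  then show ?thesis unfolding odd_cos_poly_def
    by (intro exI[of _ "\<lambda>k. (if k < K then c k else 0) + (if k < L then d k else 0)"] exI[of _ "max K L"]) simp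
qed

lemma odd_cos_poly_sum: "(\<And>i. i \<in> A \<Longrightarrow> odd_cos_poly (f i)) \<Longrightarrow> finite A \<Longrightarrow> odd_cos_poly (\<lambda>u. \<Sum>i\<in>A. f i u)"
proof (induction A rule: infinite_finite_induct)
  case empty
  show ?case unfolding odd_cos_poly_def by (rule exI, rule exI[of _ 0]) simp
qed (auto intro: odd_cos_poly_add)

text \<open>Multiplication by \<open>(sin u)\<^sup>2\<close> shifts frequencies by -2, 0 or 2, which
  keeps them odd. The shift of frequency 1 to -1 stays within the class because cosine is
  even.\<close>

lemma odd_cos_poly_sin2:
  assumes "odd_cos_poly f" shows "odd_cos_poly (\<lambda>u. (sin u)\<^sup>2 * f u)"
proof -
  have base: "odd_cos_poly (\<lambda>u. (sin u)\<^sup>2 * cos ((2 * real k + 1) * u))" for k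
  proof -
    have p: "odd_cos_poly (\<lambda>u. cos ((2 * real k - 1) * u))"
    proof (cases k)
      case 0
      then show ?thesis using odd_cos_poly_cos[of 0] by (simp)
    next
      case (Suc j)
      then show ?thesis using odd_cos_poly_cos[of j] by (simp add: algebra_simps)
    qed
    have s: "(sin u)\<^sup>2 * cos v = 1 / 2 * cos v + (- (1 / 4)) * (cos (v + 2 * u) + cos (v - 2 * u))" for u v :: real
    proof -
      have 1: "cos (v + 2 * u) + cos (v - 2 * u) = 2 * cos v * cos (2 * u)" by (simp add: cos_add cos_diff)
      show ?thesis unfolding 1 cos_double_sin by (simp add: algebra_simps)
    qed
    have "(\<lambda>u. (sin u)\<^sup>2 * cos ((2 * real k + 1) * u)) = (\<lambda>u. 1 / 2 * cos ((2 * real k + 1) * u)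
       + (- (1 / 4)) * (cos ((2 * real (Suc k) + 1) * u) + cos ((2 * real k - 1) * u)))"
      unfolding s by (rule ext) (simp add: algebra_simps)
    then show ?thesis
      by (simp only:) (intro odd_cos_poly_add odd_cos_poly_cmult odd_cos_poly_cos p)
  qed
  obtain c K where f: "\<And>u. f u = (\<Sum>k<K. c k * cos ((2 * real k + 1) * u))"
    using assms(1) unfolding odd_cos_poly_def by blast
  have "(\<lambda>u. (sin u)\<^sup>2 * f u) = (\<lambda>u. \<Sum>k<K. c k * ((sin u)\<^sup>2 * cos ((2 * real k + 1) * u)))"
    unfolding f by (rule ext) (simp add: sum_distrib_left algebra_simps)
  then show ?thesis by (simp only:) (intro odd_cos_poly_sum odd_cos_poly_cmult base finite_lessThan)
qed

lemma odd_cos_poly_square_wave: "odd_cos_poly (square_wave N)"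
proof -
  have "odd_cos_poly (\<lambda>u. sin u ^ (2 * i) * cos u)" for i
  proof (induction i)
    case 0 show ?case using odd_cos_poly_cos[of 0] by simp
  next
    case (Suc i)
    then show ?case using odd_cos_poly_sin2[OF Suc] by (simp add: power2_eq_square mult.assoc)
  qed
  then have "odd_cos_poly (\<lambda>u. \<Sum>i<N. central_coeff i * (sin u ^ (2 * i) * cos u))"
    by (intro odd_cos_poly_sum odd_cos_poly_cmult) auto
  moreover have "(\<lambda>u. \<Sum>i<N. central_coeff i * (sin u ^ (2 * i) * cos u)) = square_wave N"
    by (rule ext) (simp add: square_wave_def sum_distrib_left algebra_simps)
  ultimately show ?thesis by simp
qed

text \<open>Orthogonality on a quarter period: the antiderivative consists of sines of even
  frequency, which vanish at both ends. Frequency 0 occurs for \<open>k = 0\<close> and calls for a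
  separate case.\<close>

lemma integral_cos_mult_odd_cos:
  "((\<lambda>u. cos u * cos ((2 * real k + 1) * u)) has_integral (if k = 0 then pi / 4 else 0)) {0..pi / 2}"
proof (cases "k = 0")
  case True
  have "((\<lambda>u. cos u * cos u) has_integral ((pi / 2) / 2 + sin (2 * (pi / 2)) / 4) - (0 / 2 + sin (2 * 0) / 4)) {0..pi / 2}"
  proof (rule fundamental_theorem_of_calculus)
    fix u :: real assume "u \<in> {0..pi / 2}"
    have "((\<lambda>u. u / 2 + sin (2 * u) / 4) has_real_derivative 1 / 2 + cos (2 * u) * 2 / 4) (at u within {0..pi / 2})"
      by (rule derivative_eq_intros refl | simp)+
    moreover have "1 / 2 + cos (2 * u) * 2 / 4 = cos u * cos u"
      unfolding cos_double_cos power2_eq_square by (simp add: field_simps)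
    ultimately show "((\<lambda>u. u / 2 + sin (2 * u) / 4) has_vector_derivative cos u * cos u) (at u within {0..pi / 2})"
      by (simp add: has_real_derivative_iff_has_vector_derivative)
  qed simp
  then show ?thesis using True by simp
next
  case False
  define F where "F u = sin (2 * real k * u) / (4 * real k) + sin ((2 * real k + 2) * u) / (4 * real k + 4)" for u
  have "((\<lambda>u. cos u * cos ((2 * real k + 1) * u)) has_integral F (pi / 2) - F 0) {0..pi / 2}"
  proof (rule fundamental_theorem_of_calculus)
    fix u :: real assume "u \<in> {0..pi / 2}"
    have "(F has_real_derivative cos (2 * real k * u) * (2 * real k) / (4 * real k)
        + cos ((2 * real k + 2) * u) * (2 * real k + 2) / (4 * real k + 4)) (at u within {0..pi / 2})"
      unfolding F_def by (rule derivative_eq_intros refl | use False in simp)+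
    moreover have "cos (2 * real k * u) * (2 * real k) / (4 * real k)
        + cos ((2 * real k + 2) * u) * (2 * real k + 2) / (4 * real k + 4)
        = (cos (2 * real k * u) + cos ((2 * real k + 2) * u)) / 2"
    proof -
      have "(2 * real k + 2) / (4 * real k + 4) = 1 / 2" by (simp add: field_simps)
      then have "cos ((2 * real k + 2) * u) * (2 * real k + 2) / (4 * real k + 4) = cos ((2 * real k + 2) * u) / 2"
        by (simp only: times_divide_eq_right[symmetric]) 
      then show ?thesis using False by simp
    qed
    moreover have "\<dots> = cos u * cos ((2 * real k + 1) * u)"
    proof -
      have 1: "2 * real k * u = (2 * real k + 1) * u - u" and 2: "(2 * real k + 2) * u = (2 * real k + 1) * u + u"
        by (auto simp: algebra_simps)
      show ?thesis unfolding 1 2 cos_add cos_diff by simp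
    qed
    ultimately show "(F has_vector_derivative cos u * cos ((2 * real k + 1) * u)) (at u within {0..pi / 2})"
      by (simp add: has_real_derivative_iff_has_vector_derivative)
  qed simp
  moreover have "F (pi / 2) = 0"
  proof -
    have 1: "2 * real k * (pi / 2) = real k * pi" "(2 * real k + 2) * (pi / 2) = real (Suc k) * pi"
      by (auto simp: algebra_simps)
    show ?thesis unfolding F_def 1 sin_npi by simp
  qed
  moreover have "F 0 = 0" by (simp add: F_def)
  ultimately show ?thesis using False by simp
qed

text \<open>Integrating against \<open>cos u\<close> over a quarter period isolates
  \<open>c 0\<close>. The deficit \<open>1 - square_wave N u\<close> contributes at most the
  integral of \<open>cos u * sin u ^ (2 * N)\<close>, which is \<open>1 / (2 * N + 1)\<close>; so
  \<open>c 0\<close> is close to the coefficient of the true square wave.\<close>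

lemma square_wave_expansion:
  assumes "N \<ge> 1"
  obtains c K where "K \<ge> 1" "\<And>u. square_wave N u = (\<Sum>k<K. c k * cos ((2 * real k + 1) * u))"
    "\<bar>c 0 - 4 / pi\<bar> \<le> 2 / (2 * real N + 1)"
proof -
  obtain c0 K0 where e0: "\<And>u. square_wave N u = (\<Sum>k<K0. c0 k * cos ((2 * real k + 1) * u))"
    using odd_cos_poly_square_wave[of N] unfolding odd_cos_poly_def by blast
  define c where "c k = (if k < K0 then c0 k else 0)" for k
  \<comment> \<open>Padding with a zero coefficient ensures that index 0 is in range.\<close>
  define K where "K = Suc K0"
  have e: "square_wave N u = (\<Sum>k<K. c k * cos ((2 * real k + 1) * u))" for u
    unfolding e0 by (rule sum.mono_neutral_cong_left) (auto simp: c_def K_def)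
  have "((\<lambda>u. \<Sum>k<K. c k * (cos u * cos ((2 * real k + 1) * u))) has_integral
      (\<Sum>k<K. c k * (if k = 0 then pi / 4 else 0))) {0..pi / 2}"
    by (intro has_integral_sum has_integral_mult_right integral_cos_mult_odd_cos finite_lessThan)
  also have "(\<Sum>k<K. c k * (if k = 0 then pi / 4 else 0)) = c 0 * (pi / 4)"
    unfolding K_def by (subst sum.lessThan_Suc_shift) simp
  also have "(\<lambda>u. \<Sum>k<K. c k * (cos u * cos ((2 * real k + 1) * u))) = (\<lambda>u. cos u * square_wave N u)"
    by (rule ext) (simp add: e sum_distrib_left algebra_simps)
  finally have i1: "((\<lambda>u. cos u * square_wave N u) has_integral c 0 * (pi / 4)) {0..pi / 2}" .
  have i2: "(cos has_integral sin (pi / 2) - sin 0) {0..pi / 2}"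
    by (rule fundamental_theorem_of_calculus)
       (auto simp: has_real_derivative_iff_has_vector_derivative[symmetric] intro!: derivative_eq_intros)
  have i3: "((\<lambda>u. cos u * sin u ^ (2 * N)) has_integral
      sin (pi / 2) ^ (2 * N + 1) / (2 * real N + 1) - sin 0 ^ (2 * N + 1) / (2 * real N + 1)) {0..pi / 2}"
  proof (rule fundamental_theorem_of_calculus)
    fix u :: real assume "u \<in> {0..pi / 2}"
    have n: "2 * real N + 1 \<noteq> 0" using assms by simp
    have "((\<lambda>u. sin u ^ (2 * N + 1) / (2 * real N + 1)) has_real_derivative
       (real (2 * N + 1) * sin u ^ (2 * N) * cos u) / (2 * real N + 1)) (at u within {0..pi / 2})"
      by (rule derivative_eq_intros refl | use n in simp)+
    then have "((\<lambda>u. sin u ^ (2 * N + 1) / (2 * real N + 1)) has_real_derivative cos u * sin u ^ (2 * N)) (at u within {0..pi / 2})"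
      by (rule DERIV_cong) (use n in \<open>simp add: divide_simps\<close>)
    then show "((\<lambda>u. sin u ^ (2 * N + 1) / (2 * real N + 1)) has_vector_derivative cos u * sin u ^ (2 * N))
        (at u within {0..pi / 2})"
      by (simp only: has_real_derivative_iff_has_vector_derivative)
  qed simp
  have i4: "((\<lambda>u. cos u - cos u * square_wave N u) has_integral 1 - c 0 * (pi / 4)) {0..pi / 2}"
    using has_integral_diff[OF i2 i1] by simp
  have i3': "((\<lambda>u. cos u * sin u ^ (2 * N)) has_integral 1 / (2 * real N + 1)) {0..pi / 2}"
    using i3 by simp
  have cp: "0 \<le> cos u" if "u \<in> {0..pi / 2}" for u using that by (intro cos_ge_zero) auto
  have b: "0 \<le> 1 - square_wave N u" "1 - square_wave N u \<le> sin u ^ (2 * N)" if "u \<in> {0..pi / 2}" for u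
    using square_wave_bounds[OF assms, of u] that by auto
  have u: "1 - c 0 * (pi / 4) \<le> 1 / (2 * real N + 1)"
  proof (rule has_integral_le[OF i4 i3'])
    fix u :: real assume "u \<in> {0..pi / 2}"
    then show "cos u - cos u * square_wave N u \<le> cos u * sin u ^ (2 * N)"
      using mult_left_mono[OF b(2) cp] by (simp add: algebra_simps)
  qed
  have l: "0 \<le> 1 - c 0 * (pi / 4)"
  proof (rule has_integral_nonneg[OF i4])
    fix u :: real assume "u \<in> {0..pi / 2}"
    then show "0 \<le> cos u - cos u * square_wave N u"
      using mult_nonneg_nonneg[OF cp b(1)] by (simp add: algebra_simps)
  qed
  have "\<bar>c 0 - 4 / pi\<bar> = 4 / pi * (1 - c 0 * (pi / 4))"
  proof -
    have "c 0 - 4 / pi = - (4 / pi * (1 - c 0 * (pi / 4)))" by (simp add: field_simps)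
    moreover have "0 \<le> 4 / pi * (1 - c 0 * (pi / 4))" using l pi_gt_zero by (intro mult_nonneg_nonneg) auto
    ultimately show ?thesis by linarith
  qed
  also have "\<dots> \<le> 2 * (1 / (2 * real N + 1))"
    using pi_gt3 l by (intro mult_mono u) (auto simp: divide_simps)
  finally have "\<bar>c 0 - 4 / pi\<bar> \<le> 2 / (2 * real N + 1)" by simp
  then show ?thesis using e by (intro that[of K c]) (auto simp: K_def)
qed

section \<open>Fourier expansion of even powers of the sine\<close>

lemma iexp_mult_iexp: "iexp a * iexp b = iexp (a + b)"
  by (simp add: exp_add[symmetric] algebra_simps)

text \<open>Euler's formula and the binomial theorem. The term \<open>k = N\<close> is the constant
  one, with coefficient \<open>central_coeff N\<close>; the absolute values of all coefficients add
  up to 1 by \<open>sum_binomial_4\<close>.\<close>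

lemma sin_even_power_expansion:
  "complex_of_real (sin u ^ (2 * N)) =
     (\<Sum>k\<le>2 * N. of_real ((-1) ^ (N + k) * real (2 * N choose k) / 4 ^ N) * iexp (2 * (real N - real k) * u))"
proof -
  have s: "complex_of_real (sin u) = (iexp u + - iexp (- u)) / (2 * \<i>)"
    by (simp add: sin_exp_eq sin_of_real[symmetric] field_simps)
  have e1: "iexp v ^ n = iexp (real n * v)" for v n
    by (simp add: exp_of_nat_mult[symmetric] algebra_simps)
  have "complex_of_real (sin u ^ (2 * N)) = (iexp u + - iexp (- u)) ^ (2 * N) / (2 * \<i>) ^ (2 * N)"
    unfolding of_real_power s by (rule power_divide)
  also have "(2 * \<i>) ^ (2 * N) = ((-1) ^ N * 4 ^ N :: complex)"
    by (simp add: power_mult_distrib power_mult power_minus[of 4])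
  also have "(iexp u + - iexp (- u)) ^ (2 * N) =
     (\<Sum>k\<le>2 * N. of_nat (2 * N choose k) * (- iexp (- u)) ^ k * iexp u ^ (2 * N - k))"
    by (subst add.commute, rule binomial_ring)
  also have "\<dots> = (\<Sum>k\<le>2 * N. of_nat (2 * N choose k) * (- 1) ^ k * iexp (2 * (real N - real k) * u))"
  proof (rule sum.cong[OF refl])
    fix k assume "k \<in> {..2 * N}"
    then have k: "real (2 * N - k) = 2 * real N - real k" by (simp add: of_nat_diff)
    have "(- iexp (- u)) ^ k * iexp u ^ (2 * N - k) = (- 1) ^ k * (iexp (real k * (- u)) * iexp (real (2 * N - k) * u))"
      by (subst power_minus) (simp only: e1 mult.assoc)
    also have "iexp (real k * (- u)) * iexp (real (2 * N - k) * u) = iexp (2 * (real N - real k) * u)"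
      unfolding iexp_mult_iexp k by (simp add: algebra_simps)
    finally show "of_nat (2 * N choose k) * (- iexp (- u)) ^ k * iexp u ^ (2 * N - k)
      = of_nat (2 * N choose k) * (- 1) ^ k * iexp (2 * (real N - real k) * u)"
      by (simp only: mult.assoc)
  qed
  also have "\<dots> / ((-1) ^ N * 4 ^ N) = (\<Sum>k\<le>2 * N. of_real ((-1) ^ (N + k) * real (2 * N choose k) / 4 ^ N) * iexp (2 * (real N - real k) * u))"
    unfolding sum_divide_distrib
  proof (rule sum.cong[OF refl])
    fix k
    have "(-1) ^ N * (-1 :: complex) ^ N = 1" by (simp add: power_mult_distrib[symmetric])
    then have "1 / (-1 :: complex) ^ N = (-1) ^ N" by (simp add: field_simps)
    then have "of_nat (2 * N choose k) * (- 1) ^ k * iexp (2 * (real N - real k) * u) / ((-1) ^ N * 4 ^ N)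
       = of_nat (2 * N choose k) * (- 1) ^ k * iexp (2 * (real N - real k) * u) * (-1) ^ N / 4 ^ N"
      by (metis (no_types, lifting) divide_divide_eq_left mult.right_neutral times_divide_eq_right)
    then show "of_nat (2 * N choose k) * (- 1) ^ k * iexp (2 * (real N - real k) * u) / ((-1) ^ N * 4 ^ N)
       = of_real ((-1) ^ (N + k) * real (2 * N choose k) / 4 ^ N) * iexp (2 * (real N - real k) * u)"
      by (simp add: power_add algebra_simps)
  qed
  finally show ?thesis .
qed

lemma sum_binomial_4: "(\<Sum>k\<le>2 * N. real (2 * N choose k) / 4 ^ N) = 1"
proof -
  have "(\<Sum>k\<le>2 * N. real (2 * N choose k)) = 2 ^ (2 * N)"
    using choose_row_sum[of "2 * N"] by (metis of_nat_sum of_nat_power of_nat_numeral)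
  then show ?thesis by (simp add: sum_divide_distrib[symmetric] power_mult)
qed

section \<open>Recursions for the harmonics\<close>

text \<open>Adding \<open>2 * u\<close> to the angle costs at most
  \<open>\<bar>sin (2 * u)\<bar>\<close>, which contains the factor \<open>cos u\<close>. This is
  what bounds the exit terms of every harmonic by those of the first.\<close>

lemma abs_cos_odd_mult_le: "\<bar>cos ((2 * real k + 1) * u)\<bar> \<le> (2 * real k + 1) * \<bar>cos u\<bar>"
proof (induction k)
  case (Suc k)
  have s: "\<bar>sin (2 * u)\<bar> \<le> 2 * \<bar>cos u\<bar>"
  proof -
    have "\<bar>sin u\<bar> * \<bar>cos u\<bar> \<le> 1 * \<bar>cos u\<bar>" by (intro mult_right_mono) auto
    then show ?thesis by (simp add: sin_double abs_mult)
  qed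
  have "cos ((2 * real (Suc k) + 1) * u) = cos ((2 * real k + 1) * u + 2 * u)"
    by (simp add: algebra_simps)
  also have "\<dots> = cos ((2 * real k + 1) * u) * cos (2 * u) - sin ((2 * real k + 1) * u) * sin (2 * u)"
    by (rule cos_add)
  also have "\<bar>\<dots>\<bar> \<le> \<bar>cos ((2 * real k + 1) * u)\<bar> * \<bar>cos (2 * u)\<bar> + \<bar>sin ((2 * real k + 1) * u)\<bar> * \<bar>sin (2 * u)\<bar>"
    unfolding abs_mult[symmetric] by (rule abs_triangle_ineq4)
  also have "\<dots> \<le> (2 * real k + 1) * \<bar>cos u\<bar> * 1 + 1 * (2 * \<bar>cos u\<bar>)"
    by (intro add_mono mult_mono Suc s) auto
  finally show ?case by (simp add: algebra_simps)
qed simp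

lemma cos_nonneg_inside: "0 < y \<Longrightarrow> \<bar>v\<bar> \<le> y \<Longrightarrow> 0 \<le> cos (pi / (2 * y) * v)"
proof -
  assume y: "0 < y" "\<bar>v\<bar> \<le> y"
  have "\<bar>pi / (2 * y) * v\<bar> \<le> pi / (2 * y) * y"
    unfolding abs_mult using y by (intro mult_mono) auto
  then have "\<bar>pi / (2 * y) * v\<bar> \<le> pi / 2" using y by simp
  then show ?thesis by (intro cos_ge_zero) linarith+
qed

text \<open>Shifting the angle by pi leads back to \<open>cos_nonneg_inside\<close>. A walk inside
  [-x, x] whose next step is at most \<open>2 * x\<close> cannot get beyond \<open>3 * x\<close>, so
  its exit point falls under this lemma.\<close>

lemma cos_nonpos_outside: "0 < y \<Longrightarrow> y \<le> \<bar>v\<bar> \<Longrightarrow> \<bar>v\<bar> \<le> 3 * y \<Longrightarrow> cos (pi / (2 * y) * v) \<le> 0"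
proof -
  assume y: "0 < y" "y \<le> \<bar>v\<bar>" "\<bar>v\<bar> \<le> 3 * y"
  have e: "cos (pi / (2 * y) * v) = cos (pi / (2 * y) * \<bar>v\<bar>)"
    by (cases "v \<ge> 0") auto
  also have "\<dots> = - cos (pi / (2 * y) * (\<bar>v\<bar> - 2 * y))"
  proof -
    have "pi / (2 * y) * \<bar>v\<bar> = pi / (2 * y) * (\<bar>v\<bar> - 2 * y) + pi"
      using y by (simp add: field_simps)
    then show ?thesis by (simp only: cos_periodic_pi)
  qed
  also have "\<dots> \<le> 0" using cos_nonneg_inside[of y "\<bar>v\<bar> - 2 * y"] y by auto
  finally show ?thesis .
qed

context iid_walk
begin

lemma abs_cosm_le: "\<bar>cosm t\<bar> \<le> 1"
proof -
  have "\<bar>cosm t\<bar> \<le> expectation (\<lambda>\<omega>. 1)"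
    unfolding cosm_def
    by (rule order_trans[OF integral_abs_bound integral_mono])
       (auto intro!: integrable_const_bound[where B=1])
  then show ?thesis by (simp add: prob_space)
qed

lemma integrable_iexp_X: "integrable M (\<lambda>\<omega>. iexp (t * X k \<omega>))"
  by (intro integrable_const_bound[where B=1]) (auto simp: norm_exp_i_times)

lemma psi_Re_Im: "Re (psi t) = cosm t" "Im (psi t) = sinm t"
  unfolding psi_def cosm_def sinm_def
  by (subst integral_Re[symmetric] integral_Im[symmetric]; (rule integrable_iexp_X)?; simp add: Re_exp Im_exp)+

lemma psi_minus: "psi (- t) = cnj (psi t)"
proof -
  have "cosm (- t) = cosm t" "sinm (- t) = - sinm t"
    by (auto simp: cosm_def sinm_def)
  then show ?thesis by (auto simp: complex_eq_iff psi_Re_Im)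
qed

text \<open>For unconstrained steps a complex exponential is an exact eigenfunction, without the
  sine term of \<open>ev_cos_Suc\<close>; blocks of many free steps are therefore treated in this
  form.\<close>

definition stay_char :: "real \<Rightarrow> nat \<Rightarrow> real \<Rightarrow> nat \<Rightarrow> complex" where
  "stay_char x j t l = expectation (\<lambda>\<omega>. of_real (indicator (stay x j) \<omega>) * iexp (t * partial_sum X l \<omega>))"

lemma stay_char_Suc: "j \<le> l \<Longrightarrow> stay_char x j t (Suc l) = stay_char x j t l * psi t"
proof -
  assume "j \<le> l"
  have "stay_char x j t (Suc l) = expectation (\<lambda>\<omega>. of_real (indicator (stay x j) \<omega>) *
      iexp (t * partial_sum X l \<omega>) * iexp (t * X (Suc l) \<omega>))"
    unfolding stay_char_def
    by (intro Bochner_Integration.integral_cong refl)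
       (simp add: partial_sum_Suc distrib_left exp_add mult.assoc)
  also have "\<dots> = stay_char x j t l * psi t"
    unfolding stay_char_def psi_def
    by (rule expectation_stay_mult[where K=1 and L=1 and f="\<lambda>s. iexp (t * s)" and g="\<lambda>s. iexp (t * s)"])
       (use \<open>j \<le> l\<close> in \<open>auto simp: norm_exp_i_times\<close>)
  finally show ?thesis .
qed

lemma stay_char_add: "stay_char x j t (j + m) = stay_char x j t j * psi t ^ m"
  by (induction m) (auto simp: stay_char_Suc)

lemma integrable_stay_iexp:
  "integrable M (\<lambda>\<omega>. of_real (indicator (stay x j) \<omega>) * iexp (t * partial_sum X l \<omega>))"
  by (intro integrable_const_bound[where B=1]) (auto simp: norm_mult norm_exp_i_times indicator_def)

lemma norm_stay_char_le: "norm (stay_char x j t l) \<le> pstay x j"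
proof -
  have "norm (stay_char x j t l) \<le> expectation (\<lambda>\<omega>. norm (complex_of_real (indicator (stay x j) \<omega>) * iexp (t * partial_sum X l \<omega>)))"
    unfolding stay_char_def by (rule integral_norm_bound)
  also have "\<dots> = expectation (\<lambda>\<omega>. indicator (stay x j) \<omega>)"
    by (intro Bochner_Integration.integral_cong refl) (simp add: norm_mult norm_exp_i_times)
  finally show ?thesis by simp
qed

lemma Re_stay_char: "Re (stay_char x j t l) = ev x j (\<lambda>s. cos (t * s)) l"
  unfolding stay_char_def ev_def
  by (subst integral_Re[symmetric, OF integrable_stay_iexp])
     (auto intro!: Bochner_Integration.integral_cong simp: Re_exp)

lemma ev_stay_antimono:
  assumes [measurable]: "f \<in> borel_measurable borel" and "\<And>s. \<bar>f s\<bar> \<le> K" "\<And>s. 0 \<le> f s" "i \<le> j"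
  shows "ev x j f l \<le> ev x i f l"
  unfolding ev_def
  by (intro integral_mono integrable_stay)
     (use assms stay_antimono[OF \<open>i \<le> j\<close>, of x] in \<open>auto split: split_indicator\<close>)

text \<open>Releasing the constraint during the last \<open>m\<close> steps needs a nonnegative test
  function. \<open>1 + cos (t * s)\<close> is one, and on [-x, x] it is at least its value at the
  ends; the free steps multiply its Fourier part by \<open>psi t ^ m\<close>.\<close>

lemma prob_stay_block_le:
  assumes "0 \<le> x" and that: "\<bar>t * x\<bar> \<le> pi"
  shows "pstay x (j + m) * (1 + cos (t * x)) \<le> pstay x j + Re (stay_char x j t j * psi t ^ m)"
proof -
  have "pstay x (j + m) * (1 + cos (t * x)) = ev x (j + m) (\<lambda>s. (1 + cos (t * x)) * 1) (j + m)"
    by (subst ev_cmult) (simp add: ev_one)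
  also have "\<dots> \<le> ev x (j + m) (\<lambda>s. 1 + cos (t * s)) (j + m)"
  proof (rule ev_mono[where K=2 and L=2])
    fix s :: real
    show "\<bar>1 + cos (t * s)\<bar> \<le> 2" "\<bar>(1 + cos (t * x)) * 1\<bar> \<le> 2"
      using cos_le_one[of "t * s"] cos_ge_minus_one[of "t * s"] cos_le_one[of "t * x"] cos_ge_minus_one[of "t * x"]
      unfolding mult_1_right by linarith+
    assume s: "\<bar>s\<bar> \<le> x"
    have "cos \<bar>t * x\<bar> \<le> cos \<bar>t * s\<bar>"
      using that s assms by (intro cos_monotone_0_pi_le) (auto simp: abs_mult intro!: mult_left_mono)
    then show "(1 + cos (t * x)) * 1 \<le> 1 + cos (t * s)" by simp
  qed (use assms in auto)
  also have "\<dots> \<le> ev x j (\<lambda>s. 1 + cos (t * s)) (j + m)"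
  proof (rule ev_stay_antimono[where K=2])
    fix s :: real
    show "\<bar>1 + cos (t * s)\<bar> \<le> 2" "0 \<le> 1 + cos (t * s)"
      using cos_le_one[of "t * s"] cos_ge_minus_one[of "t * s"] by linarith+
  qed auto
  also have "\<dots> = pstay x j + Re (stay_char x j t (j + m))"
    by (subst ev_add[where K=1 and L=1]) (auto simp: ev_one Re_stay_char)
  finally show ?thesis by (simp add: stay_char_add)
qed

text \<open>During \<open>m\<close> free steps every nonconstant Fourier term of the even sine power
  is multiplied by a number of norm at most \<open>d\<close>, and the weights add up to 1; the
  constant term \<open>central_coeff N\<close> is unaffected.\<close>

lemma ev_sin_power_block_le:
  assumes "\<And>k. k \<in> {1..N} \<Longrightarrow> norm (psi (2 * real k * t)) ^ m \<le> d" "0 \<le> d"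
  shows "ev x j (\<lambda>s. sin (t * s) ^ (2 * N)) (j + m) \<le> pstay x j * (central_coeff N + d)"
proof -
  let ?l = "j + m"
  let ?c = "\<lambda>k. (-1) ^ (N + k) * real (2 * N choose k) / 4 ^ N"
  have "complex_of_real (ev x j (\<lambda>s. sin (t * s) ^ (2 * N)) ?l) =
     expectation (\<lambda>\<omega>. \<Sum>k\<le>2 * N. of_real (?c k) * (of_real (indicator (stay x j) \<omega>) * iexp (2 * (real N - real k) * t * partial_sum X ?l \<omega>)))"
    unfolding ev_def integral_complex_of_real[symmetric]
    by (intro Bochner_Integration.integral_cong refl)
       (simp only: of_real_mult sin_even_power_expansion sum_distrib_left mult.assoc mult.left_commute)
  also have "\<dots> = (\<Sum>k\<le>2 * N. of_real (?c k) * stay_char x j (2 * (real N - real k) * t) ?l)"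
    unfolding stay_char_def
    by (subst Bochner_Integration.integral_sum)
       (rule integrable_mult_right, rule integrable_stay_iexp, simp only: integral_mult_right_zero)
  finally have e: "complex_of_real (ev x j (\<lambda>s. sin (t * s) ^ (2 * N)) ?l) =
     (\<Sum>k\<le>2 * N. of_real (?c k) * stay_char x j (2 * (real N - real k) * t) ?l)" .
  have "\<bar>ev x j (\<lambda>s. sin (t * s) ^ (2 * N)) ?l\<bar> = norm (complex_of_real (ev x j (\<lambda>s. sin (t * s) ^ (2 * N)) ?l))"
    by simp
  also have "\<dots> \<le> (\<Sum>k\<le>2 * N. norm (of_real (?c k) * stay_char x j (2 * (real N - real k) * t) ?l))"
    unfolding e by (rule norm_sum)
  also have "\<dots> \<le> (\<Sum>k\<le>2 * N. (if k = N then pstay x j * central_coeff N else 0)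
      + pstay x j * d * (real (2 * N choose k) / 4 ^ N))"
  proof (rule sum_mono)
    fix k assume k: "k \<in> {..2 * N}"
    have c: "norm (complex_of_real (?c k)) = real (2 * N choose k) / 4 ^ N"
      by (simp add: norm_mult norm_divide norm_power)
    show "norm (of_real (?c k) * stay_char x j (2 * (real N - real k) * t) ?l)
      \<le> (if k = N then pstay x j * central_coeff N else 0) + pstay x j * d * (real (2 * N choose k) / 4 ^ N)"
    proof (cases "k = N")
      case True
      have "norm (of_real (?c k) * stay_char x j (2 * (real N - real k) * t) ?l) \<le> real (2 * N choose k) / 4 ^ N * pstay x j"
        unfolding norm_mult c by (intro mult_left_mono norm_stay_char_le) auto
      moreover have "0 \<le> pstay x j * d * (real (2 * N choose k) / 4 ^ N)" using assms(2) by simp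
      ultimately show ?thesis using True by (simp add: central_coeff_def mult.commute)
    next
      case False
      have "norm (psi (2 * (real N - real k) * t)) ^ m \<le> d"
      proof (cases "k < N")
        case True
        then have "2 * (real N - real k) * t = 2 * real (N - k) * t" by (simp add: of_nat_diff)
        then show ?thesis using assms(1)[of "N - k"] True by simp
      next
        \<comment> \<open>Beyond the middle index the frequency is negative, which conjugates
          \<open>psi\<close> and leaves its norm unchanged.\<close>
        case F: False
        then have "2 * (real N - real k) * t = - (2 * real (k - N) * t)" by (simp add: of_nat_diff algebra_simps)
        then have "psi (2 * (real N - real k) * t) = cnj (psi (2 * real (k - N) * t))" by (simp only: psi_minus)
        moreover have "k - N \<in> {1..N}" using k F False by auto
        ultimately show ?thesis using assms(1)[of "k - N"] by (simp only: complex_mod_cnj)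
      qed
      then have "norm (stay_char x j (2 * (real N - real k) * t) ?l) \<le> pstay x j * d"
        unfolding stay_char_add norm_mult norm_power
        by (intro mult_mono norm_stay_char_le) auto
      then have "norm (of_real (?c k) * stay_char x j (2 * (real N - real k) * t) ?l)
          \<le> real (2 * N choose k) / 4 ^ N * (pstay x j * d)"
        unfolding norm_mult c by (intro mult_left_mono) auto
      then show ?thesis using False by (simp add: mult.commute)
    qed
  qed
  also have "\<dots> = pstay x j * central_coeff N + pstay x j * d"
    unfolding sum.distrib sum_distrib_left[symmetric] sum_binomial_4 by simp
  finally show ?thesis by (simp add: distrib_left)
qed

text \<open>Upper bound with a slightly wider interval: the cosine of the wider interval is bounded below on the
  narrower one, so the error terms are absorbed into the eigenvalue.\<close>

lemma upper_recursion:
  fixes x x' t c e :: real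
  defines "t \<equiv> pi / (2 * x')" and "c \<equiv> cos (t * x)"
  defines "e \<equiv> \<bar>sinm t\<bar> + prob {\<omega> \<in> space M. \<bar>X 0 \<omega>\<bar> > x' - x}"
  assumes x: "0 < x" "x < x'" and lam: "cosm t + e / c \<le> lam"
  shows "ev x n (\<lambda>s. cos (t * s)) n \<le> lam ^ n" "c * pstay x n \<le> ev x n (\<lambda>s. cos (t * s)) n" "0 < c"
proof -
  let ?a = "\<lambda>j. ev x j (\<lambda>s. cos (t * s)) j"
  have t0: "0 < t" using x by (simp add: t_def)
  have tx: "t * x < pi / 2" unfolding t_def using x by (simp add: field_simps)
  show c0: "0 < c" unfolding c_def using tx t0 x by (intro cos_gt_zero) auto
  have cle: "c \<le> cos (t * s)" if "\<bar>s\<bar> \<le> x" for s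
  proof -
    have "t * \<bar>s\<bar> \<le> t * x" using t0 that by (intro mult_left_mono) auto
    moreover have "0 \<le> t * \<bar>s\<bar>" "t * x \<le> pi" using t0 tx pi_gt_zero by (simp, linarith)
    ultimately have "cos (t * x) \<le> cos (t * \<bar>s\<bar>)"
      by (intro cos_monotone_0_pi_le)
    also have "cos (t * \<bar>s\<bar>) = cos (t * s)" by (cases "s \<ge> 0") auto
    finally show ?thesis by (simp add: c_def)
  qed
  have lower: "c * pstay x j \<le> ?a j" for j
  proof -
    have "c * pstay x j = ev x j (\<lambda>_. c * 1) j" by (simp only: ev_cmult ev_one)
    also have "\<dots> \<le> ?a j"
      by (rule ev_mono[where K=1 and L=1]) (use x cle in \<open>auto simp: c_def\<close>)
    finally show ?thesis .
  qed
  then show "c * pstay x n \<le> ?a n" .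
  have a0: "0 \<le> ?a j" for j using lower[of j] c0 by (meson measure_nonneg mult_nonneg_nonneg less_imp_le order_trans)
  have e0: "0 \<le> e" unfolding e_def by simp
  have step: "?a (Suc j) \<le> lam * ?a j" for j
  proof -
    have "exit_ev x j (\<lambda>s. - cos (t * s)) \<le> - exit_ev x j (\<lambda>_. 0)
        + max 1 0 * (pstay x j * prob {\<omega> \<in> space M. \<bar>X 0 \<omega>\<bar> > x' - x})"
    proof (rule exit_ev_le[where K=1 and L=0])
      fix s v :: real assume s: "\<bar>s\<bar> \<le> x" and v: "x < \<bar>v\<bar>"
      show "- cos (t * v) \<le> - 0 + (if x' - x < \<bar>v - s\<bar> then 1 else 0)"
      proof (cases "\<bar>v\<bar> \<le> x'")
        case True
        then have "0 \<le> cos (t * v)" unfolding t_def using x by (intro cos_nonneg_inside) auto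
        then show ?thesis by simp
      next
        case False
        then have "x' - x < \<bar>v - s\<bar>" using s by linarith
        then show ?thesis using cos_ge_minus_one[of "t * v"] by simp
      qed
    qed (use x in auto)
    also have "exit_ev x j (\<lambda>_. 0) = 0" by (simp add: exit_ev_def)
    also have "exit_ev x j (\<lambda>s. - cos (t * s)) = - exit_ev x j (\<lambda>s. cos (t * s))"
      by (simp add: exit_ev_def)
    finally have 1: "- exit_ev x j (\<lambda>s. cos (t * s)) \<le> pstay x j * prob {\<omega> \<in> space M. \<bar>X 0 \<omega>\<bar> > x' - x}"
      by simp
    have "\<bar>ev x j (\<lambda>s. sin (t * s)) j\<bar> \<le> 1 * pstay x j"
      by (rule abs_ev_le) auto
    then have "\<bar>sinm t * ev x j (\<lambda>s. sin (t * s)) j\<bar> \<le> \<bar>sinm t\<bar> * pstay x j"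
      unfolding abs_mult by (intro mult_left_mono) auto
    then have 2: "- (sinm t * ev x j (\<lambda>s. sin (t * s)) j) \<le> \<bar>sinm t\<bar> * pstay x j" by linarith
    have "?a (Suc j) = cosm t * ?a j - sinm t * ev x j (\<lambda>s. sin (t * s)) j - exit_ev x j (\<lambda>s. cos (t * s))"
      by (subst ev_Suc[where K=1]) (auto simp: ev_cos_Suc)
    also have "\<dots> \<le> cosm t * ?a j + e * pstay x j"
      using 1 2 by (simp add: e_def algebra_simps)
    also have "e * pstay x j \<le> e * (?a j / c)"
      using lower[of j] c0 by (intro mult_left_mono e0) (simp add: field_simps)
    also have "cosm t * ?a j + e * (?a j / c) = (cosm t + e / c) * ?a j"
      by (simp add: algebra_simps)
    also have "\<dots> \<le> lam * ?a j" by (intro mult_right_mono lam a0)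
    finally show ?thesis by simp
  qed
  \<comment> \<open>Since \<open>?a 0 = 1\<close>, the first step gives
    \<open>0 \<le> ?a 1 \<le> lam\<close>.\<close>
  have l0: "0 \<le> lam"
    using step[of 0] a0[of "Suc 0"] by (simp add: ev_0)
  show "?a n \<le> lam ^ n"
  proof (induction n)
    case (Suc n)
    have "?a (Suc n) \<le> lam * ?a n" by (rule step)
    also have "\<dots> \<le> lam * lam ^ n" by (intro mult_left_mono Suc l0)
    finally show ?case by simp
  qed (simp add: ev_0)
qed

text \<open>An exit by a jump of at most \<open>2 * x\<close> ends where the cosine is nonpositive
  and so raises the first mode by its absolute value. This gain is kept in the inequality because
  \<open>mode_bounds\<close> extracts from it a bound on all exits. For a longer jump
  \<open>cos + \<bar>cos\<bar> \<le> 2\<close> is paid.\<close>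

lemma lower_recursion:
  fixes x t :: real
  defines "t \<equiv> pi / (2 * x)"
  assumes x: "0 < x"
  shows "cosm t * ev x j (\<lambda>s. cos (t * s)) j + exit_ev x j (\<lambda>s. \<bar>cos (t * s)\<bar>)
     - (\<bar>sinm t\<bar> + 2 * prob {\<omega> \<in> space M. \<bar>X 0 \<omega>\<bar> > 2 * x}) * pstay x j
    \<le> ev x (Suc j) (\<lambda>s. cos (t * s)) (Suc j)"
proof -
  have "exit_ev x j (\<lambda>s. cos (t * s)) \<le> - exit_ev x j (\<lambda>s. \<bar>cos (t * s)\<bar>)
        + max 2 0 * (pstay x j * prob {\<omega> \<in> space M. \<bar>X 0 \<omega>\<bar> > 2 * x})"
  proof (rule exit_ev_le[where K=1 and L=1])
    fix s v :: real assume s: "\<bar>s\<bar> \<le> x" and v: "x < \<bar>v\<bar>"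
    show "cos (t * v) \<le> - \<bar>cos (t * v)\<bar> + (if 2 * x < \<bar>v - s\<bar> then 2 else 0)"
    proof (cases "\<bar>v\<bar> \<le> 3 * x")
      case True
      then have "cos (t * v) \<le> 0" unfolding t_def using x v by (intro cos_nonpos_outside) auto
      then show ?thesis by simp
    next
      case False
      then have "2 * x < \<bar>v - s\<bar>" using s by linarith
      then show ?thesis using cos_le_one[of "t * v"] abs_cos_le_one[of "t * v"] by (simp, linarith)
    qed
  qed (use x in auto)
  then have 1: "exit_ev x j (\<lambda>s. cos (t * s)) \<le> - exit_ev x j (\<lambda>s. \<bar>cos (t * s)\<bar>)
        + 2 * prob {\<omega> \<in> space M. \<bar>X 0 \<omega>\<bar> > 2 * x} * pstay x j" by (simp add: algebra_simps)
  have "\<bar>ev x j (\<lambda>s. sin (t * s)) j\<bar> \<le> 1 * pstay x j"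
    by (rule abs_ev_le) auto
  then have "\<bar>sinm t * ev x j (\<lambda>s. sin (t * s)) j\<bar> \<le> \<bar>sinm t\<bar> * pstay x j"
    unfolding abs_mult by (intro mult_left_mono) auto
  then have 2: "sinm t * ev x j (\<lambda>s. sin (t * s)) j \<le> \<bar>sinm t\<bar> * pstay x j" by linarith
  have "ev x (Suc j) (\<lambda>s. cos (t * s)) (Suc j)
     = cosm t * ev x j (\<lambda>s. cos (t * s)) j - sinm t * ev x j (\<lambda>s. sin (t * s)) j - exit_ev x j (\<lambda>s. cos (t * s))"
    by (subst ev_Suc[where K=1]) (auto simp: ev_cos_Suc)
  then show ?thesis using 1 2 by (simp add: algebra_simps)
qed

lemma exit_ev_nonneg: "(\<And>s. 0 \<le> f s) \<Longrightarrow> 0 \<le> exit_ev x j f"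
  unfolding exit_ev_def by (intro integral_nonneg_AE AE_I2) auto

text \<open>The exits of a harmonic are controlled by those of the first one through
  \<open>abs_cos_odd_mult_le\<close>, which relies on the frequency being an odd multiple.\<close>

lemma higher_mode_recursion:
  fixes x t :: real and k :: nat
  defines "t \<equiv> pi / (2 * x)" and "u \<equiv> (2 * real k + 1) * t"
  shows "\<bar>ev x (Suc j) (\<lambda>s. cos (u * s)) (Suc j) - cosm u * ev x j (\<lambda>s. cos (u * s)) j\<bar>
     \<le> \<bar>sinm u\<bar> * pstay x j + (2 * real k + 1) * exit_ev x j (\<lambda>s. \<bar>cos (t * s)\<bar>)"
proof -
  have "\<bar>ev x j (\<lambda>s. sin (u * s)) j\<bar> \<le> 1 * pstay x j"
    by (rule abs_ev_le) auto
  then have 1: "\<bar>sinm u * ev x j (\<lambda>s. sin (u * s)) j\<bar> \<le> \<bar>sinm u\<bar> * pstay x j"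
    unfolding abs_mult by (intro mult_left_mono) auto
  let ?A = "stay x j - stay x (Suc j)"
  have "\<bar>exit_ev x j (\<lambda>s. cos (u * s))\<bar> \<le> expectation (\<lambda>\<omega>. \<bar>indicator ?A \<omega> * cos (u * partial_sum X (Suc j) \<omega>)\<bar>)"
    unfolding exit_ev_def by (rule integral_abs_bound)
  also have "\<dots> \<le> expectation (\<lambda>\<omega>. (2 * real k + 1) * (indicator ?A \<omega> * \<bar>cos (t * partial_sum X (Suc j) \<omega>)\<bar>))"
  proof (rule integral_mono)
    show "integrable M (\<lambda>\<omega>. \<bar>indicator ?A \<omega> * cos (u * partial_sum X (Suc j) \<omega>)\<bar>)"
      by (intro integrable_abs integrable_stay[where K=1]) auto
    show "integrable M (\<lambda>\<omega>. (2 * real k + 1) * (indicator ?A \<omega> * \<bar>cos (t * partial_sum X (Suc j) \<omega>)\<bar>))"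
      by (intro integrable_mult_right integrable_stay[where K=1]) auto
    fix \<omega>
    have e: "u * partial_sum X (Suc j) \<omega> = (2 * real k + 1) * (t * partial_sum X (Suc j) \<omega>)"
      by (simp add: u_def)
    show "\<bar>indicator ?A \<omega> * cos (u * partial_sum X (Suc j) \<omega>)\<bar>
       \<le> (2 * real k + 1) * (indicator ?A \<omega> * \<bar>cos (t * partial_sum X (Suc j) \<omega>)\<bar>)"
      unfolding e using abs_cos_odd_mult_le[of k "t * partial_sum X (Suc j) \<omega>"] by (simp add: indicator_def)
  qed
  also have "\<dots> = (2 * real k + 1) * exit_ev x j (\<lambda>s. \<bar>cos (t * s)\<bar>)"
    unfolding exit_ev_def by (rule integral_mult_right_zero)
  finally have 2: "\<bar>exit_ev x j (\<lambda>s. cos (u * s))\<bar> \<le> (2 * real k + 1) * exit_ev x j (\<lambda>s. \<bar>cos (t * s)\<bar>)" .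
  have "ev x (Suc j) (\<lambda>s. cos (u * s)) (Suc j)
     = cosm u * ev x j (\<lambda>s. cos (u * s)) j - sinm u * ev x j (\<lambda>s. sin (u * s)) j - exit_ev x j (\<lambda>s. cos (u * s))"
    by (subst ev_Suc[where K=1]) (auto simp: ev_cos_Suc)
  then show ?thesis using 1 2 by (simp add: algebra_simps)
qed

end

section \<open>The probability of staying in an interval\<close>

lemma linear_recursion_lower:
  fixes a b :: "nat \<Rightarrow> real"
  assumes "\<And>j. j < n \<Longrightarrow> l * a j + b j \<le> a (Suc j)" "l > 0"
  shows "a 0 + (\<Sum>j<n. b j / l ^ Suc j) \<le> a n / l ^ n"
  using assms(1)
proof (induction n)
  case (Suc n)
  have "a 0 + (\<Sum>j<Suc n. b j / l ^ Suc j) \<le> a n / l ^ n + b n / l ^ Suc n"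
    using Suc.IH Suc.prems by simp
  also have "\<dots> = (l * a n + b n) / l ^ Suc n"
    using assms(2) by (simp add: field_simps)
  also have "\<dots> \<le> a (Suc n) / l ^ Suc n"
    using assms(2) Suc.prems[of n] by (intro divide_right_mono) auto
  finally show ?case .
qed simp

text \<open>Only the initial value is damped by \<open>r ^ n\<close>. For the forcing terms
  \<open>r \<le> 1\<close> is enough, so that they appear in the same weighted sum as in
  \<open>linear_recursion_lower\<close>.\<close>

lemma linear_recursion_abs:
  fixes a b :: "nat \<Rightarrow> real"
  assumes "\<And>j. j < n \<Longrightarrow> \<bar>a (Suc j) - c * a j\<bar> \<le> b j" "l > 0"
    and c: "\<bar>c\<bar> \<le> r * l" "0 \<le> r" "r \<le> 1"
  shows "\<bar>a n\<bar> / l ^ n \<le> r ^ n * \<bar>a 0\<bar> + (\<Sum>j<n. b j / l ^ Suc j)"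
  using assms(1)
proof (induction n)
  case (Suc n)
  have "0 \<le> b j" if "j < n" for j using Suc.prems[of j] that by fastforce
  then have s0: "0 \<le> (\<Sum>j<n. b j / l ^ Suc j)"
    using assms(2) by (intro sum_nonneg divide_nonneg_nonneg) auto
  have "\<bar>a (Suc n)\<bar> \<le> \<bar>c * a n\<bar> + b n" using Suc.prems[of n] by linarith
  also have "\<dots> \<le> r * l * \<bar>a n\<bar> + b n" unfolding abs_mult by (intro add_right_mono mult_right_mono c) auto
  finally have "\<bar>a (Suc n)\<bar> / l ^ Suc n \<le> (r * l * \<bar>a n\<bar> + b n) / l ^ Suc n"
    using assms(2) by (intro divide_right_mono) auto
  also have "\<dots> = r * (\<bar>a n\<bar> / l ^ n) + b n / l ^ Suc n"
    using assms(2) by (simp add: field_simps)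
  also have "r * (\<bar>a n\<bar> / l ^ n) \<le> r * (r ^ n * \<bar>a 0\<bar> + (\<Sum>j<n. b j / l ^ Suc j))"
    using Suc.IH Suc.prems c by (intro mult_left_mono) auto
  also have "\<dots> \<le> r ^ Suc n * \<bar>a 0\<bar> + (\<Sum>j<n. b j / l ^ Suc j)"
    using mult_right_mono[OF c(3) s0] by (simp add: algebra_simps)
  finally show ?case by simp
qed simp

text \<open>The exponent \<open>2 + e\<close> lies between the cubic order of the error at 0 and its
  linear growth at infinity; the two regimes meet at \<open>\<bar>u\<bar> = 1\<close>.\<close>

lemma abs_sin_minus_self_le:
  fixes u :: real
  assumes "0 < e" "e < 1" shows "\<bar>sin u - u\<bar> \<le> 2 * \<bar>u\<bar> powr (2 + e)"
proof (cases "\<bar>u\<bar> \<le> 1")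
  case True
  have "\<bar>sin u - u\<bar> = \<bar>sin u - (\<Sum>i<3. sin_coeff i * u ^ i)\<bar>"
    by (simp add: sin_coeff_def numeral_3_eq_3)
  also have "\<dots> \<le> inverse (fact 3) * \<bar>u\<bar> ^ 3"
    by (rule Maclaurin_sin_bound)
  also have "\<dots> \<le> 1 * \<bar>u\<bar> ^ 3" by (intro mult_right_mono) (auto simp: fact_numeral)
  also have "\<bar>u\<bar> ^ 3 \<le> \<bar>u\<bar> powr (2 + e)"
  proof (cases "u = 0")
    case False
    then have "\<bar>u\<bar> ^ 3 = \<bar>u\<bar> powr 3" by simp
    also have "\<dots> \<le> \<bar>u\<bar> powr (2 + e)" using True assms by (intro powr_mono') auto
    finally show ?thesis .
  qed simp
  finally show ?thesis by simp
next
  case False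
  have "\<bar>sin u - u\<bar> \<le> 1 + \<bar>u\<bar>" using abs_sin_le_one[of u] by linarith
  also have "\<dots> \<le> 2 * \<bar>u\<bar> powr 1" using False by auto
  also have "\<dots> \<le> 2 * \<bar>u\<bar> powr (2 + e)" using False assms by (intro mult_left_mono powr_mono) auto
  finally show ?thesis .
qed

lemma Maclaurin_cos_bound: "\<bar>cos x - (\<Sum>m<n. cos_coeff m * x ^ m)\<bar> \<le> inverse (fact n) * \<bar>x\<bar> ^ n"
proof -
  have *: "\<bar>c / f * v\<bar> \<le> inverse f * \<bar>v\<bar>" if "\<bar>c\<bar> \<le> 1" "0 < f" for c f v :: real
    using mult_right_mono[OF that(1), of "inverse f * \<bar>v\<bar>"] that(2) by (simp add: abs_mult divide_inverse mult.assoc)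
  obtain t where "cos x = (\<Sum>m<n. cos_coeff m * x ^ m) + (cos (t + 1 / 2 * real n * pi) / fact n) * x ^ n"
    using Maclaurin_cos_expansion[of x n] by blast
  then show ?thesis
    using *[OF abs_cos_le_one fact_gt_zero, of "t + 1 / 2 * real n * pi" n "x ^ n"] by (simp add: power_abs)
qed

lemma one_minus_cos_le: "1 - cos u \<le> u\<^sup>2 / 2" for u :: real
proof -
  have "\<bar>sin (u / 2)\<bar> \<le> \<bar>u / 2\<bar>" by (rule abs_sin_x_le_abs_x)
  then have "(sin (u / 2))\<^sup>2 \<le> (u / 2)\<^sup>2" by (rule abs_le_square_iff[THEN iffD1])
  moreover have "cos u = 1 - 2 * (sin (u / 2))\<^sup>2" using cos_double_sin[of "u / 2"] by simp
  ultimately show ?thesis by (simp add: power2_eq_square)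
qed

lemma abs_cos_taylor2_le:
  fixes u :: real
  assumes "0 < e" "e < 1" shows "\<bar>cos u - 1 + u\<^sup>2 / 2\<bar> \<le> \<bar>u\<bar> powr (2 + e)"
proof (cases "\<bar>u\<bar> \<le> 1")
  case True
  have "\<bar>cos u - 1 + u\<^sup>2 / 2\<bar> = \<bar>cos u - (\<Sum>i<4. cos_coeff i * u ^ i)\<bar>"
  proof -
    have "{..<4} = {0, 1, 2, 3 :: nat}" by auto
    then show ?thesis by (simp add: cos_coeff_def fact_numeral)
  qed
  also have "\<dots> \<le> inverse (fact 4) * \<bar>u\<bar> ^ 4"
    by (rule Maclaurin_cos_bound)
  also have "\<dots> \<le> 1 * \<bar>u\<bar> ^ 4" by (intro mult_right_mono) (auto simp: fact_numeral)
  also have "\<bar>u\<bar> ^ 4 \<le> \<bar>u\<bar> powr (2 + e)"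
  proof (cases "u = 0")
    case False
    then have "\<bar>u\<bar> ^ 4 = \<bar>u\<bar> powr 4" by simp
    also have "\<dots> \<le> \<bar>u\<bar> powr (2 + e)" using True assms by (intro powr_mono') auto
    finally show ?thesis .
  qed simp
  finally show ?thesis by simp
next
  case False
  have "\<bar>cos u - 1 + u\<^sup>2 / 2\<bar> \<le> u\<^sup>2 / 2" using one_minus_cos_le[of u] cos_le_one[of u] by linarith
  also have "\<dots> \<le> \<bar>u\<bar> powr 2" using False by auto
  also have "\<dots> \<le> \<bar>u\<bar> powr (2 + e)" using False assms by (intro powr_mono) auto
  finally show ?thesis .
qed

section \<open>Walks with mean zero and a moment of order 2 + eta\<close>

locale centered_walk = iid_walk +
  fixes \<sigma> \<eta> :: real
  assumes sigma_pos: "0 < \<sigma>" and eta: "0 < \<eta>" "\<eta> < 1"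
    and integrable_X: "integrable M (X 0)" and mean_zero: "expectation (X 0) = 0"
    and integrable_X2: "integrable M (\<lambda>\<omega>. (X 0 \<omega>)\<^sup>2)" and variance: "expectation (\<lambda>\<omega>. (X 0 \<omega>)\<^sup>2) = \<sigma>\<^sup>2"
    and integrable_moment: "integrable M (\<lambda>\<omega>. \<bar>X 0 \<omega>\<bar> powr (2 + \<eta>))"
begin

definition moment :: real where "moment = expectation (\<lambda>\<omega>. \<bar>X 0 \<omega>\<bar> powr (2 + \<eta>))"

lemma moment_nonneg: "0 \<le> moment"
  unfolding moment_def by (intro integral_nonneg_AE AE_I2) simp

lemma sinm_bound: "0 \<le> t \<Longrightarrow> \<bar>sinm t\<bar> \<le> 2 * moment * t powr (2 + \<eta>)"
proof -
  assume t: "0 \<le> t"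
  have i: "integrable M (\<lambda>\<omega>. sin (t * X 0 \<omega>))" by (intro integrable_const_bound[where B=1]) auto
  have "sinm t = expectation (\<lambda>\<omega>. sin (t * X 0 \<omega>) - t * X 0 \<omega>)"
    using i integrable_X by (simp add: sinm_def mean_zero)
  also have "\<bar>\<dots>\<bar> \<le> expectation (\<lambda>\<omega>. \<bar>sin (t * X 0 \<omega>) - t * X 0 \<omega>\<bar>)" by (rule integral_abs_bound)
  also have "\<dots> \<le> expectation (\<lambda>\<omega>. 2 * t powr (2 + \<eta>) * \<bar>X 0 \<omega>\<bar> powr (2 + \<eta>))"
  proof (rule integral_mono)
    fix \<omega>
    show "\<bar>sin (t * X 0 \<omega>) - t * X 0 \<omega>\<bar> \<le> 2 * t powr (2 + \<eta>) * \<bar>X 0 \<omega>\<bar> powr (2 + \<eta>)"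
      using abs_sin_minus_self_le[OF eta, of "t * X 0 \<omega>"] t by (simp add: abs_mult powr_mult)
  qed (use i integrable_X integrable_moment in auto)
  also have "\<dots> = 2 * moment * t powr (2 + \<eta>)" by (simp add: moment_def)
  finally show ?thesis .
qed

lemma cosm_bound: "0 \<le> t \<Longrightarrow> \<bar>cosm t - 1 + \<sigma>\<^sup>2 * t\<^sup>2 / 2\<bar> \<le> moment * t powr (2 + \<eta>)"
proof -
  assume t: "0 \<le> t"
  have i: "integrable M (\<lambda>\<omega>. cos (t * X 0 \<omega>))" by (intro integrable_const_bound[where B=1]) auto
  have e: "(t * X 0 \<omega>)\<^sup>2 / 2 = (t\<^sup>2 / 2) * (X 0 \<omega>)\<^sup>2" for \<omega> by (simp add: power_mult_distrib)
  have "cosm t - 1 + \<sigma>\<^sup>2 * t\<^sup>2 / 2 = expectation (\<lambda>\<omega>. cos (t * X 0 \<omega>) - 1 + (t * X 0 \<omega>)\<^sup>2 / 2)"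
    unfolding e using i integrable_X2 by (simp add: cosm_def variance prob_space)
  also have "\<bar>\<dots>\<bar> \<le> expectation (\<lambda>\<omega>. \<bar>cos (t * X 0 \<omega>) - 1 + (t * X 0 \<omega>)\<^sup>2 / 2\<bar>)" by (rule integral_abs_bound)
  also have "\<dots> \<le> expectation (\<lambda>\<omega>. t powr (2 + \<eta>) * \<bar>X 0 \<omega>\<bar> powr (2 + \<eta>))"
  proof (rule integral_mono)
    show "integrable M (\<lambda>\<omega>. \<bar>cos (t * X 0 \<omega>) - 1 + (t * X 0 \<omega>)\<^sup>2 / 2\<bar>)"
      unfolding e using i integrable_X2 by auto
    fix \<omega>
    show "\<bar>cos (t * X 0 \<omega>) - 1 + (t * X 0 \<omega>)\<^sup>2 / 2\<bar> \<le> t powr (2 + \<eta>) * \<bar>X 0 \<omega>\<bar> powr (2 + \<eta>)"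
      using abs_cos_taylor2_le[OF eta, of "t * X 0 \<omega>"] t by (simp add: abs_mult powr_mult)
  qed (use integrable_moment in auto)
  also have "\<dots> = moment * t powr (2 + \<eta>)" by (simp add: moment_def)
  finally show ?thesis .
qed

lemma tail_bound: "0 < y \<Longrightarrow> prob {\<omega> \<in> space M. \<bar>X 0 \<omega>\<bar> > y} \<le> moment * y powr - (2 + \<eta>)"
proof -
  assume y: "0 < y"
  have "prob {\<omega> \<in> space M. \<bar>X 0 \<omega>\<bar> > y} \<le> prob {\<omega> \<in> space M. y powr (2 + \<eta>) \<le> \<bar>X 0 \<omega>\<bar> powr (2 + \<eta>)}"
    using y eta by (intro finite_measure_mono) (auto intro!: powr_mono2)
  also have "\<dots> \<le> moment / y powr (2 + \<eta>)"
    unfolding moment_def using y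
    by (intro integral_Markov_inequality_measure[where A="space M"] integrable_moment) auto
  finally show ?thesis by (simp only: powr_minus divide_inverse)
qed

end

lemma sin_ge_half: "0 \<le> w \<Longrightarrow> w \<le> 1 \<Longrightarrow> w / 2 \<le> sin w" for w :: real
proof -
  assume w: "0 \<le> w" "w \<le> 1"
  have "{..<3} = {0, 1, 2 :: nat}" by auto
  then have "\<bar>sin w - w\<bar> \<le> inverse (fact 3) * \<bar>w\<bar> ^ 3"
    using Maclaurin_sin_bound[of w 3] by (simp add: sin_coeff_def)
  moreover have "\<bar>w\<bar> ^ 3 \<le> w"
    using w power_decreasing[of 1 3 w] by simp
  moreover have "inverse (fact 3) = (1 / 6 :: real)" by (simp add: fact_numeral)
  ultimately have "\<bar>sin w - w\<bar> \<le> 1 / 6 * w" by simp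
  then show ?thesis using w by (simp only: abs_le_iff) linarith
qed

context centered_walk
begin

text \<open>Each power of \<open>kap\<close> is a loss in \<open>upper_bounds\<close>: the tail
  beyond the small widening costs at most three, dividing by \<open>c\<close> one more, and
  \<open>2 + kap\<close> has to remain. \<open>16 * kap = \<eta>\<close> leaves room for all of
  them.\<close>

definition kap :: real where "kap = \<eta> / 16"

text \<open>The losses in \<open>upper_bounds\<close>: \<open>\<sigma>\<^sup>2\<close> from the
  wider interval, 12 moments from sine and tail divided by \<open>c\<close>, and 2 from comparing
  the eigenvalues at the two frequencies. The factor 2 makes up for
  \<open>cosm t \<ge> 1 / 2\<close>.\<close>

definition err :: real where "err = 2 * (\<sigma>\<^sup>2 + 14 * moment)"

lemma kap: "0 < kap" "kap < 1" "16 * kap = \<eta>" using eta by (auto simp: kap_def)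

lemma err_nonneg: "0 \<le> err" using moment_nonneg by (simp add: err_def)

lemma err_ge: "28 * moment \<le> err" by (simp add: err_def)

lemma powr_le_kap: "0 < t \<Longrightarrow> t \<le> 1 \<Longrightarrow> 2 + kap \<le> e \<Longrightarrow> t powr e \<le> t powr (2 + kap)"
  by (rule powr_mono') auto

lemma tail_bound_scaled: 
  assumes "0 < t" "0 < d" "d / t \<le> y"
  shows "prob {\<omega> \<in> space M. \<bar>X 0 \<omega>\<bar> > y} \<le> moment * (d powr - (2 + \<eta>) * t powr (2 + \<eta>))"
proof -
  have "prob {\<omega> \<in> space M. \<bar>X 0 \<omega>\<bar> > y} \<le> prob {\<omega> \<in> space M. \<bar>X 0 \<omega>\<bar> > d / t}"
    using assms by (intro finite_measure_mono) auto
  also have "\<dots> \<le> moment * (d / t) powr - (2 + \<eta>)"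
    using assms by (intro tail_bound) auto
  also have "(d / t) powr - (2 + \<eta>) = d powr - (2 + \<eta>) * t powr (2 + \<eta>)"
  proof -
    have "(d / t) powr (2 + \<eta>) = d powr (2 + \<eta>) / t powr (2 + \<eta>)"
      using assms by (intro powr_divide)
    then show ?thesis by (auto simp only: powr_minus inverse_divide divide_inverse inverse_mult_distrib inverse_inverse_eq)
  qed
  finally show ?thesis .
qed

text \<open>The recursion is applied with the interval widened by the factor
  \<open>1 + t powr kap\<close>: large enough for a small tail beyond \<open>x' - x\<close>, small
  enough to change the eigenvalue only by order \<open>t powr (2 + kap)\<close>. The first mode only
  grows when the frequency is lowered, so its bound has no prefactor; passing to the probability
  divides by \<open>c\<close>, which is of order \<open>t powr kap\<close>.\<close>

lemma upper_bounds:
  fixes x t :: real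
  defines "t \<equiv> pi / (2 * x)"
  assumes x: "0 < x" and t1: "t \<le> 1" and L: "1 / 2 \<le> cosm t"
  shows "ev x j (\<lambda>s. cos (t * s)) j \<le> (cosm t * exp (err * t powr (2 + kap))) ^ j"
    and "pstay x j \<le> 4 * t powr - kap * (cosm t * exp (err * t powr (2 + kap))) ^ j"
proof -
  define d where "d = t powr kap"
  define x' where "x' = x * (1 + d)"
  define t' where "t' = pi / (2 * x')"
  define c where "c = cos (t' * x)"
  define T where "T = t powr (2 + kap)"
  define lam where "lam = cosm t * exp (err * T)"
  have t0: "0 < t" using x by (simp add: t_def)
  have d: "0 < d" "d \<le> 1"
    unfolding d_def using t0 t1 kap by (auto intro!: powr_le1)
  have T0: "0 < T" using t0 by (simp add: T_def)
  have x': "x < x'" using x d by (simp add: x'_def)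
  have t': "t' = t / (1 + d)" using x d by (simp add: t'_def t_def x'_def)
  have t'0: "0 < t'" "t' \<le> t" unfolding t' using t0 d by (auto simp: field_simps)
  have c_ge: "d / 4 \<le> c"
  proof -
    define w where "w = pi / 2 * (d / (1 + d))"
    have "1 / (1 + d) = 1 - d / (1 + d)" using d by (simp add: field_simps)
    moreover have "t' * x = pi / 2 * (1 / (1 + d))" unfolding t' t_def using x by simp
    ultimately have "t' * x = pi / 2 - w" by (simp only: w_def right_diff_distrib mult_1_right)
    \<comment> \<open>The angle misses \<open>pi / 2\<close> by \<open>w\<close>, which is of order
      \<open>d\<close>; hence so is the cosine.\<close>
    then have "c = sin w" unfolding c_def by (simp add: cos_diff)
    moreover have "w \<le> 1"
    proof -
      have "d / (1 + d) \<le> 1 / 2" using d by (simp add: field_simps)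
      then have "w \<le> pi / 2 * (1 / 2)" unfolding w_def by (intro mult_left_mono) auto
      then show ?thesis using pi_less_4 by simp
    qed
    moreover have "d / 2 \<le> w"
    proof -
      have "d / 2 \<le> d / (1 + d)" using d by (intro divide_left_mono) auto
      moreover have "1 * (d / (1 + d)) \<le> pi / 2 * (d / (1 + d))"
        using d pi_gt3 by (intro mult_right_mono) auto
      ultimately show ?thesis unfolding w_def by linarith
    qed
    ultimately show ?thesis using sin_ge_half[of w] d by simp
  qed
  have c0: "0 < c" using c_ge d by linarith
  have tx: "1 / t \<le> x" using x pi_ge_two by (simp add: t_def field_simps)
  define e where "e = \<bar>sinm t'\<bar> + prob {\<omega> \<in> space M. \<bar>X 0 \<omega>\<bar> > x' - x}"
  have e_le: "e \<le> moment * (3 * t powr (2 + \<eta> - 3 * kap))"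
  proof -
    have m: "t powr (2 + \<eta>) \<le> t powr (2 + \<eta> - 3 * kap)" using t0 t1 kap by (intro powr_mono') auto
    have "\<bar>sinm t'\<bar> \<le> 2 * moment * t' powr (2 + \<eta>)" using t'0 by (intro sinm_bound) auto
    also have "\<dots> \<le> 2 * moment * t powr (2 + \<eta>)"
      using t'0 eta moment_nonneg by (intro mult_left_mono powr_mono2) auto
    also have "\<dots> \<le> 2 * moment * t powr (2 + \<eta> - 3 * kap)"
      using moment_nonneg by (intro mult_left_mono m) auto
    finally have 1: "\<bar>sinm t'\<bar> \<le> 2 * moment * t powr (2 + \<eta> - 3 * kap)" .
    have "prob {\<omega> \<in> space M. \<bar>X 0 \<omega>\<bar> > x' - x} \<le> moment * (d powr - (2 + \<eta>) * t powr (2 + \<eta>))"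
    proof (rule tail_bound_scaled[OF t0 d(1)])
      have "d * (1 / t) \<le> d * x" using tx d by (intro mult_left_mono) auto
      then show "d / t \<le> x' - x" by (simp add: x'_def algebra_simps)
    qed
    also have "d powr - (2 + \<eta>) * t powr (2 + \<eta>) = t powr (2 + \<eta> - (2 + \<eta>) * kap)"
      unfolding d_def powr_powr powr_add[symmetric] by (simp add: algebra_simps)
    also have "\<dots> \<le> t powr (2 + \<eta> - 3 * kap)"
      using t0 t1 kap eta by (intro powr_mono') (auto intro!: mult_right_mono)
    finally have 2: "prob {\<omega> \<in> space M. \<bar>X 0 \<omega>\<bar> > x' - x} \<le> moment * t powr (2 + \<eta> - 3 * kap)"
      using moment_nonneg by (auto simp: mult_left_mono)
    show ?thesis using 1 2 by (simp add: e_def algebra_simps)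
  qed
  have ec: "e / c \<le> 12 * moment * T"
  proof -
    have "e / c \<le> (moment * (3 * t powr (2 + \<eta> - 3 * kap))) / (d / 4)"
      using e_le c_ge d moment_nonneg by (intro frac_le) auto
    also have "\<dots> = 12 * moment * (t powr (2 + \<eta> - 3 * kap) / t powr kap)"
      using d by (simp add: d_def)
    also have "t powr (2 + \<eta> - 3 * kap) / t powr kap = t powr (2 + \<eta> - 4 * kap)"
      by (simp add: powr_diff[symmetric])
    also have "12 * moment * \<dots> \<le> 12 * moment * T"
      unfolding T_def using t0 t1 kap moment_nonneg by (intro mult_left_mono powr_le_kap) auto
    finally show ?thesis .
  qed
  have T_eta: "t powr (2 + \<eta>) \<le> T"
    unfolding T_def using t0 t1 kap by (intro powr_le_kap) auto
  have Td: "t\<^sup>2 * d = T"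
    unfolding T_def d_def powr_add using t0 by simp
  have "cosm t' \<le> 1 - \<sigma>\<^sup>2 * t'\<^sup>2 / 2 + moment * t' powr (2 + \<eta>)"
    using cosm_bound[of t'] t'0 by linarith
  also have "moment * t' powr (2 + \<eta>) \<le> moment * T"
    using t'0 eta moment_nonneg by (intro mult_left_mono order_trans[OF powr_mono2 T_eta]) auto
  also have "1 - \<sigma>\<^sup>2 * t'\<^sup>2 / 2 \<le> 1 - \<sigma>\<^sup>2 * t\<^sup>2 / 2 + \<sigma>\<^sup>2 * T"
  proof -
    have "1 - 2 * d \<le> 1 / (1 + d)\<^sup>2"
    proof -
      have "(1 - 2 * d) * (1 + d)\<^sup>2 = 1 - d\<^sup>2 * (3 + 2 * d)" by (simp add: power2_eq_square algebra_simps)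
      also have "\<dots> \<le> 1" using d by simp
      finally show ?thesis using d by (simp add: field_simps)
    qed
    then have "t\<^sup>2 * (1 - 2 * d) \<le> t'\<^sup>2"
      using mult_left_mono[of "1 - 2 * d" "1 / (1 + d)\<^sup>2" "t\<^sup>2"] by (simp add: t' power_divide)
    then have "t\<^sup>2 - 2 * T \<le> t'\<^sup>2" unfolding Td[symmetric] by (simp add: algebra_simps)
    then have "\<sigma>\<^sup>2 * (t\<^sup>2 - 2 * T) \<le> \<sigma>\<^sup>2 * t'\<^sup>2" by (intro mult_left_mono) auto
    then show ?thesis by (simp add: algebra_simps)
  qed
  also have "1 - \<sigma>\<^sup>2 * t\<^sup>2 / 2 \<le> cosm t + moment * T"
  proof -
    have "moment * t powr (2 + \<eta>) \<le> moment * T" using moment_nonneg T_eta by (intro mult_left_mono) auto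
    then show ?thesis using cosm_bound[of t] t0 by linarith
  qed
  finally have up: "cosm t' \<le> cosm t + moment * T + \<sigma>\<^sup>2 * T + moment * T" by simp
  have errh: "err / 2 = \<sigma>\<^sup>2 + 14 * moment" by (simp add: err_def)
  have "cosm t' + e / c \<le> cosm t + err / 2 * T"
    using ec up unfolding errh by (simp add: algebra_simps)
  also have "\<dots> \<le> cosm t * (1 + err * T)"
  proof -
    have "1 / 2 * (err * T) \<le> cosm t * (err * T)" using L T0 err_nonneg by (intro mult_right_mono) auto
    then show ?thesis by (simp add: algebra_simps)
  qed
  also have "\<dots> \<le> lam" unfolding lam_def using L by (intro mult_left_mono exp_ge_add_one_self) auto
  finally have lam: "cosm t' + e / c \<le> lam" .
  note rec = upper_recursion[OF x x', folded t'_def, folded c_def, folded e_def, OF lam]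
  have "ev x j (\<lambda>s. cos (t * s)) j \<le> ev x j (\<lambda>s. cos (t' * s)) j"
  proof (rule ev_mono[where K=1 and L=1])
    fix s assume s: "\<bar>s\<bar> \<le> x"
    have "t * \<bar>s\<bar> \<le> t * x" using s t0 by (intro mult_left_mono) auto
    also have "\<dots> = pi / 2" using x by (simp add: t_def)
    finally have "t * \<bar>s\<bar> \<le> pi" using pi_gt_zero by linarith
    then have "cos (t * \<bar>s\<bar>) \<le> cos (t' * \<bar>s\<bar>)"
      using t'0 by (intro cos_monotone_0_pi_le) (auto intro: mult_right_mono)
    then show "cos (t * s) \<le> cos (t' * s)" by (cases "s \<ge> 0") auto
  qed (use x in auto)
  also have "\<dots> \<le> lam ^ j" by (rule rec)
  finally show "ev x j (\<lambda>s. cos (t * s)) j \<le> (cosm t * exp (err * t powr (2 + kap))) ^ j"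
    by (simp add: lam_def T_def)
  have "c * pstay x j \<le> lam ^ j" using rec(1,2)[of j] by linarith
  then have "pstay x j \<le> lam ^ j / c" using c0 by (simp add: field_simps)
  also have "\<dots> \<le> lam ^ j / (d / 4)"
    using c_ge d L c0 by (intro divide_left_mono) (auto simp: lam_def)
  also have "\<dots> = 4 * t powr - kap * lam ^ j"
    using t0 by (simp add: d_def powr_minus field_simps)
  finally show "pstay x j \<le> 4 * t powr - kap * (cosm t * exp (err * t powr (2 + kap))) ^ j"
    by (simp add: lam_def T_def)
qed

text \<open>The first mode cannot lose mass, which forces the weighted sum of the overshoot terms to be small; this in
  turn controls the higher modes.\<close>

lemma mode_bounds:
  fixes x t :: real and n :: nat
  defines "t \<equiv> pi / (2 * x)"
  defines "S \<equiv> real n * t powr (2 + kap)"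
  assumes x: "0 < x" and t1: "t \<le> 1" and L: "1 / 2 \<le> cosm t" and S1: "S \<le> 1"
  defines "C \<equiv> err * exp err"
  shows "1 - 2 * C * S \<le> ev x n (\<lambda>s. cos (t * s)) n / cosm t ^ n"
    and "ev x n (\<lambda>s. cos (t * s)) n / cosm t ^ n \<le> exp (err * S)"
    and "\<lbrakk>\<bar>cosm ((2 * real k + 1) * t)\<bar> \<le> r * cosm t; 0 \<le> r; r \<le> 1\<rbrakk> \<Longrightarrow>
       \<bar>ev x n (\<lambda>s. cos ((2 * real k + 1) * t * s)) n\<bar> / cosm t ^ n
       \<le> r ^ n + (2 * real k + 1) ^ 3 * (4 * C * S + (exp (err * S) - 1))"
proof -
  define R where "R = exp (err * S)"
  define B where "B j = exit_ev x j (\<lambda>s. \<bar>cos (t * s)\<bar>)" for j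
  let ?L = "cosm t"
  have t0: "0 < t" using x by (simp add: t_def)
  have L0: "0 < ?L" using L by linarith
  have S0: "0 \<le> S" by (simp add: S_def)
  have S_eq: "S = t powr (2 + kap) * real n" by (simp add: S_def)
  have Rj: "exp (err * t powr (2 + kap)) ^ j \<le> R" if "j \<le> n" for j
  proof -
    have "real j * (err * t powr (2 + kap)) \<le> real n * (err * t powr (2 + kap))"
      using that err_nonneg by (intro mult_right_mono) auto
    then show ?thesis unfolding R_def S_eq exp_of_nat_mult[symmetric] by (simp add: algebra_simps)
  qed
  have R_le: "R \<le> exp err" unfolding R_def using S1 err_nonneg mult_left_mono[of S 1 err] by simp
  have R0: "0 < R" by (simp add: R_def)
  have a_le: "ev x j (\<lambda>s. cos (t * s)) j / ?L ^ j \<le> R" if "j \<le> n" for j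
  proof -
    have "ev x j (\<lambda>s. cos (t * s)) j \<le> ?L ^ j * R"
      using upper_bounds(1)[OF x t1[unfolded t_def] L[unfolded t_def], of j] Rj[OF that] L0
      unfolding t_def[symmetric] power_mult_distrib by (meson mult_left_mono order_trans zero_le_power less_imp_le)
    then show ?thesis using L0 by (simp add: field_simps)
  qed
  then show "ev x n (\<lambda>s. cos (t * s)) n / ?L ^ n \<le> exp (err * S)" by (simp add: R_def)
  have p_le: "pstay x j / ?L ^ Suc j \<le> 8 * t powr - kap * R" if "j < n" for j
  proof -
    have "pstay x j \<le> 4 * t powr - kap * (?L ^ j * R)"
      using upper_bounds(2)[OF x t1[unfolded t_def] L[unfolded t_def], of j] Rj[of j] L0 that
      unfolding t_def[symmetric] power_mult_distrib
      by (meson mult_left_mono order_trans zero_le_power less_imp_le powr_ge_zero mult_nonneg_nonneg zero_le_numeral)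
    then have "pstay x j / ?L ^ Suc j \<le> 4 * t powr - kap * (?L ^ j * R) / ?L ^ Suc j"
      using L0 by (intro divide_right_mono) auto
    also have "\<dots> = 4 * t powr - kap * R * (1 / ?L)" using L0 by (simp add: field_simps)
    also have "\<dots> \<le> 4 * t powr - kap * R * 2"
      using L R0 by (intro mult_left_mono) (auto simp: field_simps)
    finally show ?thesis by simp
  qed
  have sum_p: "(\<Sum>j<n. pstay x j / ?L ^ Suc j) \<le> 8 * real n * t powr - kap * R"
  proof -
    have "(\<Sum>j<n. pstay x j / ?L ^ Suc j) \<le> (\<Sum>j<n. 8 * t powr - kap * R)" by (intro sum_mono p_le) auto
    then show ?thesis by (simp add: algebra_simps)
  qed
  \<comment> \<open>The crude bound on \<open>pstay\<close> brings in \<open>t powr - kap\<close>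
    (and a factor 2 from the extra \<open>1 / ?L\<close>). The error per step,
    \<open>t powr (2 + \<eta>)\<close>, can afford this and still leaves
    \<open>real n * t powr (2 + kap) = S\<close>.\<close>
  have sum_err: "c * t powr (2 + \<eta>) * (\<Sum>j<n. pstay x j / ?L ^ Suc j) \<le> 8 * c * exp err * S" if "0 \<le> c" for c
  proof -
    have "c * t powr (2 + \<eta>) * (\<Sum>j<n. pstay x j / ?L ^ Suc j) \<le> c * t powr (2 + \<eta>) * (8 * real n * t powr - kap * R)"
      using that by (intro mult_left_mono sum_p) auto
    also have "\<dots> = 8 * c * R * (real n * (t powr (2 + \<eta>) * t powr - kap))" by simp
    also have "t powr (2 + \<eta>) * t powr - kap = t powr (2 + \<eta> - kap)" by (simp add: powr_add[symmetric])
    also have "8 * c * R * (real n * t powr (2 + \<eta> - kap)) \<le> 8 * c * exp err * (real n * t powr (2 + kap))"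
      using that R_le R0 t0 t1 kap by (intro mult_mono powr_le_kap) auto
    finally show ?thesis by (simp add: S_def)
  qed
  define E where "E = \<bar>sinm t\<bar> + 2 * prob {\<omega> \<in> space M. \<bar>X 0 \<omega>\<bar> > 2 * x}"
  have E_le: "E \<le> 4 * moment * t powr (2 + \<eta>)"
  proof -
    have "1 / t \<le> 2 * x" using x pi_ge_two by (simp add: t_def field_simps)
    then have "prob {\<omega> \<in> space M. \<bar>X 0 \<omega>\<bar> > 2 * x} \<le> moment * (1 powr - (2 + \<eta>) * t powr (2 + \<eta>))"
      using t0 by (intro tail_bound_scaled) auto
    then show ?thesis using sinm_bound[of t] t0 by (simp add: E_def algebra_simps)
  qed
  have "1 + (\<Sum>j<n. (B j - E * pstay x j) / ?L ^ Suc j) \<le> ev x n (\<lambda>s. cos (t * s)) n / ?L ^ n"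
    using linear_recursion_lower[of n ?L "\<lambda>j. ev x j (\<lambda>s. cos (t * s)) j" "\<lambda>j. B j - E * pstay x j"] L0
      lower_recursion[OF x] unfolding t_def[symmetric] E_def[symmetric] B_def[symmetric]
    by (simp add: ev_0 algebra_simps)
  also have "(\<Sum>j<n. (B j - E * pstay x j) / ?L ^ Suc j) = (\<Sum>j<n. B j / ?L ^ Suc j) - E * (\<Sum>j<n. pstay x j / ?L ^ Suc j)"
    by (simp only: diff_divide_distrib sum_subtractf sum_distrib_left times_divide_eq_right)
  finally have low: "1 + (\<Sum>j<n. B j / ?L ^ Suc j) - E * (\<Sum>j<n. pstay x j / ?L ^ Suc j)
     \<le> ev x n (\<lambda>s. cos (t * s)) n / ?L ^ n" by simp
  have sp0: "0 \<le> (\<Sum>j<n. pstay x j / ?L ^ Suc j)" using L0 by (intro sum_nonneg) auto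
  have "E * (\<Sum>j<n. pstay x j / ?L ^ Suc j) \<le> 4 * moment * t powr (2 + \<eta>) * (\<Sum>j<n. pstay x j / ?L ^ Suc j)"
    by (intro mult_right_mono E_le sp0)
  also have "\<dots> \<le> 8 * (4 * moment) * exp err * S" using moment_nonneg by (intro sum_err) auto
  also have "\<dots> \<le> 2 * C * S"
  proof -
    have "8 * (4 * moment) * (exp err * S) \<le> 2 * err * (exp err * S)"
      using err_ge moment_nonneg S0 by (intro mult_right_mono) auto
    then show ?thesis by (simp add: C_def)
  qed
  finally have ES: "E * (\<Sum>j<n. pstay x j / ?L ^ Suc j) \<le> 2 * C * S" .
  have B0: "0 \<le> B j" for j unfolding B_def by (rule exit_ev_nonneg) simp
  have sB0: "0 \<le> (\<Sum>j<n. B j / ?L ^ Suc j)" using L0 B0 by (intro sum_nonneg) auto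
  show "1 - 2 * C * S \<le> ev x n (\<lambda>s. cos (t * s)) n / ?L ^ n" using low ES sB0 by linarith
  \<comment> \<open>The lower recursion adds this sum to a first mode that is itself at most
    \<open>R\<close>, so the sum has no room to be large.\<close>
  have sB: "(\<Sum>j<n. B j / ?L ^ Suc j) \<le> R - 1 + 2 * C * S" using low ES a_le[of n] by linarith
  assume r: "\<bar>cosm ((2 * real k + 1) * t)\<bar> \<le> r * ?L" "0 \<le> r" "r \<le> 1"
  let ?u = "(2 * real k + 1) * t" and ?q = "2 * real k + 1"
  have "\<bar>ev x n (\<lambda>s. cos (?u * s)) n\<bar> / ?L ^ n
     \<le> r ^ n * \<bar>ev x 0 (\<lambda>s. cos (?u * s)) 0\<bar> + (\<Sum>j<n. (\<bar>sinm ?u\<bar> * pstay x j + ?q * B j) / ?L ^ Suc j)"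
    by (rule linear_recursion_abs[OF _ L0 r])
       (use higher_mode_recursion[where k=k and x=x] in \<open>auto simp: B_def t_def\<close>)
  also have "(\<Sum>j<n. (\<bar>sinm ?u\<bar> * pstay x j + ?q * B j) / ?L ^ Suc j) =
     \<bar>sinm ?u\<bar> * (\<Sum>j<n. pstay x j / ?L ^ Suc j) + ?q * (\<Sum>j<n. B j / ?L ^ Suc j)"
    by (simp only: add_divide_distrib sum.distrib sum_distrib_left times_divide_eq_right)
  also have "ev x 0 (\<lambda>s. cos (?u * s)) 0 = 1" by (rule ev_0) simp
  also have "\<bar>sinm ?u\<bar> * (\<Sum>j<n. pstay x j / ?L ^ Suc j)
     \<le> (2 * moment * ?q ^ 3) * t powr (2 + \<eta>) * (\<Sum>j<n. pstay x j / ?L ^ Suc j)"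
  proof (rule mult_right_mono[OF _ sp0])
    have "\<bar>sinm ?u\<bar> \<le> 2 * moment * ?u powr (2 + \<eta>)" using t0 by (intro sinm_bound) auto
    also have "?u powr (2 + \<eta>) = ?q powr (2 + \<eta>) * t powr (2 + \<eta>)" using t0 by (simp add: powr_mult)
    also have "?q powr (2 + \<eta>) \<le> ?q ^ 3"
      using powr_mono[of "2 + \<eta>" 3 ?q] eta by simp
    finally show "\<bar>sinm ?u\<bar> \<le> (2 * moment * ?q ^ 3) * t powr (2 + \<eta>)"
      using moment_nonneg by (simp add: mult_left_mono mult_right_mono mult.assoc)
  qed
  also have "\<dots> \<le> 8 * (2 * moment * ?q ^ 3) * exp err * S"
    using moment_nonneg by (intro sum_err) auto
  also have "\<dots> \<le> ?q ^ 3 * (C * S)"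
  proof -
    have "16 * moment * (?q ^ 3 * (exp err * S)) \<le> err * (?q ^ 3 * (exp err * S))"
      using err_ge moment_nonneg S0 by (intro mult_right_mono) auto
    then show ?thesis by (simp add: C_def algebra_simps)
  qed
  also have "?q * (\<Sum>j<n. B j / ?L ^ Suc j) \<le> ?q ^ 3 * (R - 1 + 2 * C * S)"
  proof (rule mult_mono[OF _ sB _ sB0])
    show "?q \<le> ?q ^ 3" using power_increasing[of 1 3 ?q] by simp
  qed auto
  finally have "\<bar>ev x n (\<lambda>s. cos (?u * s)) n\<bar> / ?L ^ n \<le> r ^ n + (?q ^ 3 * (C * S) + ?q ^ 3 * (R - 1 + 2 * C * S))"
    by simp
  also have "\<dots> \<le> r ^ n + ?q ^ 3 * (4 * C * S + (R - 1))"
  proof -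
    have "0 \<le> ?q ^ 3 * (C * S)" using S0 err_nonneg by (simp add: C_def)
    then show ?thesis by (simp add: algebra_simps)
  qed
  finally show "\<bar>ev x n (\<lambda>s. cos (?u * s)) n\<bar> / ?L ^ n \<le> r ^ n + ?q ^ 3 * (4 * C * S + (exp (err * S) - 1))"
    by (simp add: R_def)
qed

end

section \<open>Second-order expansions under two moments\<close>

context iid_walk
begin

lemma psi_eq_char: "psi t = char (distr M borel (X 0)) t"
  unfolding psi_def char_def by (subst integral_distr) auto

context
  fixes v :: real
  assumes intX: "integrable M (X 0)" and mean0: "expectation (X 0) = 0"
    and intX2: "integrable M (\<lambda>\<omega>. (X 0 \<omega>)\<^sup>2)" and var: "expectation (\<lambda>\<omega>. (X 0 \<omega>)\<^sup>2) = v"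
begin

text \<open>Up to the factor \<open>t\<^sup>2 / 6\<close> this is the remainder bound of
  \<open>char_approx3'\<close>. It is dominated by \<open>6 * (X 0 \<omega>)\<^sup>2\<close> and its
  integrand tends to 0 pointwise, so two moments give an error \<open>o(t\<^sup>2)\<close> with no
  rate.\<close>

lemma second_order_remainder:
  "((\<lambda>t. expectation (\<lambda>\<omega>. min (6 * (X 0 \<omega>)\<^sup>2) (\<bar>t\<bar> * \<bar>X 0 \<omega>\<bar> ^ 3))) \<longlongrightarrow> 0) (at_right 0)"
  unfolding tendsto_at_iff_sequentially
proof (intro allI impI)
  fix T :: "nat \<Rightarrow> real" assume T: "T \<longlonglongrightarrow> 0"
  have "(\<lambda>n. expectation (\<lambda>\<omega>. min (6 * (X 0 \<omega>)\<^sup>2) (\<bar>T n\<bar> * \<bar>X 0 \<omega>\<bar> ^ 3))) \<longlonglongrightarrow> expectation (\<lambda>\<omega>. 0)"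
  proof (rule integral_dominated_convergence)
    show "integrable M (\<lambda>\<omega>. 6 * (X 0 \<omega>)\<^sup>2)" using intX2 by simp
    show "AE \<omega> in M. (\<lambda>n. min (6 * (X 0 \<omega>)\<^sup>2) (\<bar>T n\<bar> * \<bar>X 0 \<omega>\<bar> ^ 3)) \<longlonglongrightarrow> 0"
    proof (rule AE_I2)
      fix \<omega>
      have "(\<lambda>n. min (6 * (X 0 \<omega>)\<^sup>2) (\<bar>T n\<bar> * \<bar>X 0 \<omega>\<bar> ^ 3)) \<longlonglongrightarrow> min (6 * (X 0 \<omega>)\<^sup>2) (\<bar>0\<bar> * \<bar>X 0 \<omega>\<bar> ^ 3)"
        by (intro tendsto_intros T)
      then show "(\<lambda>n. min (6 * (X 0 \<omega>)\<^sup>2) (\<bar>T n\<bar> * \<bar>X 0 \<omega>\<bar> ^ 3)) \<longlonglongrightarrow> 0" by simp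
    qed
    fix n show "AE \<omega> in M. norm (min (6 * (X 0 \<omega>)\<^sup>2) (\<bar>T n\<bar> * \<bar>X 0 \<omega>\<bar> ^ 3)) \<le> 6 * (X 0 \<omega>)\<^sup>2"
      by (rule AE_I2) (auto simp: min_def)
  qed auto
  then show "((\<lambda>t. expectation (\<lambda>\<omega>. min (6 * (X 0 \<omega>)\<^sup>2) (\<bar>t\<bar> * \<bar>X 0 \<omega>\<bar> ^ 3))) \<circ> T) \<longlonglongrightarrow> 0"
    by (simp add: o_def)
qed

lemma psi_second_order:
  "((\<lambda>t. norm (psi t - (1 - t\<^sup>2 * v / 2)) / t\<^sup>2) \<longlongrightarrow> 0) (at_right 0)"
proof (rule tendsto_sandwich[where f="\<lambda>_. 0"])
  let ?E = "\<lambda>t. expectation (\<lambda>\<omega>. min (6 * (X 0 \<omega>)\<^sup>2) (\<bar>t\<bar> * \<bar>X 0 \<omega>\<bar> ^ 3))"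
  show "\<forall>\<^sub>F t in at_right 0. norm (psi t - (1 - t\<^sup>2 * v / 2)) / t\<^sup>2 \<le> ?E t / 6"
  proof (intro eventually_at_right_less[THEN eventually_mono])
    fix t :: real assume t: "0 < t"
    have "norm (psi t - (1 - t\<^sup>2 * v / 2)) \<le> t\<^sup>2 / 6 * ?E t"
      unfolding psi_eq_char
      by (rule char_approx3') (use intX intX2 mean0 var in auto)
    then show "norm (psi t - (1 - t\<^sup>2 * v / 2)) / t\<^sup>2 \<le> ?E t / 6"
      using t by (simp add: field_simps)
  qed
  show "((\<lambda>t. ?E t / 6) \<longlongrightarrow> 0) (at_right 0)"
    using tendsto_divide[OF second_order_remainder tendsto_const, of 6] by simp
qed auto

lemma cosm_second_order: "((\<lambda>t. (1 - cosm t) / t\<^sup>2) \<longlongrightarrow> v / 2) (at_right 0)"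
proof (rule Lim_transform_bound[THEN LIM_zero_cancel])
  show "((\<lambda>t. norm (psi t - (1 - t\<^sup>2 * v / 2)) / t\<^sup>2) \<longlongrightarrow> 0) (at_right 0)" by (rule psi_second_order)
  show "\<forall>\<^sub>F t in at_right 0. norm ((1 - cosm t) / t\<^sup>2 - v / 2) \<le> norm (norm (psi t - (1 - t\<^sup>2 * v / 2)) / t\<^sup>2)"
  proof (intro eventually_at_right_less[THEN eventually_mono])
    fix t :: real assume t: "0 < t"
    have "\<bar>cosm t - (1 - t\<^sup>2 * v / 2)\<bar> \<le> norm (psi t - (1 - t\<^sup>2 * v / 2))"
      using abs_Re_le_cmod[of "psi t - (1 - t\<^sup>2 * v / 2)"] by (simp add: psi_Re_Im flip: of_real_power)
    moreover have "(1 - cosm t) / t\<^sup>2 - v / 2 = - (cosm t - (1 - t\<^sup>2 * v / 2)) / t\<^sup>2" using t by (simp add: field_simps)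
    ultimately show "norm ((1 - cosm t) / t\<^sup>2 - v / 2) \<le> norm (norm (psi t - (1 - t\<^sup>2 * v / 2)) / t\<^sup>2)"
      by (simp add: abs_divide divide_right_mono)
  qed
qed

lemma sinm_second_order: "((\<lambda>t. sinm t / t\<^sup>2) \<longlongrightarrow> 0) (at_right 0)"
proof (rule Lim_transform_bound)
  show "((\<lambda>t. norm (psi t - (1 - t\<^sup>2 * v / 2)) / t\<^sup>2) \<longlongrightarrow> 0) (at_right 0)" by (rule psi_second_order)
  show "\<forall>\<^sub>F t in at_right 0. norm (sinm t / t\<^sup>2) \<le> norm (norm (psi t - (1 - t\<^sup>2 * v / 2)) / t\<^sup>2)"
  proof (intro always_eventually allI)
    fix t :: real
    have "\<bar>sinm t\<bar> \<le> norm (psi t - (1 - t\<^sup>2 * v / 2))"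
      using abs_Im_le_cmod[of "psi t - (1 - t\<^sup>2 * v / 2)"] by (simp add: psi_Re_Im flip: of_real_power)
    then show "norm (sinm t / t\<^sup>2) \<le> norm (norm (psi t - (1 - t\<^sup>2 * v / 2)) / t\<^sup>2)"
      by (simp add: abs_divide divide_right_mono)
  qed
qed

text \<open>Markov's inequality for the part of the second moment beyond \<open>y\<close>; that part
  vanishes by dominated convergence.\<close>

lemma tail_second_order: "((\<lambda>y. y\<^sup>2 * prob {\<omega> \<in> space M. \<bar>X 0 \<omega>\<bar> > y}) \<longlongrightarrow> 0) at_top"
proof (rule tendsto_sandwich[where f="\<lambda>_. 0"])
  let ?f = "\<lambda>y \<omega>. indicator {\<omega> \<in> space M. \<bar>X 0 \<omega>\<bar> > y} \<omega> * (X 0 \<omega>)\<^sup>2"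
  have "((\<lambda>y. expectation (?f y)) \<longlongrightarrow> expectation (\<lambda>\<omega>. 0)) at_top"
  proof (rule integral_dominated_convergence_at_top)
    show "integrable M (\<lambda>\<omega>. (X 0 \<omega>)\<^sup>2)" by (rule intX2)
    show "AE \<omega> in M. ((\<lambda>y. ?f y \<omega>) \<longlongrightarrow> 0) at_top"
    proof (rule AE_I2, rule tendsto_eventually)
      fix \<omega> show "\<forall>\<^sub>F y in at_top. ?f y \<omega> = 0"
        using eventually_ge_at_top[of "\<bar>X 0 \<omega>\<bar>"] by eventually_elim auto
    qed
  qed (auto simp: indicator_def)
  then show "((\<lambda>y. expectation (?f y)) \<longlongrightarrow> 0) at_top" by simp
  show "\<forall>\<^sub>F y in at_top. y\<^sup>2 * prob {\<omega> \<in> space M. \<bar>X 0 \<omega>\<bar> > y} \<le> expectation (?f y)"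
    using eventually_ge_at_top[of 0]
  proof eventually_elim
    fix y :: real assume y: "0 \<le> y"
    let ?A = "{\<omega> \<in> space M. \<bar>X 0 \<omega>\<bar> > y}"
    have A: "?A \<in> sets M" by measurable
    have "y\<^sup>2 * prob ?A = expectation (\<lambda>\<omega>. y\<^sup>2 * indicator ?A \<omega>)"
      using A by simp
    also have "\<dots> \<le> expectation (?f y)"
    proof (rule integral_mono)
      show "integrable M (?f y)"
        by (rule Bochner_Integration.integrable_bound[OF intX2]) (auto simp: indicator_def)
      show "integrable M (\<lambda>\<omega>. y\<^sup>2 * indicator ?A \<omega>)"
        by (intro integrable_const_bound[where B="y\<^sup>2"]) (auto simp: indicator_def)
      fix \<omega> show "y\<^sup>2 * indicator ?A \<omega> \<le> ?f y \<omega>"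
        using y abs_le_square_iff[of y "X 0 \<omega>"] by (auto simp: indicator_def)
    qed
    finally show "y\<^sup>2 * prob ?A \<le> expectation (?f y)" .
  qed
qed auto

end

end

section \<open>From the modes to the probability of staying\<close>

lemma one_minus_ge_exp:
  fixes y :: real assumes "0 \<le> y" "y \<le> 1 / 2" shows "exp (- 2 * y) \<le> 1 - y"
proof -
  have "- y - 2 * y\<^sup>2 \<le> ln (1 - y)" using assms by (rule ln_one_minus_pos_lower_bound)
  moreover have "2 * y\<^sup>2 \<le> y" using assms mult_right_mono[of y "1/2" y] by (simp add: power2_eq_square)
  ultimately have "- 2 * y \<le> ln (1 - y)" by linarith
  then have "exp (- 2 * y) \<le> exp (ln (1 - y))" by simp
  then show ?thesis using assms by simp
qed

lemma one_minus_power_le_exp: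
  fixes y :: real assumes "y \<le> 1" shows "(1 - y) ^ n \<le> exp (- (real n * y))"
proof -
  have "(1 - y) ^ n \<le> exp (- y) ^ n"
    using assms exp_ge_add_one_self[of "- y"] by (intro power_mono) auto
  then show ?thesis by (simp add: exp_of_nat_mult[symmetric])
qed

lemma (in centered_walk) cosm_ratio: "((\<lambda>t. (1 - cosm t) / t\<^sup>2) \<longlongrightarrow> \<sigma>\<^sup>2 / 2) (at_right 0)"
  by (rule cosm_second_order[OF integrable_X mean_zero integrable_X2 variance])

lemma (in centered_walk) sinm_ratio: "((\<lambda>t. sinm t / t\<^sup>2) \<longlongrightarrow> 0) (at_right 0)"
  by (rule sinm_second_order[OF integrable_X mean_zero integrable_X2 variance])

text \<open>On the event the endpoint lies in [-x, x], where 1 and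
  \<open>square_wave N (t * s)\<close> differ by at most \<open>sin (t * s) ^ (2 * N)\<close>; the
  expansion of the square wave supplies the harmonics.\<close>

lemma (in iid_walk) pstay_square_wave:
  fixes x t :: real
  defines "t \<equiv> pi / (2 * x)"
  assumes x: "0 < x" and N: "N \<ge> 1"
    and c: "\<And>u. square_wave N u = (\<Sum>k<K. c k * cos ((2 * real k + 1) * u))"
  shows "\<bar>pstay x j - (\<Sum>k<K. c k * ev x j (\<lambda>s. cos ((2 * real k + 1) * t * s)) j)\<bar>
    \<le> ev x j (\<lambda>s. sin (t * s) ^ (2 * N)) j"
proof -
  have t0: "0 < t" using x by (simp add: t_def)
  have cb: "\<bar>c k * cos ((2 * real k + 1) * t * s)\<bar> \<le> \<bar>c k\<bar>" for k s
    using mult_left_mono[OF abs_cos_le_one, of "\<bar>c k\<bar>"] by (simp add: abs_mult)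
  have W: "(\<Sum>k<K. c k * cos ((2 * real k + 1) * t * s)) = square_wave N (t * s)" for s
    by (simp add: c mult.assoc)
  have Wb: "\<bar>square_wave N (t * s)\<bar> \<le> (\<Sum>k<K. \<bar>c k\<bar>)" for s
    unfolding W[symmetric] by (rule order_trans[OF sum_abs]) (intro sum_mono cb)
  have [measurable]: "(\<lambda>s. square_wave N (t * s)) \<in> borel_measurable borel"
    unfolding W[symmetric] by measurable
  have "(\<Sum>k<K. c k * ev x j (\<lambda>s. cos ((2 * real k + 1) * t * s)) j) = ev x j (\<lambda>s. square_wave N (t * s)) j"
    unfolding W[symmetric] by (subst ev_sum[where K="\<lambda>k. \<bar>c k\<bar>"]) (auto simp: ev_cmult cb)
  moreover have "pstay x j + ev x j (\<lambda>s. (-1) * square_wave N (t * s)) j = ev x j (\<lambda>s. 1 + (-1) * square_wave N (t * s)) j"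
    unfolding ev_one[symmetric, of x j j] by (subst ev_add[where K=1 and L="\<Sum>k<K. \<bar>c k\<bar>"]) (use Wb in auto)
  ultimately have e: "pstay x j - (\<Sum>k<K. c k * ev x j (\<lambda>s. cos ((2 * real k + 1) * t * s)) j)
      = ev x j (\<lambda>s. 1 - square_wave N (t * s)) j"
    unfolding ev_cmult by simp
  have in_range: "\<bar>t * s\<bar> \<le> pi / 2" if "\<bar>s\<bar> \<le> x" for s
  proof -
    have "t * \<bar>s\<bar> \<le> t * x" using that t0 by (intro mult_left_mono) auto
    also have "\<dots> = pi / 2" using x by (simp add: t_def)
    finally show ?thesis using t0 by (simp add: abs_mult)
  qed
  have b: "\<bar>1 - square_wave N (t * s)\<bar> \<le> 1 + (\<Sum>k<K. \<bar>c k\<bar>)" for s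
    using Wb[of s] abs_triangle_ineq4[of 1 "square_wave N (t * s)"] by simp
  have sb: "\<bar>sin u ^ (2 * N)\<bar> \<le> 1" for u :: real
    unfolding power_abs by (intro power_le_one) auto
  have "ev x j (\<lambda>s. 1 - square_wave N (t * s)) j \<le> ev x j (\<lambda>s. sin (t * s) ^ (2 * N)) j"
    by (rule ev_mono[where L=1, OF _ _ b]) (use square_wave_bounds[OF N in_range] sb x in auto)
  moreover have "ev x j (\<lambda>_. 0) j \<le> ev x j (\<lambda>s. 1 - square_wave N (t * s)) j"
    by (rule ev_mono[where K=0, OF _ _ _ b]) (use square_wave_bounds[OF N in_range] x in auto)
  moreover have "ev x j (\<lambda>_. 0) j = 0" by (simp add: ev_def)
  ultimately show ?thesis unfolding e by simp
qed

text \<open>\<open>large\<close> makes the higher modes negligible, \<open>small\<close> the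
  accumulated errors. The filter is abstract so that a joint limit in \<open>n\<close> and
  \<epsilon> fits: it is later the product filter.\<close>

locale moderate_deviations = centered_walk M X \<sigma> \<eta>
  for M :: "'a measure" and X \<sigma> \<eta> +
  fixes G :: "'i filter" and nn :: "'i \<Rightarrow> nat" and xx :: "'i \<Rightarrow> real"
  assumes xx_top: "filterlim xx at_top G"
    and large: "filterlim (\<lambda>i. real (nn i) * (pi / (2 * xx i))\<^sup>2) at_top G"
    and small: "((\<lambda>i. real (nn i) * (pi / (2 * xx i)) powr (2 + kap)) \<longlongrightarrow> 0) G"
begin

definition th :: "'i \<Rightarrow> real" where "th i = pi / (2 * xx i)"

definition Lm :: "'i \<Rightarrow> real" where "Lm i = cosm (th i)"

lemma xx_pos: "\<forall>\<^sub>F i in G. 0 < xx i"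
  using xx_top by (simp add: filterlim_at_top_dense)

lemma th_at_right: "filterlim th (at_right 0) G"
proof -
  have "filterlim (\<lambda>x :: real. pi / (2 * x)) (at_right 0) at_top" by real_asymp
  then show ?thesis unfolding th_def[abs_def] using xx_top by (rule filterlim_compose)
qed

lemma th_pos: "\<forall>\<^sub>F i in G. 0 < th i"
  using th_at_right by (auto simp: filterlim_at elim: eventually_mono)

lemma th_less: "0 < c \<Longrightarrow> \<forall>\<^sub>F i in G. th i < c"
  using th_at_right by (auto simp: filterlim_at order_tendsto_iff)

lemma th_mult_at_right: "0 < q \<Longrightarrow> filterlim (\<lambda>i. q * th i) (at_right 0) G"
proof -
  assume "0 < q"
  then have "filterlim (\<lambda>t. q * t) (at_right 0) (at_right (0::real))"
    by (auto simp: filterlim_at intro!: tendsto_eq_intros eventually_at_rightI[of 0 1])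
  then show ?thesis using th_at_right by (rule filterlim_compose)
qed

lemma cosm_upper:
  assumes "0 < q" "a < q\<^sup>2 * \<sigma>\<^sup>2 / 2" shows "\<forall>\<^sub>F i in G. cosm (q * th i) \<le> 1 - a * (th i)\<^sup>2"
proof -
  have "((\<lambda>i. (1 - cosm (q * th i)) / (q * th i)\<^sup>2) \<longlongrightarrow> \<sigma>\<^sup>2 / 2) G"
    using cosm_ratio th_mult_at_right[OF assms(1)] by (rule filterlim_compose)
  moreover have "a / q\<^sup>2 < \<sigma>\<^sup>2 / 2" using assms by (simp add: field_simps)
  ultimately have "\<forall>\<^sub>F i in G. a / q\<^sup>2 < (1 - cosm (q * th i)) / (q * th i)\<^sup>2"
    by (auto simp: order_tendsto_iff)
  with th_pos show ?thesis
  proof eventually_elim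
    case (elim i)
    then have "a / q\<^sup>2 * (q * th i)\<^sup>2 \<le> 1 - cosm (q * th i)"
      using assms(1) by (simp add: pos_less_divide_eq)
    then show ?case using assms(1) by (simp add: power_mult_distrib)
  qed
qed

lemma cosm_lower:
  assumes "0 < q" "q\<^sup>2 * \<sigma>\<^sup>2 / 2 < a" shows "\<forall>\<^sub>F i in G. 1 - a * (th i)\<^sup>2 \<le> cosm (q * th i)"
proof -
  have "((\<lambda>i. (1 - cosm (q * th i)) / (q * th i)\<^sup>2) \<longlongrightarrow> \<sigma>\<^sup>2 / 2) G"
    using cosm_ratio th_mult_at_right[OF assms(1)] by (rule filterlim_compose)
  moreover have "\<sigma>\<^sup>2 / 2 < a / q\<^sup>2" using assms by (simp add: field_simps)
  ultimately have "\<forall>\<^sub>F i in G. (1 - cosm (q * th i)) / (q * th i)\<^sup>2 < a / q\<^sup>2"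
    by (auto simp: order_tendsto_iff)
  with th_pos show ?thesis
  proof eventually_elim
    case (elim i)
    then have "1 - cosm (q * th i) \<le> a / q\<^sup>2 * (q * th i)\<^sup>2"
      using assms(1) by (simp add: pos_divide_less_eq)
    then show ?case using assms(1) by (simp add: power_mult_distrib)
  qed
qed

lemma sinm_small:
  assumes "0 < q" "0 < a" shows "\<forall>\<^sub>F i in G. \<bar>sinm (q * th i)\<bar> \<le> a * (th i)\<^sup>2"
proof -
  have "((\<lambda>i. sinm (q * th i) / (q * th i)\<^sup>2) \<longlongrightarrow> 0) G"
    using sinm_ratio th_mult_at_right[OF assms(1)] by (rule filterlim_compose)
  moreover have "0 < a / q\<^sup>2" using assms by simp
  ultimately have "\<forall>\<^sub>F i in G. dist (sinm (q * th i) / (q * th i)\<^sup>2) 0 < a / q\<^sup>2"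
    by (rule tendstoD)
  with th_pos show ?thesis
  proof eventually_elim
    case (elim i)
    then have "\<bar>sinm (q * th i)\<bar> \<le> a / q\<^sup>2 * (q * th i)\<^sup>2"
      using assms(1) by (simp add: abs_divide pos_divide_less_eq)
    then show ?case using assms(1) by (simp add: power_mult_distrib)
  qed
qed

lemma th2_less: "0 < c \<Longrightarrow> \<forall>\<^sub>F i in G. c' * (th i)\<^sup>2 < c"
proof -
  assume "0 < c"
  have "((\<lambda>i. c' * (th i)\<^sup>2) \<longlongrightarrow> c' * 0\<^sup>2) G"
    using th_at_right by (intro tendsto_intros) (auto simp: filterlim_at)
  then show ?thesis using \<open>0 < c\<close> by (auto simp: order_tendsto_iff)
qed

lemma Lm_ge_half: "\<forall>\<^sub>F i in G. 1 / 2 \<le> Lm i"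
proof -
  have "\<forall>\<^sub>F i in G. 1 - \<sigma>\<^sup>2 * (th i)\<^sup>2 \<le> cosm (1 * th i)"
    using sigma_pos by (intro cosm_lower) auto
  with th2_less[of "1/2" "\<sigma>\<^sup>2"] show ?thesis
    unfolding Lm_def by (auto elim: eventually_elim2)
qed

definition S :: "'i \<Rightarrow> real" where "S i = real (nn i) * th i powr (2 + kap)"

lemma S_tendsto: "(S \<longlongrightarrow> 0) G"
  using small by (simp add: S_def[abs_def] th_def)

abbreviation mode :: "nat \<Rightarrow> 'i \<Rightarrow> nat \<Rightarrow> real" where
  "mode k i j \<equiv> ev (xx i) j (\<lambda>s. cos ((2 * real k + 1) * th i * s)) j / Lm i ^ j"

lemma eventually_regular: "\<forall>\<^sub>F i in G. 0 < xx i \<and> 0 < th i \<and> th i \<le> 1 \<and> 1 / 2 \<le> Lm i \<and> S i \<le> 1"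
proof -
  have "\<forall>\<^sub>F i in G. S i < 1" using S_tendsto by (auto simp: order_tendsto_iff)
  with xx_pos th_pos th_less[OF zero_less_one] Lm_ge_half show ?thesis
    by eventually_elim auto
qed

lemma mode_0_tendsto: "((\<lambda>i. mode 0 i (nn i)) \<longlongrightarrow> 1) G"
proof (rule tendsto_sandwich[where f="\<lambda>i. 1 - 2 * (err * exp err) * S i" and h="\<lambda>i. exp (err * S i)"])
  show "\<forall>\<^sub>F i in G. 1 - 2 * (err * exp err) * S i \<le> mode 0 i (nn i)"
    using eventually_regular by eventually_elim (use mode_bounds(1) in \<open>auto simp: th_def Lm_def S_def\<close>)
  show "\<forall>\<^sub>F i in G. mode 0 i (nn i) \<le> exp (err * S i)"
    using eventually_regular by eventually_elim (use mode_bounds(2) in \<open>auto simp: th_def Lm_def S_def\<close>)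
  have "((\<lambda>i. 1 - 2 * (err * exp err) * S i) \<longlongrightarrow> 1 - 2 * (err * exp err) * 0) G"
    by (intro tendsto_intros S_tendsto)
  then show "((\<lambda>i. 1 - 2 * (err * exp err) * S i) \<longlongrightarrow> 1) G" by simp
  have "((\<lambda>i. exp (err * S i)) \<longlongrightarrow> exp (err * 0)) G"
    by (intro tendsto_intros S_tendsto)
  then show "((\<lambda>i. exp (err * S i)) \<longlongrightarrow> 1) G" by simp
qed

definition rest :: "nat \<Rightarrow> real \<Rightarrow> real" where
  "rest k s = (2 * real k + 1) ^ 3 * (4 * (err * exp err) * s + (exp (err * s) - 1))"

lemma rest_tendsto: "((\<lambda>i. rest k (S i)) \<longlongrightarrow> 0) G"
proof -
  have "((\<lambda>i. rest k (S i)) \<longlongrightarrow> rest k 0) G"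
    unfolding rest_def by (intro tendsto_intros S_tendsto)
  then show ?thesis by (simp add: rest_def)
qed

lemma rest_mono: "s \<le> s' \<Longrightarrow> rest k s \<le> rest k s'"
  unfolding rest_def using err_nonneg
  by (intro mult_left_mono add_mono diff_mono) (auto intro: mult_left_mono)

text \<open>With frequency at least 3 the eigenvalue falls below
  \<open>1 - 4 * \<sigma>\<^sup>2 * (th i)\<^sup>2\<close>, while \<open>Lm i\<close> exceeds
  \<open>r = 1 - \<sigma>\<^sup>2 * (th i)\<^sup>2\<close>; hence their quotient is at most
  \<open>r\<close>. All times \<open>j \<le> nn i\<close> are treated at once, because the induction
  in \<open>pstay_bounded\<close> visits intermediate times.\<close>

lemma mode_le:
  assumes "k \<ge> 1"
  shows "\<forall>\<^sub>F i in G. \<sigma>\<^sup>2 * (th i)\<^sup>2 \<le> 1 \<and>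
    (\<forall>j\<le>nn i. \<bar>mode k i j\<bar> \<le> (1 - \<sigma>\<^sup>2 * (th i)\<^sup>2) ^ j + rest k (S i))"
proof -
  let ?q = "2 * real k + 1"
  have q: "9 \<le> ?q\<^sup>2" using assms power_mono[of 3 ?q 2] by simp
  have s2: "0 < \<sigma>\<^sup>2" using sigma_pos by simp
  have "\<forall>\<^sub>F i in G. cosm (?q * th i) \<le> 1 - (4 * \<sigma>\<^sup>2) * (th i)\<^sup>2"
    using q s2 mult_right_mono[OF q, of "\<sigma>\<^sup>2"] by (intro cosm_upper) auto
  moreover have "\<forall>\<^sub>F i in G. 1 - (?q\<^sup>2 * \<sigma>\<^sup>2) * (th i)\<^sup>2 \<le> cosm (?q * th i)"
    using q s2 by (intro cosm_lower) auto
  moreover have "\<forall>\<^sub>F i in G. 1 - \<sigma>\<^sup>2 * (th i)\<^sup>2 \<le> cosm (1 * th i)"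
    using s2 by (intro cosm_lower) auto
  ultimately show ?thesis
    using eventually_regular th2_less[OF zero_less_one, of "\<sigma>\<^sup>2"] th2_less[OF zero_less_one, of "?q\<^sup>2 * \<sigma>\<^sup>2"]
  proof eventually_elim
    case (elim i)
    define r where "r = 1 - \<sigma>\<^sup>2 * (th i)\<^sup>2"
    have r: "0 \<le> r" "r \<le> 1" using elim by (auto simp: r_def)
    have "\<bar>cosm (?q * th i)\<bar> \<le> r * Lm i"
    proof -
      have "1 - 2 * (\<sigma>\<^sup>2 * (th i)\<^sup>2) \<le> r * r"
        by (simp add: r_def algebra_simps)
      also have "\<dots> \<le> r * Lm i" using elim r by (intro mult_left_mono) (auto simp: r_def Lm_def)
      finally have "1 - 2 * (\<sigma>\<^sup>2 * (th i)\<^sup>2) \<le> r * Lm i" .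
      moreover have "0 \<le> \<sigma>\<^sup>2 * (th i)\<^sup>2" by simp
      ultimately have "cosm (?q * th i) \<le> r * Lm i" "0 \<le> cosm (?q * th i)" using elim by linarith+
      then show ?thesis by simp
    qed
    note mb = mode_bounds(3)[of "xx i" _ k r, folded th_def, folded Lm_def, OF _ _ _ _ this r]
    have "\<bar>mode k i j\<bar> \<le> r ^ j + rest k (S i)" if "j \<le> nn i" for j
    proof -
      have Sj: "real j * th i powr (2 + kap) \<le> S i" unfolding S_def using that by (intro mult_right_mono) auto
      have L0: "0 < Lm i" using elim by linarith
      have "\<bar>mode k i j\<bar> = \<bar>ev (xx i) j (\<lambda>s. cos (?q * th i * s)) j\<bar> / Lm i ^ j"
        using L0 by (simp add: abs_divide)
      also have "\<dots> \<le> r ^ j + rest k (real j * th i powr (2 + kap))"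
        unfolding rest_def using elim Sj by (intro mb) (auto simp: algebra_simps)
      also have "\<dots> \<le> r ^ j + rest k (S i)" using rest_mono[OF Sj] by simp
      finally show ?thesis .
    qed
    then show ?case using elim by (auto simp: r_def)
  qed
qed

lemma mode_tendsto_0: "k \<ge> 1 \<Longrightarrow> ((\<lambda>i. mode k i (nn i)) \<longlongrightarrow> 0) G"
proof (rule Lim_null_comparison[where g="\<lambda>i. exp (- (\<sigma>\<^sup>2 * (real (nn i) * (th i)\<^sup>2))) + rest k (S i)"])
  assume k: "k \<ge> 1"
  show "\<forall>\<^sub>F i in G. norm (mode k i (nn i)) \<le> exp (- (\<sigma>\<^sup>2 * (real (nn i) * (th i)\<^sup>2))) + rest k (S i)"
    using mode_le[OF k]
  proof eventually_elim
    case (elim i)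
    have "(1 - \<sigma>\<^sup>2 * (th i)\<^sup>2) ^ nn i \<le> exp (- (real (nn i) * (\<sigma>\<^sup>2 * (th i)\<^sup>2)))"
      using elim by (intro one_minus_power_le_exp) auto
    moreover have "\<bar>mode k i (nn i)\<bar> \<le> (1 - \<sigma>\<^sup>2 * (th i)\<^sup>2) ^ nn i + rest k (S i)" using elim by blast
    ultimately show ?case by (simp add: algebra_simps)
  qed
  have s2: "0 < \<sigma>\<^sup>2" using sigma_pos by simp
  have "filterlim (\<lambda>i. \<sigma>\<^sup>2 * (real (nn i) * (th i)\<^sup>2)) at_top G"
    using large s2 unfolding th_def by (intro filterlim_tendsto_pos_mult_at_top[OF tendsto_const])
  then have "((\<lambda>i. exp (- (\<sigma>\<^sup>2 * (real (nn i) * (th i)\<^sup>2)))) \<longlongrightarrow> 0) G"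
    by (intro filterlim_compose[OF exp_at_bot] filterlim_uminus_at_bot_at_top[THEN filterlim_compose])
  then show "((\<lambda>i. exp (- (\<sigma>\<^sup>2 * (real (nn i) * (th i)\<^sup>2))) + rest k (S i)) \<longlongrightarrow> 0) G"
    using tendsto_add[OF _ rest_tendsto] by fastforce
qed

lemma mode_bounded: "\<forall>\<^sub>F i in G. \<forall>j\<le>nn i. \<bar>mode k i j\<bar> \<le> 2"
proof (cases "k = 0")
  case True
  have "((\<lambda>i. 2 * (err * exp err) * S i) \<longlongrightarrow> 2 * (err * exp err) * 0) G"
    "((\<lambda>i. exp (err * S i)) \<longlongrightarrow> exp (err * 0)) G"
    by (intro tendsto_intros S_tendsto)+
  then have "\<forall>\<^sub>F i in G. 2 * (err * exp err) * S i < 1" "\<forall>\<^sub>F i in G. exp (err * S i) < 2"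
    by (auto simp: order_tendsto_iff)
  with eventually_regular show ?thesis
  proof eventually_elim
    case (elim i)
    show ?case
    proof (intro allI impI)
      fix j assume "j \<le> nn i"
      then have Sj: "real j * th i powr (2 + kap) \<le> S i" unfolding S_def by (intro mult_right_mono) auto
      have x: "0 < xx i" and t: "th i \<le> 1" and l: "1 / 2 \<le> cosm (th i)" and s: "real j * th i powr (2 + kap) \<le> 1"
        using elim Sj by (auto simp: Lm_def)
      have 1: "1 - 2 * (err * exp err) * (real j * th i powr (2 + kap)) \<le> mode 0 i j"
        and 2: "mode 0 i j \<le> exp (err * (real j * th i powr (2 + kap)))"
        using mode_bounds(1,2)[of "xx i" j, folded th_def, OF x t l s] by (simp_all add: Lm_def)
      have "2 * (err * exp err) * (real j * th i powr (2 + kap)) \<le> 2 * (err * exp err) * S i"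
        using err_nonneg by (intro mult_left_mono Sj) auto
      moreover have "exp (err * (real j * th i powr (2 + kap))) \<le> exp (err * S i)"
        using err_nonneg Sj by (simp add: mult_left_mono)
      ultimately have "0 \<le> mode 0 i j" "mode 0 i j \<le> 2" using elim 1 2 by linarith+
      then show "\<bar>mode k i j\<bar> \<le> 2" unfolding True by linarith
    qed
  qed
next
  case False
  then have k: "k \<ge> 1" by simp
  have "\<forall>\<^sub>F i in G. rest k (S i) < 1" using rest_tendsto[of k] by (auto simp: order_tendsto_iff)
  with mode_le[OF k] show ?thesis
  proof eventually_elim
    case (elim i)
    show ?case
    proof (intro allI impI)
      fix j assume "j \<le> nn i"
      then have "\<bar>mode k i j\<bar> \<le> (1 - \<sigma>\<^sup>2 * (th i)\<^sup>2) ^ j + rest k (S i)" using elim by blast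
      moreover have "(1 - \<sigma>\<^sup>2 * (th i)\<^sup>2) ^ j \<le> 1" using elim by (intro power_le_one) auto
      ultimately show "\<bar>mode k i j\<bar> \<le> 2" using elim by linarith
    qed
  qed
qed

text \<open>The error of the square wave is at most \<open>sin (t s) ^ (2 N)\<close>, which is not small near the ends of the interval.
  But after \<open>m\<close> of order \<open>1 / t\<^sup>2\<close> further steps only its constant Fourier coefficient survives, and that tends to \<open>0\<close>
  with \<open>N\<close>.\<close>

lemma sin_power_block:
  assumes "0 < \<delta>"
  obtains N0 E0 where "\<And>N. N \<ge> N0 \<Longrightarrow> \<forall>\<^sub>F i in G. \<exists>m\<ge>1. m \<le> nn i \<and> 1 / Lm i ^ m \<le> E0 \<and>
    (\<forall>j. ev (xx i) j (\<lambda>s. sin (th i * s) ^ (2 * N)) (j + m) \<le> \<delta> * Lm i ^ m * pstay (xx i) j)"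
proof -
  have s2: "0 < \<sigma>\<^sup>2" using sigma_pos by simp
  \<comment> \<open>Block length in units of \<open>1 / t\<^sup>2\<close>: relative to
    \<open>Lm ^ m\<close> the nonconstant harmonics decay like
    \<open>exp (- \<sigma>\<^sup>2 * s / 2)\<close>, which is to be at most
    \<open>\<delta> / 2\<close>. \<open>E0\<close> bounds \<open>1 / Lm ^ m\<close> for such a
    block, and \<open>N\<close> is then taken so large that the constant coefficient contributes the
    other half.\<close>
  define s where "s = max 1 (2 * ln (2 / \<delta>) / \<sigma>\<^sup>2)"
  define E0 where "E0 = exp (5 / 4 * \<sigma>\<^sup>2 * (s + 1))"
  have s1: "1 \<le> s" by (simp add: s_def)
  have sd: "exp (- (\<sigma>\<^sup>2 * s) / 2) \<le> \<delta> / 2"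
  proof -
    have "2 * ln (2 / \<delta>) / \<sigma>\<^sup>2 \<le> s" by (simp add: s_def)
    then have "ln (2 / \<delta>) \<le> \<sigma>\<^sup>2 * s / 2" using s2 by (simp add: field_simps)
    then have "exp (- (\<sigma>\<^sup>2 * s) / 2) \<le> exp (- ln (2 / \<delta>))" by simp
    also have "\<dots> = \<delta> / 2" using assms by (simp add: exp_minus)
    finally show ?thesis .
  qed
  have "\<forall>\<^sub>F N in sequentially. central_coeff N < \<delta> / (2 * E0)"
    using central_coeff_tendsto_0 assms by (auto simp: order_tendsto_iff E0_def)
  then obtain N0 where N0: "\<And>N. N \<ge> N0 \<Longrightarrow> central_coeff N < \<delta> / (2 * E0)"
    by (auto simp: eventually_sequentially)
  show ?thesis
  proof (rule that[of N0 E0])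
    fix N assume "N \<ge> N0"
    note cN = N0[OF this]
    have "\<forall>\<^sub>F i in G. norm (psi (2 * real k * th i)) \<le> exp (- (7 / 4 * \<sigma>\<^sup>2 * (th i)\<^sup>2))" if k: "k \<in> {1..N}" for k
    proof -
      \<comment> \<open>Frequency at least 2 gives the rate
        \<open>2 * \<sigma>\<^sup>2 * t\<^sup>2\<close>; giving up 1/8 for the limit and 1/8 for the
        sine leaves 7/4. Below, \<open>Lm\<close> has the rate 5/4, twice 5/8 by
        \<open>one_minus_ge_exp\<close>. The difference 1/2 is the gap on which \<open>s\<close>
        relies.\<close>
      have q: "2\<^sup>2 \<le> (2 * real k)\<^sup>2" using k by (intro power_mono) auto
      have "\<forall>\<^sub>F i in G. cosm (2 * real k * th i) \<le> 1 - (15 / 8 * \<sigma>\<^sup>2) * (th i)\<^sup>2"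
      proof (rule cosm_upper)
        have "4 * \<sigma>\<^sup>2 \<le> (2 * real k)\<^sup>2 * \<sigma>\<^sup>2" using q by (intro mult_right_mono) auto
        then show "15 / 8 * \<sigma>\<^sup>2 < (2 * real k)\<^sup>2 * \<sigma>\<^sup>2 / 2" using s2 by linarith
      qed (use k in simp)
      moreover have "\<forall>\<^sub>F i in G. 1 - ((2 * real k)\<^sup>2 * \<sigma>\<^sup>2) * (th i)\<^sup>2 \<le> cosm (2 * real k * th i)"
        using q s2 k by (intro cosm_lower) auto
      moreover have "\<forall>\<^sub>F i in G. \<bar>sinm (2 * real k * th i)\<bar> \<le> (1 / 8 * \<sigma>\<^sup>2) * (th i)\<^sup>2"
        using s2 k by (intro sinm_small) auto
      ultimately show ?thesis using th2_less[OF zero_less_one, of "(2 * real k)\<^sup>2 * \<sigma>\<^sup>2"]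
      proof eventually_elim
        case (elim i)
        have "norm (psi (2 * real k * th i)) \<le> \<bar>cosm (2 * real k * th i)\<bar> + \<bar>sinm (2 * real k * th i)\<bar>"
          using cmod_le[of "psi (2 * real k * th i)"] by (simp add: psi_Re_Im)
        also have "\<bar>cosm (2 * real k * th i)\<bar> = cosm (2 * real k * th i)" using elim by linarith
        also have "cosm (2 * real k * th i) + \<bar>sinm (2 * real k * th i)\<bar> \<le> 1 + - (7 / 4 * \<sigma>\<^sup>2 * (th i)\<^sup>2)"
          using elim by linarith
        also have "\<dots> \<le> exp (- (7 / 4 * \<sigma>\<^sup>2 * (th i)\<^sup>2))" by (rule exp_ge_add_one_self)
        finally show ?case .
      qed
    qed
    then have "\<forall>\<^sub>F i in G. \<forall>k\<in>{1..N}. norm (psi (2 * real k * th i)) \<le> exp (- (7 / 4 * \<sigma>\<^sup>2 * (th i)\<^sup>2))"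
      by (intro eventually_ball_finite) auto
    moreover have "\<forall>\<^sub>F i in G. 1 - (5 / 8 * \<sigma>\<^sup>2) * (th i)\<^sup>2 \<le> cosm (1 * th i)"
      using s2 by (intro cosm_lower) auto
    moreover have "\<forall>\<^sub>F i in G. s + 1 \<le> real (nn i) * (th i)\<^sup>2"
      using large unfolding th_def by (simp add: filterlim_at_top)
    ultimately show "\<forall>\<^sub>F i in G. \<exists>m\<ge>1. m \<le> nn i \<and> 1 / Lm i ^ m \<le> E0 \<and>
      (\<forall>j. ev (xx i) j (\<lambda>s. sin (th i * s) ^ (2 * N)) (j + m) \<le> \<delta> * Lm i ^ m * pstay (xx i) j)"
      using eventually_regular th2_less[OF half_gt_zero[OF zero_less_one], of "5 / 8 * \<sigma>\<^sup>2"]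
    proof eventually_elim
      case (elim i)
      define m where "m = nat \<lceil>s / (th i)\<^sup>2\<rceil>"
      have t2: "0 < (th i)\<^sup>2" "(th i)\<^sup>2 \<le> 1" using elim by (auto intro: power_le_one)
      have m_ge: "s / (th i)\<^sup>2 \<le> real m" unfolding m_def by (rule real_nat_ceiling_ge)
      have m_le: "real m \<le> s / (th i)\<^sup>2 + 1"
      proof -
        have "0 \<le> s / (th i)\<^sup>2" using s1 by simp
        then have "real m = of_int \<lceil>s / (th i)\<^sup>2\<rceil>" by (simp add: m_def)
        then show ?thesis using of_int_ceiling_le_add_one[of "s / (th i)\<^sup>2"] by simp
      qed
      have ms: "s \<le> real m * (th i)\<^sup>2" using m_ge t2 by (simp add: field_simps)
      have mss: "real m * (th i)\<^sup>2 \<le> s + (th i)\<^sup>2" using m_le t2 by (simp add: field_simps)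
      have mn: "m \<le> nn i"
      proof -
        have "real m * (th i)\<^sup>2 \<le> real (nn i) * (th i)\<^sup>2" using mss elim t2 by linarith
        then show ?thesis using t2 by simp
      qed
      have m1: "1 \<le> m"
      proof (rule ccontr)
        assume "\<not> 1 \<le> m" then have "m = 0" by simp then show False using ms s1 by simp
      qed
      have Lge: "exp (- (5 / 4 * \<sigma>\<^sup>2 * (th i)\<^sup>2)) \<le> Lm i"
        using one_minus_ge_exp[of "5 / 8 * \<sigma>\<^sup>2 * (th i)\<^sup>2"] elim by (simp add: Lm_def mult.assoc)
      have Lmge: "exp (- (5 / 4 * \<sigma>\<^sup>2 * (real m * (th i)\<^sup>2))) \<le> Lm i ^ m"
        using power_mono[OF Lge, of m] by (simp add: exp_of_nat_mult[symmetric] algebra_simps)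
      have L0: "0 < Lm i ^ m" using elim by simp
      have LE: "1 / E0 \<le> Lm i ^ m"
      proof -
        have "5 / 4 * \<sigma>\<^sup>2 * (real m * (th i)\<^sup>2) \<le> 5 / 4 * \<sigma>\<^sup>2 * (s + 1)"
          using mss t2 by (intro mult_left_mono) auto
        then have "exp (- (5 / 4 * \<sigma>\<^sup>2 * (s + 1))) \<le> exp (- (5 / 4 * \<sigma>\<^sup>2 * (real m * (th i)\<^sup>2)))" by simp
        then show ?thesis using Lmge by (simp add: E0_def exp_minus inverse_eq_divide)
      qed
      have "ev (xx i) j (\<lambda>s. sin (th i * s) ^ (2 * N)) (j + m) \<le> \<delta> * Lm i ^ m * pstay (xx i) j" for j
      proof -
        define d where "d = exp (- (7 / 4 * \<sigma>\<^sup>2 * (real m * (th i)\<^sup>2)))"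
        have "ev (xx i) j (\<lambda>s. sin (th i * s) ^ (2 * N)) (j + m) \<le> pstay (xx i) j * (central_coeff N + d)"
        proof (rule ev_sin_power_block_le)
          fix k assume "k \<in> {1..N}"
          then have "norm (psi (2 * real k * th i)) ^ m \<le> exp (- (7 / 4 * \<sigma>\<^sup>2 * (th i)\<^sup>2)) ^ m"
            using elim by (intro power_mono) auto
          then show "norm (psi (2 * real k * th i)) ^ m \<le> d"
            by (simp add: d_def exp_of_nat_mult[symmetric] algebra_simps)
        qed (simp add: d_def)
        moreover have "central_coeff N + d \<le> \<delta> / 2 * Lm i ^ m + \<delta> / 2 * Lm i ^ m"
        proof (rule add_mono)
          have "central_coeff N \<le> \<delta> / 2 * (1 / E0)" using cN by simp
          also have "\<dots> \<le> \<delta> / 2 * Lm i ^ m" using assms by (intro mult_left_mono LE) auto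
          finally show "central_coeff N \<le> \<delta> / 2 * Lm i ^ m" .
          have "d = exp (- (\<sigma>\<^sup>2 * (real m * (th i)\<^sup>2)) / 2) * exp (- (5 / 4 * \<sigma>\<^sup>2 * (real m * (th i)\<^sup>2)))"
            unfolding d_def exp_add[symmetric] by simp
          also have "\<dots> \<le> \<delta> / 2 * Lm i ^ m"
          proof (rule mult_mono[OF _ Lmge])
            have "exp (- (\<sigma>\<^sup>2 * (real m * (th i)\<^sup>2)) / 2) \<le> exp (- (\<sigma>\<^sup>2 * s) / 2)"
              using ms by (simp add: mult_left_mono)
            then show "exp (- (\<sigma>\<^sup>2 * (real m * (th i)\<^sup>2)) / 2) \<le> \<delta> / 2" using sd by linarith
          qed (use assms in auto)
          finally show "d \<le> \<delta> / 2 * Lm i ^ m" .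
        qed
        then have "pstay (xx i) j * (central_coeff N + d) \<le> pstay (xx i) j * (\<delta> * Lm i ^ m)"
          by (intro mult_left_mono) auto
        ultimately show ?thesis by (simp add: mult.commute)
      qed
      moreover have "1 / Lm i ^ m \<le> E0"
        using LE L0 by (simp add: field_simps E0_def)
      ultimately show ?case using mn m1 by blast
    qed
  qed
qed

text \<open>This removes the loss \<open>t powr - kap\<close> of \<open>upper_bounds\<close>. With
  \<open>\<delta> = 1 / 2\<close> the square-wave error at time \<open>j\<close> is at most half the
  normalised probability at time \<open>j - m\<close>, so strong induction in blocks of
  \<open>m\<close> steps closes.\<close>

lemma pstay_bounded: obtains D where "0 < D" "\<forall>\<^sub>F i in G. \<forall>j\<le>nn i. pstay (xx i) j / Lm i ^ j \<le> D"
proof -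
  obtain N0 E0 where NE: "\<And>N. N \<ge> N0 \<Longrightarrow> \<forall>\<^sub>F i in G. \<exists>m\<ge>1. m \<le> nn i \<and> 1 / Lm i ^ m \<le> E0 \<and>
    (\<forall>j. ev (xx i) j (\<lambda>s. sin (th i * s) ^ (2 * N)) (j + m) \<le> 1 / 2 * Lm i ^ m * pstay (xx i) j)"
    by (rule sin_power_block[OF half_gt_zero[OF zero_less_one]]) (rule that)
  define N where "N = max N0 1"
  have N: "N \<ge> N0" "N \<ge> 1" by (auto simp: N_def)
  obtain c K where "K \<ge> 1" and c: "\<And>u. square_wave N u = (\<Sum>k<K. c k * cos ((2 * real k + 1) * u))"
    and "\<bar>c 0 - 4 / pi\<bar> \<le> 2 / (2 * real N + 1)"
    by (rule square_wave_expansion[OF N(2)]) (rule that)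
  \<comment> \<open>Half of \<open>D\<close> plus the bound on the modes is again at most
    \<open>D\<close>; and \<open>E0\<close>, which covers times below \<open>m\<close>, is
    dominated.\<close>
  define D where "D = \<bar>E0\<bar> + 1 + 2 * (\<Sum>k<K. 2 * \<bar>c k\<bar>)"
  have c_nonneg: "0 \<le> (\<Sum>k<K. 2 * \<bar>c k\<bar>)" by (intro sum_nonneg) auto
  then have D0: "0 < D" unfolding D_def by linarith
  have "\<forall>\<^sub>F i in G. \<forall>k\<in>{..<K}. \<forall>j\<le>nn i. \<bar>mode k i j\<bar> \<le> 2"
    by (intro eventually_ball_finite ballI mode_bounded) auto
  with eventually_regular NE[OF N(1)] have "\<forall>\<^sub>F i in G. \<forall>j\<le>nn i. pstay (xx i) j / Lm i ^ j \<le> D"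
  proof eventually_elim
    case (elim i)
    then obtain m where m: "m \<ge> 1" "1 / Lm i ^ m \<le> E0"
      and blk: "\<And>j. ev (xx i) j (\<lambda>s. sin (th i * s) ^ (2 * N)) (j + m) \<le> 1 / 2 * Lm i ^ m * pstay (xx i) j"
      by blast
    have L: "0 < Lm i" "Lm i \<le> 1" using elim abs_cosm_le[of "th i"] by (auto simp: Lm_def)
    show ?case
    proof (intro allI impI)
      fix j assume "j \<le> nn i"
      then show "pstay (xx i) j / Lm i ^ j \<le> D"
      proof (induction j rule: less_induct)
        case (less j)
        show ?case
        proof (cases "j < m")
          case True
          have "pstay (xx i) j / Lm i ^ j \<le> 1 / Lm i ^ m"
            using L True by (intro frac_le power_decreasing) auto
          also have "\<dots> \<le> D" using m c_nonneg unfolding D_def by linarith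
          finally show ?thesis .
        next
          case False
          define j' where "j' = j - m"
          have j': "j = j' + m" "j' < j" using False m by (auto simp: j'_def)
          have "pstay (xx i) j \<le> (\<Sum>k<K. c k * ev (xx i) j (\<lambda>s. cos ((2 * real k + 1) * th i * s)) j)
             + ev (xx i) j (\<lambda>s. sin (th i * s) ^ (2 * N)) j"
            using pstay_square_wave[OF _ N(2) c, of "xx i" j, folded th_def] elim by linarith
          also have "ev (xx i) j (\<lambda>s. sin (th i * s) ^ (2 * N)) j \<le> ev (xx i) j' (\<lambda>s. sin (th i * s) ^ (2 * N)) j"
            by (rule ev_stay_antimono[where K=1]) (use j' in \<open>auto simp: power_abs intro!: power_le_one\<close>)
          also have "\<dots> \<le> 1 / 2 * Lm i ^ m * pstay (xx i) j'" using blk[of j'] j' by simp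
          finally have "pstay (xx i) j / Lm i ^ j \<le> ((\<Sum>k<K. c k * ev (xx i) j (\<lambda>s. cos ((2 * real k + 1) * th i * s)) j)
             + 1 / 2 * Lm i ^ m * pstay (xx i) j') / Lm i ^ j"
            using L by (intro divide_right_mono) auto
          also have "\<dots> = (\<Sum>k<K. c k * mode k i j) + 1 / 2 * (pstay (xx i) j' / Lm i ^ j')"
            using L unfolding j'(1) by (simp add: add_divide_distrib sum_divide_distrib power_add)
          also have "(\<Sum>k<K. c k * mode k i j) \<le> (\<Sum>k<K. 2 * \<bar>c k\<bar>)"
          proof (rule sum_mono)
            fix k assume "k \<in> {..<K}"
            then have "\<bar>mode k i j\<bar> \<le> 2" using elim less.prems by blast
            then have "\<bar>c k\<bar> * \<bar>mode k i j\<bar> \<le> \<bar>c k\<bar> * 2" by (intro mult_left_mono) auto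
            then show "c k * mode k i j \<le> 2 * \<bar>c k\<bar>" unfolding abs_mult[symmetric] by linarith
          qed
          also have "pstay (xx i) j' / Lm i ^ j' \<le> D" using less j' by auto
          also have "(\<Sum>k<K. 2 * \<bar>c k\<bar>) + 1 / 2 * D \<le> D" by (simp add: D_def)
          finally show ?thesis by simp
        qed
      qed
    qed
  qed
  then show ?thesis using D0 that by blast
qed

text \<open>Three errors of size \<open>e / 3\<close>. The combination of modes tends to
  \<open>c 0\<close>, as only the first mode survives; \<open>c 0\<close> is near
  \<open>4 / pi\<close> for large \<open>N\<close>; and the square-wave error is smoothed over the
  last \<open>m\<close> steps, where \<open>\<delta> = e / (3 * D)\<close> compensates the bound
  \<open>D\<close> at time \<open>nn i - m\<close>.\<close>

lemma pstay_eigenvalue_tendsto: "((\<lambda>i. pstay (xx i) (nn i) / Lm i ^ nn i) \<longlongrightarrow> 4 / pi) G"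
proof (rule tendstoI)
  fix e :: real assume e: "0 < e"
  obtain D where D: "0 < D" "\<forall>\<^sub>F i in G. \<forall>j\<le>nn i. pstay (xx i) j / Lm i ^ j \<le> D"
    by (rule pstay_bounded)
  define \<delta> where "\<delta> = e / (3 * D)"
  have d0: "0 < \<delta>" using D e by (simp add: \<delta>_def)
  obtain N0 E0 where NE: "\<And>N. N \<ge> N0 \<Longrightarrow> \<forall>\<^sub>F i in G. \<exists>m\<ge>1. m \<le> nn i \<and> 1 / Lm i ^ m \<le> E0 \<and>
    (\<forall>j. ev (xx i) j (\<lambda>s. sin (th i * s) ^ (2 * N)) (j + m) \<le> \<delta> * Lm i ^ m * pstay (xx i) j)"
    by (rule sin_power_block[OF d0]) (rule that)
  have "(\<lambda>N. 2 / (2 * real N + 1)) \<longlonglongrightarrow> 0" by real_asymp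
  then have "\<forall>\<^sub>F N in sequentially. 2 / (2 * real N + 1) < e / 3"
    by (rule order_tendstoD(2)) (use e in simp)
  then have "\<forall>\<^sub>F N in sequentially. N \<ge> N0 \<and> N \<ge> 1 \<and> 2 / (2 * real N + 1) < e / 3"
    by (intro eventually_conj eventually_ge_at_top)
  then obtain N where N: "N \<ge> N0" "N \<ge> 1" "2 / (2 * real N + 1) < e / 3"
    by (auto simp: eventually_sequentially)
  obtain c K where K: "K \<ge> 1" and c: "\<And>u. square_wave N u = (\<Sum>k<K. c k * cos ((2 * real k + 1) * u))"
    and c0: "\<bar>c 0 - 4 / pi\<bar> \<le> 2 / (2 * real N + 1)"
    by (rule square_wave_expansion[OF N(2)]) (rule that)
  have "((\<lambda>i. \<Sum>k<K. c k * mode k i (nn i)) \<longlongrightarrow> (\<Sum>k<K. c k * (if k = 0 then 1 else 0))) G"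
  proof (intro tendsto_sum tendsto_mult tendsto_const)
    fix k show "((\<lambda>i. mode k i (nn i)) \<longlongrightarrow> (if k = 0 then 1 else 0)) G"
      using mode_0_tendsto mode_tendsto_0[of k] by (cases "k = 0") auto
  qed
  also have "(\<Sum>k<K. c k * (if k = 0 then 1 else 0)) = c 0"
    using K by (subst sum.remove[of _ 0]) auto
  finally have "\<forall>\<^sub>F i in G. dist (\<Sum>k<K. c k * mode k i (nn i)) (c 0) < e / 3"
    using e by (intro tendstoD) auto
  with eventually_regular NE[OF N(1)] D(2) show "\<forall>\<^sub>F i in G. dist (pstay (xx i) (nn i) / Lm i ^ nn i) (4 / pi) < e"
  proof eventually_elim
    case (elim i)
    then obtain m where m: "m \<ge> 1" "m \<le> nn i"
      and blk: "\<And>j. ev (xx i) j (\<lambda>s. sin (th i * s) ^ (2 * N)) (j + m) \<le> \<delta> * Lm i ^ m * pstay (xx i) j"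
      by blast
    have L: "0 < Lm i" using elim by auto
    define j where "j = nn i - m"
    have j: "nn i = j + m" using m by (simp add: j_def)
    have "\<bar>pstay (xx i) (nn i) - (\<Sum>k<K. c k * ev (xx i) (nn i) (\<lambda>s. cos ((2 * real k + 1) * th i * s)) (nn i))\<bar>
        \<le> ev (xx i) (nn i) (\<lambda>s. sin (th i * s) ^ (2 * N)) (nn i)"
      using pstay_square_wave[OF _ N(2) c, of "xx i" "nn i", folded th_def] elim by blast
    also have "\<dots> \<le> ev (xx i) j (\<lambda>s. sin (th i * s) ^ (2 * N)) (nn i)"
      by (rule ev_stay_antimono[where K=1]) (use j in \<open>auto simp: power_abs intro!: power_le_one\<close>)
    also have "\<dots> \<le> \<delta> * Lm i ^ m * pstay (xx i) j" using blk[of j] j by simp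
    also have "\<dots> = \<delta> * Lm i ^ nn i * (pstay (xx i) j / Lm i ^ j)" using L by (simp add: j power_add)
    also have "\<dots> \<le> \<delta> * Lm i ^ nn i * D"
      using elim L d0 j by (intro mult_left_mono) auto
    also have "\<dots> = e / 3 * Lm i ^ nn i" using D by (simp add: \<delta>_def)
    finally have "\<bar>pstay (xx i) (nn i) - (\<Sum>k<K. c k * ev (xx i) (nn i) (\<lambda>s. cos ((2 * real k + 1) * th i * s)) (nn i))\<bar> / Lm i ^ nn i \<le> e / 3"
      using L by (simp add: pos_divide_le_eq)
    moreover have "\<bar>pstay (xx i) (nn i) - (\<Sum>k<K. c k * ev (xx i) (nn i) (\<lambda>s. cos ((2 * real k + 1) * th i * s)) (nn i))\<bar> / Lm i ^ nn i
      = \<bar>pstay (xx i) (nn i) / Lm i ^ nn i - (\<Sum>k<K. c k * mode k i (nn i))\<bar>"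
    proof -
      have "\<bar>a - b\<bar> / z = \<bar>a / z - b / z\<bar>" if "0 < z" for a b z :: real
        using that by (simp add: diff_divide_distrib[symmetric])
      from this[of "Lm i ^ nn i"] show ?thesis using L by (simp add: sum_divide_distrib)
    qed
    ultimately show ?case
      using elim N(3) c0 unfolding dist_real_def by linarith
  qed
qed

text \<open>The eigenvalue \<open>Lm\<close> is \<open>exp (- \<sigma>\<^sup>2 * th\<^sup>2 / 2)\<close> up to an error that is negligible in the \<open>n\<close>-th power.\<close>

theorem prob_stay_asymptotics:
  "((\<lambda>i. pstay (xx i) (nn i) * exp (real (nn i) * (pi / (2 * xx i))\<^sup>2 * \<sigma>\<^sup>2 / 2)) \<longlongrightarrow> 4 / pi) G"
proof -
  \<comment> \<open>The deficit \<open>y\<close> of the eigenvalue is at most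
    \<open>A * (th i)\<^sup>2\<close>, so the quadratic term in the expansion of
    \<open>ln (1 - y)\<close> has order \<open>th i powr 4\<close> and joins the error.\<close>
  define A where "A = \<sigma>\<^sup>2 / 2 + moment"
  have A0: "0 \<le> A" using moment_nonneg by (simp add: A_def)
  have "((\<lambda>i. Lm i ^ nn i * exp (real (nn i) * (th i)\<^sup>2 * \<sigma>\<^sup>2 / 2)) \<longlongrightarrow> 1) G"
  proof (rule tendsto_sandwich[where f="\<lambda>i. exp (- ((moment + 2 * A\<^sup>2) * S i))" and h="\<lambda>i. exp (moment * S i)"])
    have *: "((\<lambda>i. exp (c * S i)) \<longlongrightarrow> 1) G" for c
    proof -
      have "((\<lambda>i. exp (c * S i)) \<longlongrightarrow> exp (c * 0)) G" by (intro tendsto_intros S_tendsto)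
      then show ?thesis by simp
    qed
    show "((\<lambda>i. exp (moment * S i)) \<longlongrightarrow> 1) G" by (rule *)
    show "((\<lambda>i. exp (- ((moment + 2 * A\<^sup>2) * S i))) \<longlongrightarrow> 1) G"
      using *[of "- (moment + 2 * A\<^sup>2)"] by (simp only: mult_minus_left)
    have E: "exp (real n * t\<^sup>2 * \<sigma>\<^sup>2 / 2) = exp (t\<^sup>2 * \<sigma>\<^sup>2 / 2) ^ n" for n t
      by (simp add: exp_of_nat_mult[symmetric])
    have SE: "exp (c * S i) = exp (c * th i powr (2 + kap)) ^ nn i" for c i
      by (simp add: S_def exp_of_nat_mult[symmetric] algebra_simps)
    show "\<forall>\<^sub>F i in G. Lm i ^ nn i * exp (real (nn i) * (th i)\<^sup>2 * \<sigma>\<^sup>2 / 2) \<le> exp (moment * S i)"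
      using eventually_regular
    proof eventually_elim
      case (elim i)
      have "Lm i \<le> 1 + (- (\<sigma>\<^sup>2 * (th i)\<^sup>2 / 2) + moment * th i powr (2 + \<eta>))"
        using cosm_bound[of "th i"] elim unfolding Lm_def by linarith
      also have "\<dots> \<le> exp (- (\<sigma>\<^sup>2 * (th i)\<^sup>2 / 2) + moment * th i powr (2 + \<eta>))" by (rule exp_ge_add_one_self)
      also have "\<dots> \<le> exp (- (\<sigma>\<^sup>2 * (th i)\<^sup>2 / 2) + moment * th i powr (2 + kap))"
        using elim kap moment_nonneg by (auto intro!: mult_left_mono powr_le_kap)
      finally have "Lm i * exp ((th i)\<^sup>2 * \<sigma>\<^sup>2 / 2) \<le> exp (- (\<sigma>\<^sup>2 * (th i)\<^sup>2 / 2) + moment * th i powr (2 + kap)) * exp ((th i)\<^sup>2 * \<sigma>\<^sup>2 / 2)"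
        by (intro mult_right_mono) auto
      also have "\<dots> = exp (moment * th i powr (2 + kap))" unfolding exp_add[symmetric] by (simp add: algebra_simps)
      finally show ?case unfolding E SE power_mult_distrib[symmetric] using elim by (intro power_mono) auto
    qed
    show "\<forall>\<^sub>F i in G. exp (- ((moment + 2 * A\<^sup>2) * S i)) \<le> Lm i ^ nn i * exp (real (nn i) * (th i)\<^sup>2 * \<sigma>\<^sup>2 / 2)"
      using eventually_regular th2_less[OF half_gt_zero[OF zero_less_one], of A]
    proof eventually_elim
      case (elim i)
      define y where "y = \<sigma>\<^sup>2 * (th i)\<^sup>2 / 2 + moment * th i powr (2 + kap)"
      have "th i powr (2 + kap) \<le> th i powr 2" using elim kap by (intro powr_mono') auto
      then have "moment * th i powr (2 + kap) \<le> moment * (th i)\<^sup>2"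
        using elim moment_nonneg by (intro mult_left_mono) auto
      then have yA: "y \<le> A * (th i)\<^sup>2" by (simp add: y_def A_def algebra_simps)
      have y0: "0 \<le> y" using moment_nonneg by (simp add: y_def)
      have "2 * y\<^sup>2 \<le> 2 * A\<^sup>2 * th i powr (2 + kap)"
      proof -
        have "y\<^sup>2 \<le> (A * (th i)\<^sup>2)\<^sup>2" using yA y0 by (intro power_mono) auto
        also have "\<dots> = A\<^sup>2 * th i powr 4" using elim by (simp add: power_mult_distrib)
        also have "\<dots> \<le> A\<^sup>2 * th i powr (2 + kap)" using elim kap by (intro mult_left_mono powr_mono') auto
        finally show ?thesis by simp
      qed
      moreover have "- y - 2 * y\<^sup>2 \<le> ln (1 - y)"
        using y0 yA elim by (intro ln_one_minus_pos_lower_bound) auto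
      ultimately have "- (\<sigma>\<^sup>2 * (th i)\<^sup>2 / 2) - (moment + 2 * A\<^sup>2) * th i powr (2 + kap) \<le> ln (1 - y)"
        unfolding y_def by (simp add: algebra_simps)
      then have "exp (- (\<sigma>\<^sup>2 * (th i)\<^sup>2 / 2) - (moment + 2 * A\<^sup>2) * th i powr (2 + kap)) \<le> exp (ln (1 - y))"
        by simp
      also have "\<dots> = 1 - y" using yA elim by simp
      also have "\<dots> \<le> Lm i"
      proof -
        have "moment * th i powr (2 + \<eta>) \<le> moment * th i powr (2 + kap)"
          using elim kap moment_nonneg by (intro mult_left_mono powr_le_kap) auto
        then show ?thesis using cosm_bound[of "th i"] elim unfolding Lm_def y_def by linarith
      qed
      finally have "exp (- (\<sigma>\<^sup>2 * (th i)\<^sup>2 / 2) - (moment + 2 * A\<^sup>2) * th i powr (2 + kap)) * exp ((th i)\<^sup>2 * \<sigma>\<^sup>2 / 2)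
         \<le> Lm i * exp ((th i)\<^sup>2 * \<sigma>\<^sup>2 / 2)" by (intro mult_right_mono) auto
      also have "exp (- (\<sigma>\<^sup>2 * (th i)\<^sup>2 / 2) - (moment + 2 * A\<^sup>2) * th i powr (2 + kap)) * exp ((th i)\<^sup>2 * \<sigma>\<^sup>2 / 2)
        = exp (- (moment + 2 * A\<^sup>2) * th i powr (2 + kap))" unfolding exp_add[symmetric] by (simp add: algebra_simps)
      finally have "exp (- (moment + 2 * A\<^sup>2) * th i powr (2 + kap)) ^ nn i \<le> (Lm i * exp ((th i)\<^sup>2 * \<sigma>\<^sup>2 / 2)) ^ nn i"
        by (intro power_mono) auto
      then show ?case unfolding E SE[symmetric] power_mult_distrib by (simp only: mult_minus_left)
    qed
  qed
  from tendsto_mult[OF pstay_eigenvalue_tendsto this]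
  have "((\<lambda>i. pstay (xx i) (nn i) / Lm i ^ nn i * (Lm i ^ nn i * exp (real (nn i) * (th i)\<^sup>2 * \<sigma>\<^sup>2 / 2))) \<longlongrightarrow> 4 / pi) G"
    by simp
  then show ?thesis
  proof (rule Lim_transform_eventually)
    show "\<forall>\<^sub>F i in G. pstay (xx i) (nn i) / Lm i ^ nn i * (Lm i ^ nn i * exp (real (nn i) * (th i)\<^sup>2 * \<sigma>\<^sup>2 / 2))
       = pstay (xx i) (nn i) * exp (real (nn i) * (pi / (2 * xx i))\<^sup>2 * \<sigma>\<^sup>2 / 2)"
      using eventually_regular by eventually_elim (auto simp: th_def)
  qed
qed

end

section \<open>Comparison of the series with the Gamma integral\<close>

text \<open>The interval between \<open>ln n\<close> and \<open>ln (n + 1)\<close> has mass asymptotic to \<open>n powr (-1 - d) * ln n powr a\<close>, uniformly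
  in \<open>d \<le> 1\<close>.\<close>

definition gamma_measure :: "real \<Rightarrow> real \<Rightarrow> real measure" where
  "gamma_measure a d = density lborel (\<lambda>u. ennreal (indicator {0..} u * u powr a * exp (- (d * u))))"

lemma sets_gamma_measure [simp, measurable_cong]: "sets (gamma_measure a d) = sets borel"
  by (simp add: gamma_measure_def)

lemma emeasure_gamma_measure:
  "A \<in> sets borel \<Longrightarrow> emeasure (gamma_measure a d) A
    = (\<integral>\<^sup>+ u. ennreal (indicator {0..} u * u powr a * exp (- (d * u))) * indicator A u \<partial>lborel)"
  unfolding gamma_measure_def by (subst emeasure_density) auto

lemma emeasure_gamma_measure_UNIV:
  assumes "a > -1" "d > 0"
  shows "ennreal (d powr (a + 1)) * emeasure (gamma_measure a d) UNIV = ennreal (Gamma (a + 1))"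
proof -
  have "ennreal (Gamma (a + 1)) = nn_integral lborel (\<lambda>t. ennreal (indicator {0..} t * t powr (a + 1 - 1) / exp t))"
    using assms by (intro Gamma_conv_nn_integral_real) auto
  also have "\<dots> = ennreal \<bar>d\<bar> * nn_integral lborel (\<lambda>u. ennreal (indicator {0..} (0 + d * u) * (0 + d * u) powr (a + 1 - 1) / exp (0 + d * u)))"
    using assms by (intro nn_integral_real_affine) auto
  also have "nn_integral lborel (\<lambda>u. ennreal (indicator {0..} (0 + d * u) * (0 + d * u) powr (a + 1 - 1) / exp (0 + d * u)))
    = nn_integral lborel (\<lambda>u. ennreal (d powr a) * ennreal (indicator {0..} u * u powr a * exp (- (d * u))))"
    using assms by (intro nn_integral_cong)
      (auto simp: indicator_def powr_mult exp_minus field_simps zero_le_mult_iff ennreal_mult[symmetric])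
  also have "\<dots> = ennreal (d powr a) * emeasure (gamma_measure a d) UNIV"
    by (subst nn_integral_cmult) (auto simp: emeasure_gamma_measure)
  also have "ennreal \<bar>d\<bar> * \<dots> = ennreal (d powr (a + 1)) * emeasure (gamma_measure a d) UNIV"
    using assms by (simp add: mult.assoc[symmetric] ennreal_mult[symmetric] powr_add mult.commute)
  finally show ?thesis ..
qed

text \<open>The bound is uniform in \<open>d\<close>, so that multiplied by
  \<open>d powr (a + 1)\<close> it vanishes in the limit. For negative \<open>a\<close> the density
  is unbounded at 0; hence the comparison with the density for \<open>d = 1\<close>, at the cost of
  \<open>exp T\<close>.\<close>

lemma emeasure_gamma_measure_initial:
  assumes "a > -1" "d > 0"
  shows "emeasure (gamma_measure a d) {0..<T} \<le> ennreal (exp T * Gamma (a + 1))"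
proof -
  have "emeasure (gamma_measure a d) {0..<T}
    \<le> (\<integral>\<^sup>+ u. ennreal (exp T) * (ennreal (indicator {0..} u * u powr a * exp (- (1 * u))) * indicator UNIV u) \<partial>lborel)"
  proof (subst emeasure_gamma_measure, simp, rule nn_integral_mono)
    fix u :: real
    have "u powr a * exp (- (d * u)) \<le> exp T * (u powr a * exp (- u))" if "0 \<le> u" "u < T"
    proof -
      have "- (d * u) \<le> T + - u" using that assms mult_nonneg_nonneg[of d u] by linarith
      then have "exp (- (d * u)) \<le> exp T * exp (- u)" by (simp add: exp_add[symmetric])
      from mult_left_mono[OF this, of "u powr a"] show ?thesis by (simp add: mult.left_commute)
    qed
    then show "ennreal (indicator {0..} u * u powr a * exp (- (d * u))) * indicator {0..<T} u
      \<le> ennreal (exp T) * (ennreal (indicator {0..} u * u powr a * exp (- (1 * u))) * indicator UNIV u)"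
      by (auto simp: indicator_def ennreal_mult[symmetric] mult.left_commute intro!: ennreal_leI mult_left_mono)
  qed
  also have "\<dots> = ennreal (exp T) * emeasure (gamma_measure a 1) UNIV"
    by (subst nn_integral_cmult) (auto simp: emeasure_gamma_measure)
  also have "emeasure (gamma_measure a 1) UNIV = ennreal (Gamma (a + 1))"
    using emeasure_gamma_measure_UNIV[of a 1] assms by simp
  also have "ennreal (exp T) * ennreal (Gamma (a + 1)) = ennreal (exp T * Gamma (a + 1))"
    using assms by (subst ennreal_mult) (auto intro!: Gamma_real_nonneg)
  finally show ?thesis .
qed

text \<open>One factor \<open>x / (x + 1)\<close> comes from the interval length, at least
  \<open>1 / (x + 1)\<close>, the other from the decay of the exponential across the interval when
  \<open>d \<le> 1\<close>. Minimum and, in \<open>upper_ratio\<close>, maximum with 1 cover both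
  signs of \<open>a\<close>.\<close>

definition lower_ratio :: "real \<Rightarrow> real \<Rightarrow> real" where
  "lower_ratio a x = (x / (x + 1))\<^sup>2 * min 1 ((ln (x + 1) / ln x) powr a)"

definition upper_ratio :: "real \<Rightarrow> real \<Rightarrow> real" where
  "upper_ratio a x = max 1 ((ln (x + 1) / ln x) powr a)"

lemma ratio_tendsto: "(lower_ratio a \<longlongrightarrow> 1) at_top" "(upper_ratio a \<longlongrightarrow> 1) at_top"
proof -
  have l: "((\<lambda>x :: real. ln (x + 1) / ln x) \<longlongrightarrow> 1) at_top" by real_asymp
  have p: "((\<lambda>x :: real. (ln (x + 1) / ln x) powr a) \<longlongrightarrow> 1) at_top"
    using tendsto_powr[OF l tendsto_const, of a] by simp
  have s: "((\<lambda>x :: real. (x / (x + 1))\<^sup>2) \<longlongrightarrow> 1) at_top" by real_asymp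
  show "(lower_ratio a \<longlongrightarrow> 1) at_top"
    unfolding lower_ratio_def[abs_def] using tendsto_mult[OF s tendsto_min[OF tendsto_const p, of 1]] by simp
  show "(upper_ratio a \<longlongrightarrow> 1) at_top"
    unfolding upper_ratio_def[abs_def] using tendsto_max[OF tendsto_const p, of 1] by simp
qed

lemma powr_between:
  fixes s :: real assumes "1 \<le> s" "s \<le> r"
  shows "min 1 (r powr a) \<le> s powr a" "s powr a \<le> max 1 (r powr a)"
proof -
  consider "a \<ge> 0" | "a < 0" by linarith
  then have "(1 \<le> s powr a \<and> s powr a \<le> r powr a) \<or> (s powr a \<le> 1 \<and> r powr a \<le> s powr a)"
  proof cases
    case 1
    then show ?thesis using assms powr_mono2[of a 1 s] powr_mono2[of a s r] by auto
  next
    case 2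
    then show ?thesis using assms powr_mono2'[of a 1 s] powr_mono2'[of a s r] by auto
  qed
  then show "min 1 (r powr a) \<le> s powr a" "s powr a \<le> max 1 (r powr a)" by auto
qed

lemma gamma_measure_interval:
  fixes x a d :: real
  assumes x: "3 \<le> x" and d: "0 < d" "d \<le> 1"
  defines "w \<equiv> x powr (- 1 - d) * ln x powr a"
  shows "ennreal (lower_ratio a x * w) \<le> emeasure (gamma_measure a d) {ln x..<ln (x + 1)}"
    and "emeasure (gamma_measure a d) {ln x..<ln (x + 1)} \<le> ennreal (upper_ratio a x * w)"
proof -
  let ?r = "ln (x + 1) / ln x" and ?I = "{ln x..<ln (x + 1)}"
  have lx: "0 < ln x" using x by simp
  have xp: "0 < x" using x by simp
  have len: "emeasure lborel ?I = ennreal (ln (x + 1) - ln x)"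
    using xp by simp
  have len_up: "ln (x + 1) - ln x \<le> 1 / x"
  proof -
    have "ln (x + 1) - ln x = ln (1 + 1 / x)"
    proof -
      have "(x + 1) / x = 1 + 1 / x" using xp by (simp add: field_simps)
      then show ?thesis using xp ln_div[of "x + 1" x] by simp
    qed
    also have "\<dots> \<le> 1 / x" using xp by (intro ln_add_one_self_le_self) auto
    finally show ?thesis .
  qed
  have len_low: "1 / (x + 1) \<le> ln (x + 1) - ln x"
  proof -
    have "ln (x / (x + 1)) \<le> x / (x + 1) - 1" using xp by (intro ln_le_minus_one) auto
    also have "x / (x + 1) - 1 = - (1 / (x + 1))" using xp by (simp add: field_simps)
    finally show ?thesis using xp by (simp add: ln_div)
  qed
  have uu: "u powr a = ln x powr a * (u / ln x) powr a" if "u \<in> ?I" for u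
    using that lx by (subst powr_mult[symmetric]) auto
  have ub: "min 1 (?r powr a) \<le> (u / ln x) powr a" "(u / ln x) powr a \<le> max 1 (?r powr a)" if "u \<in> ?I" for u
    using that lx by (intro powr_between; simp add: field_simps)+
  have eb: "(x + 1) powr (- d) \<le> exp (- (d * u))" "exp (- (d * u)) \<le> x powr (- d)" if "u \<in> ?I" for u
  proof -
    have "d * u \<le> d * ln (x + 1)" "d * ln x \<le> d * u" using that d by (auto intro!: mult_left_mono)
    then show "(x + 1) powr (- d) \<le> exp (- (d * u))" "exp (- (d * u)) \<le> x powr (- d)"
      using xp by (auto simp: powr_def)
  qed
  have m: "?I \<in> sets borel" by simp
  have pos: "u \<in> ?I \<Longrightarrow> 0 \<le> u" for u using lx by simp
  have "emeasure (gamma_measure a d) ?I \<le> (\<integral>\<^sup>+ u. ennreal (upper_ratio a x * ln x powr a * x powr (- d)) * indicator ?I u \<partial>lborel)"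
    unfolding emeasure_gamma_measure[OF m]
  proof (rule nn_integral_mono)
    fix u
    show "ennreal (indicator {0..} u * u powr a * exp (- (d * u))) * indicator ?I u
      \<le> ennreal (upper_ratio a x * ln x powr a * x powr (- d)) * indicator ?I u"
    proof (cases "u \<in> ?I")
      case True
      have "u powr a * exp (- (d * u)) \<le> (ln x powr a * max 1 (?r powr a)) * x powr (- d)"
        unfolding uu[OF True] using ub(2)[OF True] eb(2)[OF True]
        by (intro mult_mono mult_left_mono) (auto intro!: mult_nonneg_nonneg simp: max.coboundedI1)
      then show ?thesis using True pos[OF True] by (auto simp: upper_ratio_def mult_ac intro!: ennreal_leI)
    qed simp
  qed
  also have "\<dots> = ennreal (upper_ratio a x * ln x powr a * x powr (- d)) * ennreal (ln (x + 1) - ln x)"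
    by (subst nn_integral_cmult_indicator) (auto simp: len)
  also have "\<dots> = ennreal (upper_ratio a x * ln x powr a * x powr (- d) * (ln (x + 1) - ln x))"
    using xp by (subst ennreal_mult) (auto simp: upper_ratio_def max.coboundedI1)
  also have "\<dots> \<le> ennreal (upper_ratio a x * ln x powr a * x powr (- d) * (1 / x))"
    by (intro ennreal_leI mult_left_mono len_up) (auto simp: upper_ratio_def max.coboundedI1)
  also have "upper_ratio a x * ln x powr a * x powr (- d) * (1 / x) = upper_ratio a x * w"
    using xp by (simp add: w_def powr_diff powr_minus_divide)
  finally show "emeasure (gamma_measure a d) ?I \<le> ennreal (upper_ratio a x * w)" .
  have "ennreal (lower_ratio a x * w) \<le> ennreal (ln x powr a * min 1 (?r powr a) * (x + 1) powr (- d) * (ln (x + 1) - ln x))"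
  proof (rule ennreal_leI)
    have q: "x / (x + 1) \<le> (x / (x + 1)) powr d"
    proof -
      have "(x / (x + 1)) powr 1 \<le> (x / (x + 1)) powr d" using xp d by (intro powr_mono') auto
      then show ?thesis using xp by simp
    qed
    have "x / (x + 1) * x powr (- d) \<le> (x / (x + 1)) powr d * x powr (- d)"
      by (intro mult_right_mono q) auto
    also have "\<dots> = (x + 1) powr (- d)" using xp by (simp add: powr_divide powr_minus field_simps)
    finally have 1: "x / (x + 1) * x powr (- d) \<le> (x + 1) powr (- d)" .
    have "lower_ratio a x * w = ln x powr a * min 1 (?r powr a) * (x / (x + 1) * x powr (- d)) * (x / (x + 1) * (1 / x))"
      using xp by (simp add: lower_ratio_def w_def powr_diff powr_minus_divide power2_eq_square mult_ac)
    also have "\<dots> \<le> ln x powr a * min 1 (?r powr a) * (x + 1) powr (- d) * (ln (x + 1) - ln x)"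
      using xp len_low 1 by (intro mult_mono mult_left_mono) (auto intro!: mult_nonneg_nonneg)
    finally show "lower_ratio a x * w \<le> ln x powr a * min 1 (?r powr a) * (x + 1) powr (- d) * (ln (x + 1) - ln x)" .
  qed
  also have "\<dots> = ennreal (ln x powr a * min 1 (?r powr a) * (x + 1) powr (- d)) * ennreal (ln (x + 1) - ln x)"
    using xp by (subst ennreal_mult) auto
  also have "\<dots> = (\<integral>\<^sup>+ u. ennreal (ln x powr a * min 1 (?r powr a) * (x + 1) powr (- d)) * indicator ?I u \<partial>lborel)"
    by (subst nn_integral_cmult_indicator) (auto simp: len)
  also have "\<dots> \<le> emeasure (gamma_measure a d) ?I"
    unfolding emeasure_gamma_measure[OF m]
  proof (rule nn_integral_mono)
    fix u
    show "ennreal (ln x powr a * min 1 (?r powr a) * (x + 1) powr (- d)) * indicator ?I u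
      \<le> ennreal (indicator {0..} u * u powr a * exp (- (d * u))) * indicator ?I u"
    proof (cases "u \<in> ?I")
      case True
      have "(ln x powr a * min 1 (?r powr a)) * (x + 1) powr (- d) \<le> u powr a * exp (- (d * u))"
        unfolding uu[OF True] using ub(1)[OF True] eb(1)[OF True]
        by (intro mult_mono mult_left_mono) (auto intro!: mult_nonneg_nonneg)
      then show ?thesis using True pos[OF True] by (auto intro!: ennreal_leI)
    qed simp
  qed
  finally show "ennreal (lower_ratio a x * w) \<le> emeasure (gamma_measure a d) ?I" .
qed

lemma suminf_gamma_measure_intervals:
  assumes "N \<ge> 1"
  shows "(\<Sum>n. emeasure (gamma_measure a d) {ln (real (n + N))..<ln (real (n + N) + 1)})
    = emeasure (gamma_measure a d) {ln (real N)..}"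
proof -
  let ?A = "\<lambda>n. {ln (real (n + N))..<ln (real (n + N) + 1)}"
  have "(\<Sum>n. emeasure (gamma_measure a d) (?A n)) = emeasure (gamma_measure a d) (\<Union>n. ?A n)"
  proof (rule suminf_emeasure)
    show "disjoint_family ?A"
      unfolding disjoint_family_on_def
    proof (intro ballI impI)
      fix m n :: nat assume "m \<noteq> n"
      have *: "?A m \<inter> ?A n = {}" if "m < n" for m n
      proof -
        have "ln (real (m + N) + 1) \<le> ln (real (n + N))" using that assms by simp
        then show ?thesis by auto
      qed
      show "?A m \<inter> ?A n = {}" using *[of m n] *[of n m] \<open>m \<noteq> n\<close> by (cases "m < n") auto
    qed
  qed auto
  also have "(\<Union>n. ?A n) = {ln (real N)..}"
  proof (intro equalityI subsetI)
    fix u assume "u \<in> (\<Union>n. ?A n)"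
    then obtain n where n: "u \<in> ?A n" by auto
    have "ln (real N) \<le> ln (real (n + N))" using assms by simp
    then show "u \<in> {ln (real N)..}" using n by auto
  next
    fix u assume "u \<in> {ln (real N)..}"
    then have "exp (ln (real N)) \<le> exp u" by simp
    then have u: "real N \<le> exp u" using assms by simp
    define k where "k = nat \<lfloor>exp u\<rfloor>"
    have k: "real k \<le> exp u" "exp u < real k + 1" unfolding k_def by (auto simp: of_nat_floor)
    have kN: "N \<le> k" unfolding k_def using u by (simp add: le_nat_floor)
    have "ln (real k) \<le> ln (exp u)" using k kN assms by (subst ln_le_cancel_iff) auto
    moreover have "ln (exp u) < ln (real k + 1)" using k by (subst ln_less_cancel_iff) auto
    ultimately have "u \<in> ?A (k - N)" using kN by simp
    then show "u \<in> (\<Union>n. ?A n)" by blast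
  qed
  finally show ?thesis .
qed

text \<open>The term of index \<open>n\<close> is compared with the mass of
  \<open>gamma_measure\<close> between \<open>ln n\<close> and \<open>ln (n + 1)\<close>. The joint
  limit makes this uniform in the parameter from some \<open>N\<close> on; everything before
  \<open>N\<close> is bounded and disappears with \<open>d p powr (a + 1)\<close>. The estimates
  live in the extended nonnegative reals until finiteness is known (\<open>fin\<close>), and only
  then move to the reals.\<close>

theorem weighted_gamma_series_tendsto:
  fixes F :: "'p filter" and f :: "nat \<Rightarrow> 'p \<Rightarrow> real" and d :: "'p \<Rightarrow> real"
  assumes a: "a > -1" and d: "filterlim d (at_right 0) F" and c: "0 \<le> c"
    and nonneg: "\<And>n p. 0 \<le> f n p" and bounded: "\<And>n p. f n p \<le> B n"
    and asym: "((\<lambda>(n, p). f n p / (real n powr (- 1 - d p) * ln (real n) powr a)) \<longlongrightarrow> c) (sequentially \<times>\<^sub>F F)"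
  shows "((\<lambda>p. ennreal (d p powr (a + 1)) * (\<Sum>n. ennreal (f (Suc n) p))) \<longlongrightarrow> ennreal (c * Gamma (a + 1))) F"
proof -
  let ?w = "\<lambda>n p. real n powr (- 1 - d p) * ln (real n) powr a"
  let ?J = "\<lambda>n p. emeasure (gamma_measure a (d p)) {ln (real n)..<ln (real n + 1)}"
  let ?P = "\<lambda>p. ennreal (d p powr (a + 1)) * (\<Sum>n. ennreal (f (Suc n) p))"
  define \<Gamma> where "\<Gamma> = Gamma (a + 1)"
  have \<Gamma>: "0 \<le> \<Gamma>" unfolding \<Gamma>_def using a by (intro Gamma_real_nonneg) auto
  have dpos: "\<forall>\<^sub>F p in F. 0 < d p" and d0: "(d \<longlongrightarrow> 0) F"
    using d by (auto simp: filterlim_at elim: eventually_mono)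
  have d1: "\<forall>\<^sub>F p in F. d p < 1" using d0 by (rule order_tendstoD(2)) simp
  have D0: "((\<lambda>p. d p powr (a + 1)) \<longlongrightarrow> 0) F"
    by (rule tendsto_zero_powrI[OF d0 tendsto_const]) (use a dpos in \<open>auto elim: eventually_mono\<close>)
  have B0: "0 \<le> B n" for n using nonneg[of n] bounded[of n] by (meson order_trans)
  have fst_lim: "filterlim (\<lambda>x. real (fst x)) at_top (sequentially \<times>\<^sub>F F)"
    by (rule filterlim_compose[OF filterlim_real_sequentially filterlim_fst])
  have key: "\<exists>C\<ge>0. \<forall>\<^sub>F p in F. ?P p \<le> ennreal ((c + e) * \<Gamma> + d p powr (a + 1) * C) \<and>
      ennreal (max 0 (c - e) * \<Gamma>) \<le> ennreal (d p powr (a + 1) * C) + ?P p" if e: "0 < e" for e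
  proof -
    let ?h = "\<lambda>x :: nat \<times> 'p. f (fst x) (snd x) / ?w (fst x) (snd x)"
    have h: "(?h \<longlongrightarrow> c) (sequentially \<times>\<^sub>F F)" using asym by (simp add: case_prod_unfold)
    have "((\<lambda>x. ?h x / lower_ratio a (real (fst x))) \<longlongrightarrow> c / 1) (sequentially \<times>\<^sub>F F)"
      by (intro tendsto_divide h filterlim_compose[OF ratio_tendsto(1) fst_lim]) auto
    then have 1: "\<forall>\<^sub>F x in sequentially \<times>\<^sub>F F. ?h x / lower_ratio a (real (fst x)) < c + e"
      by (rule order_tendstoD(2)) (use e in simp)
    have "((\<lambda>x. ?h x / upper_ratio a (real (fst x))) \<longlongrightarrow> c / 1) (sequentially \<times>\<^sub>F F)"
      by (intro tendsto_divide h filterlim_compose[OF ratio_tendsto(2) fst_lim]) auto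
    then have 2: "\<forall>\<^sub>F x in sequentially \<times>\<^sub>F F. c - e < ?h x / upper_ratio a (real (fst x))"
      by (rule order_tendstoD(1)) (use e in simp)
    have "\<forall>\<^sub>F x in sequentially \<times>\<^sub>F F. ?h x / lower_ratio a (real (fst x)) < c + e \<and> c - e < ?h x / upper_ratio a (real (fst x))"
      using 1 2 by (rule eventually_conj)
    then obtain Pn Pf where Pn: "eventually Pn sequentially" and Pf: "eventually Pf F"
      and P: "\<And>n p. Pn n \<Longrightarrow> Pf p \<Longrightarrow> f n p / ?w n p / lower_ratio a (real n) < c + e \<and> c - e < f n p / ?w n p / upper_ratio a (real n)"
      unfolding eventually_prod_filter by auto
    obtain N1 where N1: "\<And>n. n \<ge> N1 \<Longrightarrow> Pn n" using Pn by (auto simp: eventually_sequentially)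
    \<comment> \<open>\<open>N\<close> is at least 3, as \<open>gamma_measure_interval\<close>
      demands, and since the series runs over \<open>f (Suc n)\<close>, exactly \<open>N'\<close> of
      its terms come before index \<open>N = Suc N'\<close>.\<close>
    define N' where "N' = max N1 2"
    define N where "N = Suc N'"
    have N: "N \<ge> N1" "N \<ge> 3" by (auto simp: N_def N'_def)
    \<comment> \<open>The first summand bounds the terms before \<open>N\<close>, the second the
      mass of \<open>{0..<ln N}\<close> that the intervals miss; neither depends on
      \<open>p\<close>.\<close>
    define C where "C = (\<Sum>j<N'. B (Suc j)) + max 0 (c - e) * (exp (ln (real N)) * \<Gamma>)"
    have sB: "0 \<le> (\<Sum>j<N'. B (Suc j))" by (intro sum_nonneg B0)
    have C2: "0 \<le> max 0 (c - e) * (exp (ln (real N)) * \<Gamma>)" using \<Gamma> by simp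
    have C0: "0 \<le> C" unfolding C_def using sB C2 by linarith
    have "\<forall>\<^sub>F p in F. ?P p \<le> ennreal ((c + e) * \<Gamma> + d p powr (a + 1) * C) \<and>
      ennreal (max 0 (c - e) * \<Gamma>) \<le> ennreal (d p powr (a + 1) * C) + ?P p"
      using Pf dpos d1
    proof eventually_elim
      case (elim p)
      let ?D = "d p powr (a + 1)"
      let ?G = "gamma_measure a (d p)"
      have dd: "0 < d p" "d p \<le> 1" using elim by auto
      have fJ: "ennreal (f n p) \<le> ennreal (c + e) * ?J n p" "ennreal (max 0 (c - e)) * ?J n p \<le> ennreal (f n p)" if n: "n \<ge> N" for n
      proof -
        have n3: "3 \<le> real n" using n N by simp
        have w0: "0 < ?w n p" using n3 by simp
        have l0: "0 < lower_ratio a (real n)" using n3 by (auto simp: lower_ratio_def intro!: mult_pos_pos)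
        have u0: "0 < upper_ratio a (real n)" using n3 by (auto simp: upper_ratio_def)
        have Pnp: "f n p / ?w n p / lower_ratio a (real n) < c + e" "c - e < f n p / ?w n p / upper_ratio a (real n)"
          using P[of n p] N1[of n] n N elim by auto
        have "f n p \<le> (c + e) * (lower_ratio a (real n) * ?w n p)"
          using Pnp(1) w0 l0 by (simp add: pos_divide_less_eq mult.assoc mult.commute)
        then have "ennreal (f n p) \<le> ennreal (c + e) * ennreal (lower_ratio a (real n) * ?w n p)"
          using c e l0 w0 by (subst ennreal_mult[symmetric]) (auto intro!: ennreal_leI mult_nonneg_nonneg)
        also have "\<dots> \<le> ennreal (c + e) * ?J n p"
          by (intro mult_left_mono gamma_measure_interval n3 dd) auto
        finally show "ennreal (f n p) \<le> ennreal (c + e) * ?J n p" .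
        have "(c - e) * (upper_ratio a (real n) * ?w n p) \<le> f n p"
          using Pnp(2) w0 u0 by (simp add: pos_less_divide_eq mult.assoc mult.commute)
        then have "max 0 (c - e) * (upper_ratio a (real n) * ?w n p) \<le> f n p"
          using nonneg[of n p] by (simp add: max_def)
        then have le: "ennreal (max 0 (c - e)) * ennreal (upper_ratio a (real n) * ?w n p) \<le> ennreal (f n p)"
          using u0 w0 by (subst ennreal_mult[symmetric]) (auto intro!: ennreal_leI mult_nonneg_nonneg)
        have "ennreal (max 0 (c - e)) * ?J n p \<le> ennreal (max 0 (c - e)) * ennreal (upper_ratio a (real n) * ?w n p)"
          by (intro mult_left_mono gamma_measure_interval n3 dd) auto
        then show "ennreal (max 0 (c - e)) * ?J n p \<le> ennreal (f n p)" using le by (rule order_trans)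
      qed
      let ?T = "\<Sum>n. ennreal (f (n + N) p)"
      let ?E = "emeasure ?G {ln (real N)..}"
      have E: "(\<Sum>n. ?J (n + N) p) = ?E"
        using N suminf_gamma_measure_intervals[of N a "d p"] by simp
      have T1: "?T \<le> ennreal (c + e) * ?E"
      proof -
        have "?T \<le> (\<Sum>n. ennreal (c + e) * ?J (n + N) p)"
          by (intro suminf_le fJ) auto
        then show ?thesis by (simp only: ennreal_suminf_cmult E)
      qed
      have T2: "ennreal (max 0 (c - e)) * ?E \<le> ?T"
      proof -
        have "(\<Sum>n. ennreal (max 0 (c - e)) * ?J (n + N) p) \<le> ?T"
          by (intro suminf_le fJ) auto
        then show ?thesis by (simp only: ennreal_suminf_cmult E)
      qed
      have split: "(\<Sum>n. ennreal (f (Suc n) p)) = ?T + (\<Sum>j<N'. ennreal (f (Suc j) p))"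
        using suminf_offset[of "\<lambda>n. ennreal (f (Suc n) p)" N'] by (simp add: N_def)
      have tot: "ennreal ?D * emeasure ?G UNIV = ennreal \<Gamma>"
        unfolding \<Gamma>_def by (rule emeasure_gamma_measure_UNIV[OF a dd(1)])
      have D0': "0 \<le> ?D" by simp
      have "?P p = ennreal ?D * ?T + ennreal ?D * (\<Sum>j<N'. ennreal (f (Suc j) p))"
        by (simp add: split distrib_left)
      also have "\<dots> \<le> ennreal ((c + e) * \<Gamma>) + ennreal (?D * C)"
      proof (rule add_mono)
        have "ennreal ?D * ?T \<le> ennreal ?D * (ennreal (c + e) * emeasure ?G UNIV)"
          by (intro mult_left_mono order_trans[OF T1] emeasure_mono) auto
        also have "\<dots> = ennreal (c + e) * ennreal \<Gamma>" by (simp only: mult.left_commute tot)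
        finally show "ennreal ?D * ?T \<le> ennreal ((c + e) * \<Gamma>)"
          using c e \<Gamma> by (simp add: ennreal_mult)
        have "(\<Sum>j<N'. ennreal (f (Suc j) p)) \<le> (\<Sum>j<N'. ennreal (B (Suc j)))"
          by (intro sum_mono ennreal_leI bounded)
        also have "\<dots> = ennreal (\<Sum>j<N'. B (Suc j))" using B0 by (intro sum_ennreal) auto
        also have "\<dots> \<le> ennreal C" unfolding C_def using C2 by (intro ennreal_leI) auto
        finally have "ennreal ?D * (\<Sum>j<N'. ennreal (f (Suc j) p)) \<le> ennreal ?D * ennreal C"
          by (intro mult_left_mono) auto
        then show "ennreal ?D * (\<Sum>j<N'. ennreal (f (Suc j) p)) \<le> ennreal (?D * C)"
          using C0 by (simp add: ennreal_mult)
      qed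
      also have "\<dots> = ennreal ((c + e) * \<Gamma> + ?D * C)"
        using c e \<Gamma> C0 by (intro ennreal_plus[symmetric]) auto
      finally have up: "?P p \<le> ennreal ((c + e) * \<Gamma> + ?D * C)" .
      have pos: "AE u in ?G. 0 \<le> u"
        unfolding gamma_measure_def by (subst AE_density) (auto simp: indicator_def)
      have "emeasure ?G UNIV = emeasure ?G ({0..<ln (real N)} \<union> {ln (real N)..})"
        by (rule emeasure_eq_AE) (use pos in \<open>auto elim: eventually_mono\<close>)
      also have "\<dots> \<le> emeasure ?G {0..<ln (real N)} + ?E" by (intro emeasure_subadditive) auto
      also have "\<dots> \<le> ennreal (exp (ln (real N)) * \<Gamma>) + ?E"
        unfolding \<Gamma>_def by (intro add_mono emeasure_gamma_measure_initial a dd order_refl)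
      finally have "ennreal ?D * emeasure ?G UNIV \<le> ennreal ?D * (ennreal (exp (ln (real N)) * \<Gamma>) + ?E)"
        by (intro mult_left_mono) auto
      then have "ennreal \<Gamma> \<le> ennreal ?D * ennreal (exp (ln (real N)) * \<Gamma>) + ennreal ?D * ?E"
        unfolding tot distrib_left .
      then have "ennreal (max 0 (c - e)) * ennreal \<Gamma> \<le> ennreal (max 0 (c - e)) * (ennreal ?D * ennreal (exp (ln (real N)) * \<Gamma>) + ennreal ?D * ?E)"
        by (intro mult_left_mono) auto
      also have "\<dots> = ennreal ?D * ennreal (max 0 (c - e) * (exp (ln (real N)) * \<Gamma>)) + ennreal ?D * (ennreal (max 0 (c - e)) * ?E)"
        using \<Gamma> by (simp add: distrib_left ennreal_mult mult_ac)
      also have "\<dots> \<le> ennreal ?D * ennreal C + ?P p"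
      proof (intro add_mono mult_left_mono)
        show "ennreal (max 0 (c - e) * (exp (ln (real N)) * \<Gamma>)) \<le> ennreal C"
          unfolding C_def using sB by (intro ennreal_leI) auto
        show "ennreal (max 0 (c - e)) * ?E \<le> (\<Sum>n. ennreal (f (Suc n) p))"
          unfolding split by (rule order_trans[OF T2]) simp
      qed auto
      finally have low: "ennreal (max 0 (c - e) * \<Gamma>) \<le> ennreal (?D * C) + ?P p"
        using \<Gamma> C0 by (simp add: ennreal_mult)
      show ?case using up low by blast
    qed
    then show ?thesis using C0 by blast
  qed
  have fin: "\<forall>\<^sub>F p in F. ?P p = ennreal (enn2real (?P p))"
  proof -
    obtain C where "\<forall>\<^sub>F p in F. ?P p \<le> ennreal ((c + 1) * \<Gamma> + d p powr (a + 1) * C) \<and>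
      ennreal (max 0 (c - 1) * \<Gamma>) \<le> ennreal (d p powr (a + 1) * C) + ?P p"
      using key[OF zero_less_one] by blast
    then show ?thesis
    proof eventually_elim
      case (elim p)
      then have "?P p < \<top>" by (auto intro: le_less_trans)
      then show ?case by simp
    qed
  qed
  have "((\<lambda>p. enn2real (?P p)) \<longlongrightarrow> c * \<Gamma>) F"
  proof (rule tendstoI)
    fix e :: real assume e: "0 < e"
    define e' where "e' = e / (2 * (\<Gamma> + 1))"
    have e': "0 < e'" using e \<Gamma> by (simp add: e'_def)
    obtain C where C: "C \<ge> 0" and ev: "\<forall>\<^sub>F p in F. ?P p \<le> ennreal ((c + e') * \<Gamma> + d p powr (a + 1) * C) \<and>
      ennreal (max 0 (c - e') * \<Gamma>) \<le> ennreal (d p powr (a + 1) * C) + ?P p"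
      using key[OF e'] by auto
    have "((\<lambda>p. d p powr (a + 1) * C) \<longlongrightarrow> 0 * C) F" by (intro tendsto_intros D0)
    then have "\<forall>\<^sub>F p in F. d p powr (a + 1) * C < e / 2"
      by (rule order_tendstoD(2)) (use e in simp)
    with ev fin show "\<forall>\<^sub>F p in F. dist (enn2real (?P p)) (c * \<Gamma>) < e"
    proof eventually_elim
      case (elim p)
      define z where "z = enn2real (?P p)"
      have z: "?P p = ennreal z" "0 \<le> z" using elim by (auto simp: z_def)
      have DC: "0 \<le> d p powr (a + 1) * C" using C by simp
      have "0 \<le> (c + e') * \<Gamma> + d p powr (a + 1) * C" using DC c e' \<Gamma> by simp
      then have 1: "z \<le> (c + e') * \<Gamma> + d p powr (a + 1) * C"
        using elim unfolding z(1) by (simp add: ennreal_le_iff)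
      have "ennreal (max 0 (c - e') * \<Gamma>) \<le> ennreal (d p powr (a + 1) * C + z)"
        using elim DC z(2) unfolding z(1) by (simp add: ennreal_plus)
      then have 2: "max 0 (c - e') * \<Gamma> \<le> d p powr (a + 1) * C + z"
        using ennreal_le_iff[OF add_nonneg_nonneg[OF DC z(2)]] by (simp only:)
      have "(c - e') * \<Gamma> \<le> max 0 (c - e') * \<Gamma>" using \<Gamma> by (intro mult_right_mono) auto
      moreover have "e' * \<Gamma> \<le> e / 2"
      proof -
        have "e' * \<Gamma> \<le> e' * (\<Gamma> + 1)" using e' by simp
        also have "\<dots> = e / 2" using \<Gamma> by (simp add: e'_def field_simps)
        finally show ?thesis .
      qed
      ultimately have "\<bar>z - c * \<Gamma>\<bar> < e" using 1 2 elim by (simp add: algebra_simps abs_less_iff)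
      then show ?case by (simp add: dist_real_def z_def)
    qed
  qed
  then have "((\<lambda>p. ennreal (enn2real (?P p))) \<longlongrightarrow> ennreal (c * \<Gamma>)) F" by (rule tendsto_ennrealI)
  then show ?thesis
    unfolding \<Gamma>_def by (rule Lim_transform_eventually) (use fin in \<open>auto elim: eventually_mono\<close>)
qed

section \<open>The limit under moment assumptions\<close>

lemma lg_ge_1: "1 \<le> lg x"
proof -
  have "ln (exp 1) \<le> ln (max x (exp 1))" by (subst ln_le_cancel_iff) (auto simp: less_max_iff_disj)
  then show ?thesis by (simp add: lg_def)
qed

lemma lg_eq_ln: "3 \<le> x \<Longrightarrow> lg x = ln x"
  using exp_le by (simp add: lg_def max_def)

lemma phi_squared: "0 < x \<Longrightarrow> (phi x)\<^sup>2 = pi\<^sup>2 * x / (8 * lg x)"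
  using lg_ge_1[of x] unfolding phi_def by (intro real_sqrt_pow2) simp

lemma lg_at_top: "filterlim lg at_top at_top"
proof (rule filterlim_mono_eventually[OF ln_at_top order_refl order_refl])
  show "\<forall>\<^sub>F x in at_top. ln x = lg x" using eventually_ge_at_top[of 3] by eventually_elim (simp add: lg_eq_ln)
qed

lemma phi_at_top: "filterlim phi at_top at_top"
proof (rule filterlim_mono_eventually[OF _ order_refl order_refl])
  show "filterlim (\<lambda>x :: real. sqrt (pi\<^sup>2 * x / (8 * ln x))) at_top at_top" by real_asymp
  show "\<forall>\<^sub>F x in at_top. sqrt (pi\<^sup>2 * x / (8 * ln x)) = phi x"
    using eventually_ge_at_top[of 3] by eventually_elim (simp add: phi_def lg_eq_ln)
qed

section \<open>The walk at the radius of the theorem, in the joint limit\<close>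

locale perturbed_walk = iid_walk M X for M :: "'a measure" and X +
  fixes \<sigma> r a \<tau> :: real and b :: "nat \<Rightarrow> real \<Rightarrow> real"
  assumes sigma: "0 < \<sigma>" and r: "r > 1" and a: "a > -1" and pert: "perturbation r \<tau> b"
begin

definition e0 :: real where "e0 = 1 / sqrt (r - 1)"

abbreviation G :: "(nat \<times> real) filter" where "G \<equiv> sequentially \<times>\<^sub>F at_left e0"

definition eps :: "nat \<times> real \<Rightarrow> real" where "eps p = snd p + b (fst p) (snd p)"

definition radius :: "nat \<times> real \<Rightarrow> real" where "radius p = \<sigma> * phi (real (fst p)) * eps p"

definition prob_term :: "nat \<Rightarrow> real \<Rightarrow> real" where
  "prob_term n \<epsilon> = pstay (radius (n, \<epsilon>)) n"

definition series_term :: "nat \<Rightarrow> real \<Rightarrow> real" where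
  "series_term n \<epsilon> = real n powr (r - 2) * lg (real n) powr a * prob_term n \<epsilon>"

lemma e0_pos: "0 < e0" using r by (simp add: e0_def)

lemma e0_squared: "1 / e0\<^sup>2 = r - 1" using r by (simp add: e0_def power_divide)

lemma e0_cubed: "1 / e0 ^ 3 = (r - 1) powr (3 / 2)"
proof -
  have "1 / e0 ^ 3 = sqrt (r - 1) ^ 3" using r by (simp add: e0_def power_divide)
  also have "\<dots> = ((r - 1) powr (1 / 2)) powr 3" using r by (simp add: powr_half_sqrt)
  also have "\<dots> = (r - 1) powr (3 / 2)" by (simp add: powr_powr)
  finally show ?thesis .
qed

lemma weighted_series_eq: "weighted_series M X \<sigma> r a b \<epsilon> = (\<Sum>n. ennreal (series_term (Suc n) \<epsilon>))"
  unfolding weighted_series_def series_term_def prob_term_def radius_def eps_def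
  by (subst max_abs_sum_le_eq_stay) auto

lemma series_term_nonneg: "0 \<le> series_term n \<epsilon>"
  by (simp add: series_term_def prob_term_def)

lemma series_term_le: "series_term n \<epsilon> \<le> real n powr (r - 2) * lg (real n) powr a"
  unfolding series_term_def prob_term_def by (rule mult_left_le) auto

lemma n_at_top: "filterlim (\<lambda>p. real (fst p)) at_top G"
  by (rule filterlim_compose[OF filterlim_real_sequentially filterlim_fst])

lemma n_ge: "\<forall>\<^sub>F p in G. c \<le> real (fst p)"
  using n_at_top by (simp add: filterlim_at_top)

lemma lg_n_at_top: "filterlim (\<lambda>p. lg (real (fst p))) at_top G"
  by (rule filterlim_compose[OF lg_at_top n_at_top])

lemma snd_tendsto: "(snd \<longlongrightarrow> e0) G"
proof -
  have "filterlim snd (at_left e0) G" by (rule filterlim_snd)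
  then show ?thesis by (simp add: filterlim_at)
qed

lemma b_lg_tendsto: "((\<lambda>p. b (fst p) (snd p) * lg (real (fst p))) \<longlongrightarrow> \<tau>) G"
  using pert unfolding perturbation_def e0_def by (simp add: case_prod_unfold)

lemma b_tendsto: "((\<lambda>p. b (fst p) (snd p)) \<longlongrightarrow> 0) G"
proof -
  have "((\<lambda>p. b (fst p) (snd p) * lg (real (fst p)) / lg (real (fst p))) \<longlongrightarrow> 0) G"
    by (rule real_tendsto_divide_at_top[OF b_lg_tendsto lg_n_at_top])
  moreover have "lg z \<noteq> 0" for z using lg_ge_1[of z] by linarith
  ultimately show ?thesis by simp
qed

lemma eps_tendsto: "(eps \<longlongrightarrow> e0) G"
  using tendsto_add[OF snd_tendsto b_tendsto] by (simp add: eps_def[abs_def])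

lemma eps_pos: "\<forall>\<^sub>F p in G. 0 < eps p"
  using eps_tendsto e0_pos by (rule order_tendstoD(1))

lemma radius_at_top: "filterlim radius at_top G"
proof -
  have "filterlim (\<lambda>p. (\<sigma> * eps p) * phi (real (fst p))) at_top G"
    by (rule filterlim_tendsto_pos_mult_at_top[OF tendsto_mult[OF tendsto_const eps_tendsto]])
       (use sigma e0_pos filterlim_compose[OF phi_at_top n_at_top] in auto)
  then show ?thesis by (simp add: radius_def[abs_def] mult_ac)
qed

lemma radius_pos: "\<forall>\<^sub>F p in G. 0 < radius p"
  using radius_at_top by (simp add: filterlim_at_top_dense)

text \<open>The constant in \<open>phi\<close> is made for this identity:
  \<open>n * t\<^sup>2 * \<sigma>\<^sup>2 / 2\<close> becomes \<open>lg n / (eps p)\<^sup>2\<close>,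
  so that the probability decays like a power of \<open>n\<close>.\<close>

lemma theta_squared:
  assumes "0 < fst p" "0 < eps p"
  shows "(pi / (2 * radius p))\<^sup>2 = 2 / (\<sigma>\<^sup>2 * (eps p)\<^sup>2) * (lg (real (fst p)) / real (fst p))"
proof -
  have "(pi / (2 * radius p))\<^sup>2 = pi\<^sup>2 / (4 * \<sigma>\<^sup>2 * (phi (real (fst p)))\<^sup>2 * (eps p)\<^sup>2)"
    by (simp add: radius_def power_divide power_mult_distrib)
  also have "(phi (real (fst p)))\<^sup>2 = pi\<^sup>2 * real (fst p) / (8 * lg (real (fst p)))"
    using assms by (intro phi_squared) auto
  finally show ?thesis
    using assms sigma lg_ge_1[of "real (fst p)"] by (simp add: field_simps)
qed

text \<open>The squared frequency is of order \<open>ln n / n\<close>, so the expression is of order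
  \<open>ln n * (ln n / n) powr (k / 2)\<close>.\<close>

lemma theta_small:
  assumes "0 < k"
  shows "((\<lambda>p. real (fst p) * (pi / (2 * radius p)) powr (2 + k)) \<longlongrightarrow> 0) G"
proof -
  let ?q = "\<lambda>p. 2 / (\<sigma>\<^sup>2 * (eps p)\<^sup>2)"
  have q: "(?q \<longlongrightarrow> 2 / (\<sigma>\<^sup>2 * e0\<^sup>2)) G"
    using sigma e0_pos by (intro tendsto_intros eps_tendsto) auto
  have "((\<lambda>x :: real. ln x * (ln x / x) powr (k / 2)) \<longlongrightarrow> 0) at_top"
    using assms by real_asymp
  then have "((\<lambda>p. ln (real (fst p)) * (ln (real (fst p)) / real (fst p)) powr (k / 2)) \<longlongrightarrow> 0) G"
    using n_at_top by (rule filterlim_compose)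
  then have "((\<lambda>p. ln (real (fst p)) * (ln (real (fst p)) / real (fst p)) powr (k / 2) * ?q p powr (1 + k / 2))
     \<longlongrightarrow> 0 * (2 / (\<sigma>\<^sup>2 * e0\<^sup>2)) powr (1 + k / 2)) G"
    using sigma e0_pos by (intro tendsto_intros q) auto
  then show ?thesis
    unfolding mult_zero_left
  proof (rule Lim_transform_eventually)
    show "\<forall>\<^sub>F p in G. ln (real (fst p)) * (ln (real (fst p)) / real (fst p)) powr (k / 2) * ?q p powr (1 + k / 2)
      = real (fst p) * (pi / (2 * radius p)) powr (2 + k)"
      using n_ge[of 3] eps_pos radius_pos
    proof eventually_elim
      case (elim p)
      let ?n = "real (fst p)" and ?t = "pi / (2 * radius p)"
      have t0: "0 < ?t" using elim by simp
      have l0: "0 < ln ?n" using elim by simp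
      have q0: "0 < ?q p" using elim sigma by simp
      have t2: "?t\<^sup>2 = ?q p * (ln ?n / ?n)" using theta_squared[of p] elim by (simp add: lg_eq_ln)
      have "?t powr (2 + k) = (?t powr 2) powr (1 + k / 2)" by (simp add: powr_powr algebra_simps)
      also have "?t powr 2 = ?t\<^sup>2" using t0 by simp
      also have "(?t\<^sup>2) powr (1 + k / 2) = ?q p powr (1 + k / 2) * (ln ?n / ?n) powr (1 + k / 2)"
        unfolding t2 using q0 l0 elim by (intro powr_mult)
      also have "(ln ?n / ?n) powr (1 + k / 2) = (ln ?n / ?n) * (ln ?n / ?n) powr (k / 2)"
        using l0 elim by (simp add: powr_add)
      finally show ?case using elim by (simp add: mult_ac)
    qed
  qed
qed

text \<open>The distance to the critical exponent: \<open>n powr (r - 2)\<close> times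
  \<open>n powr (- 1 / \<epsilon>\<^sup>2)\<close> is
  \<open>n powr (- 1 - delta \<epsilon>)\<close>.\<close>

definition delta :: "real \<Rightarrow> real" where "delta \<epsilon> = 1 / \<epsilon>\<^sup>2 - (r - 1)"

lemma delta_pos: "0 < \<epsilon> \<Longrightarrow> \<epsilon> < e0 \<Longrightarrow> 0 < delta \<epsilon>"
proof -
  assume e: "0 < \<epsilon>" "\<epsilon> < e0"
  then have "\<epsilon>\<^sup>2 < e0\<^sup>2" by (intro power_strict_mono) auto
  then have "1 / e0\<^sup>2 < 1 / \<epsilon>\<^sup>2" using e by (intro divide_strict_left_mono) auto
  then show ?thesis by (simp add: delta_def e0_squared)
qed

lemma eventually_left_range: "\<forall>\<^sub>F \<epsilon> in at_left e0. 0 < \<epsilon> \<and> \<epsilon> < e0"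
  using e0_pos by (intro eventually_at_leftI[of 0]) auto

lemma delta_at_right: "filterlim delta (at_right 0) (at_left e0)"
proof -
  have "(delta \<longlongrightarrow> 1 / e0\<^sup>2 - (r - 1)) (at_left e0)"
    unfolding delta_def[abs_def] using e0_pos by (intro tendsto_intros) auto
  moreover have "\<forall>\<^sub>F \<epsilon> in at_left e0. delta \<epsilon> \<in> {0<..} \<and> delta \<epsilon> \<noteq> 0"
    using eventually_left_range by eventually_elim (use delta_pos in force)
  ultimately show ?thesis by (auto simp: filterlim_at e0_squared)
qed

lemma precise_asymptotics_iff:
  "precise_asymptotics M X \<sigma> r a \<tau> b \<longleftrightarrow>
    ((\<lambda>\<epsilon>. ennreal (delta \<epsilon> powr (a + 1)) * (\<Sum>n. ennreal (series_term (Suc n) \<epsilon>)))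
      \<longlongrightarrow> ennreal (4 / pi * exp (2 * \<tau> * (r - 1) powr (3 / 2)) * Gamma (a + 1))) (at_left e0)"
  unfolding precise_asymptotics_def weighted_series_eq delta_def e0_def ..

text \<open>Factoring the difference of squares leaves \<open>b\<close> times a quotient tending to
  \<open>2 / e0 ^ 3\<close>, and \<open>b * lg n\<close> tends to \<open>\<tau>\<close>.\<close>

lemma exponent_shift_tendsto:
  "((\<lambda>p. lg (real (fst p)) * (1 / (snd p)\<^sup>2 - 1 / (eps p)\<^sup>2)) \<longlongrightarrow> 2 * \<tau> * (r - 1) powr (3 / 2)) G"
proof -
  have "((\<lambda>p. b (fst p) (snd p) * lg (real (fst p)) * ((snd p + eps p) / ((snd p)\<^sup>2 * (eps p)\<^sup>2)))
      \<longlongrightarrow> \<tau> * ((e0 + e0) / (e0\<^sup>2 * e0\<^sup>2))) G"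
    using e0_pos by (intro tendsto_intros b_lg_tendsto snd_tendsto eps_tendsto) auto
  also have "\<tau> * ((e0 + e0) / (e0\<^sup>2 * e0\<^sup>2)) = 2 * \<tau> * (1 / e0 ^ 3)"
    using e0_pos by (simp add: field_simps eval_nat_numeral)
  finally have "((\<lambda>p. b (fst p) (snd p) * lg (real (fst p)) * ((snd p + eps p) / ((snd p)\<^sup>2 * (eps p)\<^sup>2)))
      \<longlongrightarrow> 2 * \<tau> * (r - 1) powr (3 / 2)) G" unfolding e0_cubed .
  then show ?thesis
  proof (rule Lim_transform_eventually)
    have "\<forall>\<^sub>F p in G. 0 < snd p" using snd_tendsto e0_pos by (rule order_tendstoD(1))
    with eps_pos show "\<forall>\<^sub>F p in G. b (fst p) (snd p) * lg (real (fst p)) * ((snd p + eps p) / ((snd p)\<^sup>2 * (eps p)\<^sup>2))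
      = lg (real (fst p)) * (1 / (snd p)\<^sup>2 - 1 / (eps p)\<^sup>2)"
    proof eventually_elim
      case (elim p)
      have "1 / (snd p)\<^sup>2 - 1 / (eps p)\<^sup>2 = (eps p - snd p) * (snd p + eps p) / ((snd p)\<^sup>2 * (eps p)\<^sup>2)"
        using elim by (simp add: field_simps power2_eq_square)
      also have "eps p - snd p = b (fst p) (snd p)" by (simp add: eps_def)
      finally show ?case by simp
    qed
  qed
qed

text \<open>The exponent in \<open>prob_stay_asymptotics\<close> is
  \<open>ln n / (eps p)\<^sup>2\<close>. Multiplying by the exponential of
  \<open>exponent_shift_tendsto\<close> replaces \<open>eps p\<close> by \<epsilon> and brings the
  factor with \<open>\<tau>\<close> into the limit; what remains is the hypothesis of
  \<open>weighted_gamma_series_tendsto\<close> for \<open>delta\<close>.\<close>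

theorem precise_asymptotics_of_moments:
  assumes "0 < \<eta>" "\<eta> < 1" "integrable M (X 0)" "expectation (X 0) = 0"
    "integrable M (\<lambda>\<omega>. (X 0 \<omega>)\<^sup>2)" "expectation (\<lambda>\<omega>. (X 0 \<omega>)\<^sup>2) = \<sigma>\<^sup>2"
    "integrable M (\<lambda>\<omega>. \<bar>X 0 \<omega>\<bar> powr (2 + \<eta>))"
  shows "precise_asymptotics M X \<sigma> r a \<tau> b"
proof -
  interpret cw: centered_walk M X \<sigma> \<eta>
    by unfold_locales (use assms sigma in auto)
  have n_theta: "\<forall>\<^sub>F p in G. real (fst p) * (pi / (2 * radius p))\<^sup>2 = 2 / (\<sigma>\<^sup>2 * (eps p)\<^sup>2) * lg (real (fst p))"
    using n_ge[of 3] eps_pos by eventually_elim (subst theta_squared, auto)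
  interpret md: moderate_deviations M X \<sigma> \<eta> G fst radius
  proof
    show "filterlim radius at_top G" by (rule radius_at_top)
    have "filterlim (\<lambda>p. 2 / (\<sigma>\<^sup>2 * (eps p)\<^sup>2) * lg (real (fst p))) at_top G"
      by (rule filterlim_tendsto_pos_mult_at_top[OF _ _ lg_n_at_top, of _ "2 / (\<sigma>\<^sup>2 * e0\<^sup>2)"])
         (use sigma e0_pos in \<open>auto intro!: tendsto_intros eps_tendsto\<close>)
    then show "filterlim (\<lambda>p. real (fst p) * (pi / (2 * radius p))\<^sup>2) at_top G"
      by (rule filterlim_mono_eventually[OF _ order_refl order_refl]) (use n_theta in \<open>auto elim: eventually_mono\<close>)
    show "((\<lambda>p. real (fst p) * (pi / (2 * radius p)) powr (2 + cw.kap)) \<longlongrightarrow> 0) G"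
      using cw.kap by (intro theta_small) auto
  qed
  have lim: "((\<lambda>p. pstay (radius p) (fst p) * exp (real (fst p) * (pi / (2 * radius p))\<^sup>2 * \<sigma>\<^sup>2 / 2)
      * exp (lg (real (fst p)) * (1 / (snd p)\<^sup>2 - 1 / (eps p)\<^sup>2)))
      \<longlongrightarrow> 4 / pi * exp (2 * \<tau> * (r - 1) powr (3 / 2))) G"
    by (intro tendsto_mult md.prob_stay_asymptotics tendsto_exp exponent_shift_tendsto)
  have "((\<lambda>(n, \<epsilon>). series_term n \<epsilon> / (real n powr (- 1 - delta \<epsilon>) * ln (real n) powr a))
    \<longlongrightarrow> 4 / pi * exp (2 * \<tau> * (r - 1) powr (3 / 2))) G"
    using lim
  proof (rule Lim_transform_eventually)
    show "\<forall>\<^sub>F p in G. pstay (radius p) (fst p) * exp (real (fst p) * (pi / (2 * radius p))\<^sup>2 * \<sigma>\<^sup>2 / 2)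
      * exp (lg (real (fst p)) * (1 / (snd p)\<^sup>2 - 1 / (eps p)\<^sup>2))
      = (case p of (n, \<epsilon>) \<Rightarrow> series_term n \<epsilon> / (real n powr (- 1 - delta \<epsilon>) * ln (real n) powr a))"
      using n_ge[of 3] eps_pos n_theta
    proof eventually_elim
      case (elim p)
      let ?n = "real (fst p)" and ?e = "snd p"
      have l0: "0 < ln ?n" using elim by simp
      have e1: "?n * (pi / (2 * radius p))\<^sup>2 * \<sigma>\<^sup>2 / 2 = ln ?n / (eps p)\<^sup>2"
        using elim sigma by (simp add: lg_eq_ln field_simps)
      have "exp (?n * (pi / (2 * radius p))\<^sup>2 * \<sigma>\<^sup>2 / 2) * exp (lg ?n * (1 / ?e\<^sup>2 - 1 / (eps p)\<^sup>2)) = exp (ln ?n * (1 / ?e\<^sup>2))"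
        unfolding e1 exp_add[symmetric] using elim by (simp add: lg_eq_ln algebra_simps)
      also have "\<dots> = ?n powr (1 / ?e\<^sup>2)" using elim by (simp add: powr_def mult.commute)
      also have "\<dots> = ?n powr (r - 2) / ?n powr (- 1 - delta ?e)"
        unfolding powr_diff[symmetric] by (simp add: delta_def)
      finally have "pstay (radius p) (fst p) * exp (?n * (pi / (2 * radius p))\<^sup>2 * \<sigma>\<^sup>2 / 2) * exp (lg ?n * (1 / ?e\<^sup>2 - 1 / (eps p)\<^sup>2))
        = pstay (radius p) (fst p) * (?n powr (r - 2) / ?n powr (- 1 - delta ?e))"
        by (simp only: mult.assoc)
      then show ?case using l0 elim
        by (cases p) (simp add: series_term_def prob_term_def lg_eq_ln)
    qed
  qed
  then show ?thesis
    unfolding precise_asymptotics_iff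
    by (intro weighted_gamma_series_tendsto[OF a delta_at_right, where B="\<lambda>n. real n powr (r - 2) * lg (real n) powr a"]
        series_term_nonneg series_term_le) auto
qed

section \<open>The converse\<close>

text \<open>The series at fixed \<epsilon> runs over all \<open>n\<close>, so the threshold must be
  the same for all \<epsilon> near \<open>e0\<close>; the product filter provides this.\<close>

lemma eventually_G_uniform:
  assumes "\<forall>\<^sub>F p in G. P (fst p) (snd p)"
  obtains N where "\<forall>\<^sub>F \<epsilon> in at_left e0. \<forall>n\<ge>N. P n \<epsilon>"
proof -
  obtain Pn Pe where Pn: "eventually Pn sequentially" and Pe: "eventually Pe (at_left e0)"
    and P: "\<And>n \<epsilon>. Pn n \<Longrightarrow> Pe \<epsilon> \<Longrightarrow> P n \<epsilon>"
    using assms unfolding eventually_prod_filter by auto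
  obtain N where N: "\<And>n. n \<ge> N \<Longrightarrow> Pn n" using Pn by (auto simp: eventually_sequentially)
  have "\<forall>\<^sub>F \<epsilon> in at_left e0. \<forall>n\<ge>N. P n \<epsilon>"
    using Pe by eventually_elim (use N P in blast)
  then show ?thesis by (rule that)
qed

lemma delta_powr_tendsto_0: "((\<lambda>\<epsilon>. delta \<epsilon> powr (a + 1)) \<longlongrightarrow> 0) (at_left e0)"
proof (rule tendsto_zero_powrI)
  show "(delta \<longlongrightarrow> 0) (at_left e0)" using delta_at_right by (simp add: filterlim_at)
  show "\<forall>\<^sub>F \<epsilon> in at_left e0. 0 \<le> delta \<epsilon>"
    using eventually_left_range by eventually_elim (use delta_pos in force)
qed (use a in auto)

lemma limit_pos: "0 < 4 / pi * exp (2 * \<tau> * (r - 1) powr (3 / 2)) * Gamma (a + 1)"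
  using a by (intro mult_pos_pos Gamma_real_pos) auto

text \<open>The terms are dominated, uniformly in \<epsilon>, by a summable sequence: half of
  \<open>\<gamma>\<close> absorbs the logarithm, and for the initial terms the probability is
  bounded by 1. The normalised series is then at most a constant times
  \<open>delta \<epsilon> powr (a + 1)\<close>, which tends to 0, whereas the claimed limit is
  positive.\<close>

lemma no_asymptotics_if_small:
  assumes g: "0 < \<gamma>" and small: "\<forall>\<^sub>F p in G. pstay (radius p) (fst p) \<le> K * real (fst p) powr (- (r - 1) - \<gamma>)"
  shows "\<not> precise_asymptotics M X \<sigma> r a \<tau> b"
proof
  assume "precise_asymptotics M X \<sigma> r a \<tau> b"
  then have lim: "((\<lambda>\<epsilon>. ennreal (delta \<epsilon> powr (a + 1)) * (\<Sum>n. ennreal (series_term (Suc n) \<epsilon>)))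
      \<longlongrightarrow> ennreal (4 / pi * exp (2 * \<tau> * (r - 1) powr (3 / 2)) * Gamma (a + 1))) (at_left e0)"
    by (simp only: precise_asymptotics_iff)
  obtain N where N: "\<forall>\<^sub>F \<epsilon> in at_left e0. \<forall>n\<ge>N. pstay (radius (n, \<epsilon>)) n \<le> K * real n powr (- (r - 1) - \<gamma>)"
    using eventually_G_uniform[of "\<lambda>n \<epsilon>. pstay (radius (n, \<epsilon>)) n \<le> K * real n powr (- (r - 1) - \<gamma>)"] small by auto
  define g where "g n = (if n < N then real n powr (r - 2) * lg (real n) powr a
    else \<bar>K\<bar> * (real n powr (- 1 - \<gamma>) * lg (real n) powr a))" for n
  have g0: "0 \<le> g n" for n by (simp add: g_def)
  have "summable (\<lambda>n. real n powr (- 1 - \<gamma> / 2))"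
    using g by (subst summable_real_powr_iff) auto
  then have sK: "summable (\<lambda>n. \<bar>K\<bar> * real n powr (- 1 - \<gamma> / 2))" by (rule summable_mult)
  have "\<forall>\<^sub>F n in sequentially. norm (g n) \<le> \<bar>K\<bar> * real n powr (- 1 - \<gamma> / 2)"
  proof -
    have "((\<lambda>x :: real. x powr (- \<gamma> / 2) * ln x powr a) \<longlongrightarrow> 0) at_top"
      using g by real_asymp
    then have "((\<lambda>n. real n powr (- \<gamma> / 2) * ln (real n) powr a) \<longlongrightarrow> 0) sequentially"
      using filterlim_real_sequentially by (rule filterlim_compose)
    then have "\<forall>\<^sub>F n in sequentially. real n powr (- \<gamma> / 2) * ln (real n) powr a < 1"
      by (rule order_tendstoD(2)) simp
    then show ?thesis using eventually_ge_at_top[of N] eventually_ge_at_top[of 3]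
    proof eventually_elim
      case (elim n)
      have "real n powr (- 1 - \<gamma>) * lg (real n) powr a = real n powr (- 1 - \<gamma> / 2) * (real n powr (- \<gamma> / 2) * ln (real n) powr a)"
      proof -
        have "real n powr (- 1 - \<gamma>) = real n powr (- 1 - \<gamma> / 2) * real n powr (- \<gamma> / 2)"
          unfolding powr_add[symmetric] by (rule arg_cong[where f="\<lambda>z. real n powr z"]) simp
        then show ?thesis using elim by (simp only: lg_eq_ln mult.assoc)
      qed
      also have "\<dots> \<le> real n powr (- 1 - \<gamma> / 2) * 1" using elim by (intro mult_left_mono) auto
      finally have "\<bar>K\<bar> * (real n powr (- 1 - \<gamma>) * lg (real n) powr a) \<le> \<bar>K\<bar> * real n powr (- 1 - \<gamma> / 2)"
        by (intro mult_left_mono) auto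
      then show ?case using elim by (simp add: g_def)
    qed
  qed
  then have sg: "summable g" using sK by (rule summable_comparison_test_ev)
  then have sg': "summable (\<lambda>n. g (Suc n))" by (subst summable_Suc_iff)
  define C where "C = (\<Sum>n. g (Suc n))"
  have C0: "0 \<le> C" unfolding C_def by (intro suminf_nonneg sg' g0)
  have bd: "\<forall>\<^sub>F \<epsilon> in at_left e0. ennreal (delta \<epsilon> powr (a + 1)) * (\<Sum>n. ennreal (series_term (Suc n) \<epsilon>))
      \<le> ennreal (delta \<epsilon> powr (a + 1) * C)"
    using N
  proof eventually_elim
    case (elim \<epsilon>)
    have "series_term n \<epsilon> \<le> g n" if "n \<ge> 1" for n
    proof (cases "n < N")
      case True
      then show ?thesis using series_term_le[of n \<epsilon>] by (simp add: g_def)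
    next
      case False
      then have "prob_term n \<epsilon> \<le> K * real n powr (- (r - 1) - \<gamma>)" using elim by (simp add: prob_term_def)
      also have "\<dots> \<le> \<bar>K\<bar> * real n powr (- (r - 1) - \<gamma>)" by (intro mult_right_mono) auto
      finally have "series_term n \<epsilon> \<le> real n powr (r - 2) * lg (real n) powr a * (\<bar>K\<bar> * real n powr (- (r - 1) - \<gamma>))"
        unfolding series_term_def by (intro mult_left_mono) auto
      also have "\<dots> = \<bar>K\<bar> * (real n powr (r - 2) * real n powr (- (r - 1) - \<gamma>) * lg (real n) powr a)"
        by simp
      also have "real n powr (r - 2) * real n powr (- (r - 1) - \<gamma>) = real n powr (- 1 - \<gamma>)"
        by (simp add: powr_add[symmetric])
      finally show ?thesis using False by (simp add: g_def)
    qed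
    then have "(\<Sum>n. ennreal (series_term (Suc n) \<epsilon>)) \<le> (\<Sum>n. ennreal (g (Suc n)))"
      by (intro suminf_le ennreal_leI) auto
    also have "\<dots> = ennreal C"
      unfolding C_def by (rule suminf_ennreal2[OF g0 sg'])
    finally have "ennreal (delta \<epsilon> powr (a + 1)) * (\<Sum>n. ennreal (series_term (Suc n) \<epsilon>)) \<le> ennreal (delta \<epsilon> powr (a + 1)) * ennreal C"
      by (intro mult_left_mono) auto
    then show ?case using C0 by (simp add: ennreal_mult)
  qed
  have "((\<lambda>\<epsilon>. delta \<epsilon> powr (a + 1) * C) \<longlongrightarrow> 0 * C) (at_left e0)"
    by (intro tendsto_intros delta_powr_tendsto_0)
  then have "((\<lambda>\<epsilon>. ennreal (delta \<epsilon> powr (a + 1) * C)) \<longlongrightarrow> ennreal 0) (at_left e0)"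
    by (intro tendsto_ennrealI) simp
  then have "ennreal (4 / pi * exp (2 * \<tau> * (r - 1) powr (3 / 2)) * Gamma (a + 1)) \<le> ennreal 0"
    by (rule tendsto_le[OF trivial_limit_at_left_real _ lim bd])
  then show False using limit_pos by (simp add: ennreal_eq_0_iff)
qed

text \<open>The terms are eventually at least \<open>1 / n\<close>, as
  \<open>n powr \<gamma>\<close> beats every power of the logarithm. So the series is infinite for
  all \<epsilon> near \<open>e0\<close>, which contradicts a finite limit.\<close>

lemma no_asymptotics_if_large:
  assumes g: "0 < \<gamma>" and large: "\<forall>\<^sub>F p in G. real (fst p) powr (- (r - 1) + \<gamma>) \<le> pstay (radius p) (fst p)"
  shows "\<not> precise_asymptotics M X \<sigma> r a \<tau> b"
proof
  assume "precise_asymptotics M X \<sigma> r a \<tau> b"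
  then have lim: "((\<lambda>\<epsilon>. ennreal (delta \<epsilon> powr (a + 1)) * (\<Sum>n. ennreal (series_term (Suc n) \<epsilon>)))
      \<longlongrightarrow> ennreal (4 / pi * exp (2 * \<tau> * (r - 1) powr (3 / 2)) * Gamma (a + 1))) (at_left e0)"
    by (simp only: precise_asymptotics_iff)
  obtain N where N: "\<forall>\<^sub>F \<epsilon> in at_left e0. \<forall>n\<ge>N. real n powr (- (r - 1) + \<gamma>) \<le> pstay (radius (n, \<epsilon>)) n"
    using eventually_G_uniform[of "\<lambda>n \<epsilon>. real n powr (- (r - 1) + \<gamma>) \<le> pstay (radius (n, \<epsilon>)) n"] large by auto
  have "filterlim (\<lambda>x :: real. x powr \<gamma> * ln x powr a) at_top at_top"
    using g by real_asymp
  then have "filterlim (\<lambda>n. real n powr \<gamma> * ln (real n) powr a) at_top sequentially"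
    using filterlim_real_sequentially by (rule filterlim_compose)
  then have "\<forall>\<^sub>F n in sequentially. 1 \<le> real n powr \<gamma> * ln (real n) powr a"
    by (simp add: filterlim_at_top)
  then obtain N' where N': "\<And>n. n \<ge> N' \<Longrightarrow> 1 \<le> real n powr \<gamma> * ln (real n) powr a"
    by (auto simp: eventually_sequentially)
  have inf: "\<forall>\<^sub>F \<epsilon> in at_left e0. ennreal (delta \<epsilon> powr (a + 1)) * (\<Sum>n. ennreal (series_term (Suc n) \<epsilon>)) = \<top>"
    using N eventually_left_range
  proof eventually_elim
    case (elim \<epsilon>)
    have "(\<Sum>n. ennreal (series_term (Suc n) \<epsilon>)) = \<top>"
    proof (rule ccontr)
      assume "(\<Sum>n. ennreal (series_term (Suc n) \<epsilon>)) \<noteq> \<top>"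
      then have "summable (\<lambda>n. series_term (Suc n) \<epsilon>)"
        by (intro summable_suminf_not_top series_term_nonneg)
      then have s: "summable (\<lambda>n. series_term n \<epsilon>)" by (subst (asm) summable_Suc_iff)
      have "\<forall>\<^sub>F n in sequentially. norm (inverse (real n)) \<le> series_term n \<epsilon>"
        using eventually_ge_at_top[of N] eventually_ge_at_top[of N'] eventually_ge_at_top[of 3]
      proof eventually_elim
        case (elim n)
        have "real n powr (- (r - 1) + \<gamma>) \<le> prob_term n \<epsilon>"
          using \<open>\<forall>n\<ge>N. _\<close> elim by (simp add: prob_term_def)
        then have "real n powr (r - 2) * lg (real n) powr a * real n powr (- (r - 1) + \<gamma>) \<le> series_term n \<epsilon>"
          unfolding series_term_def by (intro mult_left_mono) auto
        moreover have "real n powr (r - 2) * lg (real n) powr a * real n powr (- (r - 1) + \<gamma>)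
          = real n powr (- 1) * (real n powr \<gamma> * ln (real n) powr a)"
        proof -
          have "real n powr (r - 2) * real n powr (- (r - 1) + \<gamma>) = real n powr (- 1) * real n powr \<gamma>"
            unfolding powr_add[symmetric] by (rule arg_cong[where f="\<lambda>z. real n powr z"]) simp
          then show ?thesis using elim by (simp add: lg_eq_ln mult_ac)
        qed
        moreover have "real n powr (- 1) * 1 \<le> real n powr (- 1) * (real n powr \<gamma> * ln (real n) powr a)"
          using N'[of n] elim by (intro mult_left_mono) auto
        ultimately have "real n powr (- 1) * 1 \<le> series_term n \<epsilon>" by linarith
        then show ?case using elim by (simp add: powr_minus)
      qed
      then have "summable (\<lambda>n. inverse (real n))" using s by (rule summable_comparison_test_ev)
      then show False using not_summable_harmonic[where 'a=real] by simp
    qed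
    moreover have "0 < delta \<epsilon>" using elim by (intro delta_pos) auto
    ultimately show ?case by (simp add: ennreal_mult_top)
  qed
  have "((\<lambda>\<epsilon>. \<top> :: ennreal) \<longlongrightarrow> ennreal (4 / pi * exp (2 * \<tau> * (r - 1) powr (3 / 2)) * Gamma (a + 1))) (at_left e0)"
    using lim inf by (rule Lim_transform_eventually)
  then have "\<top> = ennreal (4 / pi * exp (2 * \<tau> * (r - 1) powr (3 / 2)) * Gamma (a + 1))"
    using tendsto_unique[OF trivial_limit_at_left_real tendsto_const] by blast
  then show False by simp
qed

section \<open>Contraction over blocks\<close>

definition block :: "real \<Rightarrow> nat \<times> real \<Rightarrow> nat" where
  "block A p = nat \<lfloor>real (fst p) / (A * ln (real (fst p)))\<rfloor>"

lemma block_ge: "0 < A \<Longrightarrow> \<forall>\<^sub>F p in G. real (fst p) / (2 * A * ln (real (fst p))) \<le> real (block A p)"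
proof -
  assume A: "0 < A"
  have "filterlim (\<lambda>x :: real. x / (2 * A * ln x)) at_top at_top" using A by real_asymp
  then have "\<forall>\<^sub>F x :: real in at_top. 1 \<le> x / (2 * A * ln x)" by (simp add: filterlim_at_top)
  then have "\<forall>\<^sub>F p in G. 1 \<le> real (fst p) / (2 * A * ln (real (fst p)))"
    using n_at_top by (rule eventually_compose_filterlim)
  then show ?thesis
  proof eventually_elim
    case (elim p)
    let ?z = "real (fst p) / (A * ln (real (fst p)))"
    have h: "real (fst p) / (2 * A * ln (real (fst p))) = ?z / 2" by simp
    have "?z - 1 \<le> real (block A p)"
      unfolding block_def using elim h by linarith
    then show ?case using elim unfolding h by linarith
  qed
qed

text \<open>About \<open>A * ln n\<close> blocks fit into \<open>n\<close> steps, and each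
  multiplies the probability by at most 3/4, which gives the power \<open>- A * ln (4 / 3)\<close>
  of \<open>n\<close>.\<close>

lemma no_asymptotics_if_blocks_contract:
  assumes "\<And>A. 0 < A \<Longrightarrow> \<forall>\<^sub>F p in G. \<forall>j. pstay (radius p) (j + block A p) \<le> 3 / 4 * pstay (radius p) j"
  shows "\<not> precise_asymptotics M X \<sigma> r a \<tau> b"
proof -
  \<comment> \<open>Makes that power equal to \<open>- r = - (r - 1) - 1\<close>. The constant 4/3
    below pays for rounding the number of blocks down.\<close>
  define A where "A = r / ln (4 / 3)"
  have l43: "0 < ln (4 / 3 :: real)" by simp
  have A: "0 < A" using r l43 by (simp add: A_def)
  show ?thesis
  proof (rule no_asymptotics_if_small[of 1 "4 / 3"])
    show "\<forall>\<^sub>F p in G. pstay (radius p) (fst p) \<le> 4 / 3 * real (fst p) powr (- (r - 1) - 1)"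
      using assms[OF A] n_ge[of 3]
    proof eventually_elim
      case (elim p)
      let ?n = "real (fst p)"
      have l0: "0 < ln ?n" using elim by simp
      define k where "k = nat \<lfloor>A * ln ?n\<rfloor>"
      have k: "real k \<le> A * ln ?n" "A * ln ?n - 1 \<le> real k"
        unfolding k_def using A l0 by (auto simp: of_nat_floor)
      have "real (k * block A p) \<le> (A * ln ?n) * (?n / (A * ln ?n))"
        unfolding of_nat_mult block_def using k(1) A l0 by (intro mult_mono) (auto simp: of_nat_floor)
      also have "\<dots> = ?n" using A l0 by simp
      finally have km: "k * block A p \<le> fst p" by (simp only: of_nat_le_iff)
      have iter: "pstay (radius p) (k * block A p) \<le> (3 / 4) ^ k" for k
      proof (induction k)
        case (Suc k)
        have "pstay (radius p) (Suc k * block A p) \<le> 3 / 4 * pstay (radius p) (k * block A p)"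
          using elim(1)[rule_format, of "k * block A p"] by (simp add: add.commute)
        then show ?case using Suc by simp
      qed simp
      have "pstay (radius p) (fst p) \<le> pstay (radius p) (k * block A p)"
        by (rule pstay_antimono[OF km])
      also have "\<dots> \<le> (3 / 4) powr real k" using iter[of k] by (simp add: powr_realpow)
      also have "\<dots> \<le> (3 / 4) powr (A * ln ?n - 1)" using k by (intro powr_mono') auto
      also have "\<dots> = 4 / 3 * (3 / 4) powr (A * ln ?n)" by (simp add: powr_diff)
      also have "(3 / 4) powr (A * ln ?n) = ?n powr (- (r - 1) - 1)"
      proof -
        have "ln (3 / 4 :: real) = - ln (4 / 3)" by (simp add: ln_div)
        then have "A * ln ?n * ln (3 / 4) = - r * ln ?n" using l43 by (simp add: A_def)
        then show ?thesis using elim by (simp add: powr_def)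
      qed
      finally show ?case .
    qed
  qed simp
qed

end

section \<open>Characteristic functions and lower bounds for the converse\<close>

lemma one_minus_cos_ge: "\<bar>u\<bar> \<le> 1 \<Longrightarrow> u\<^sup>2 / 8 \<le> 1 - cos u" for u :: real
proof -
  assume u: "\<bar>u\<bar> \<le> 1"
  have "\<bar>u\<bar> / 4 \<le> sin (\<bar>u\<bar> / 2)" using sin_ge_half[of "\<bar>u\<bar> / 2"] u by simp
  then have "(\<bar>u\<bar> / 4)\<^sup>2 \<le> (sin (\<bar>u\<bar> / 2))\<^sup>2" by (intro power_mono) auto
  moreover have "cos u = 1 - 2 * (sin (\<bar>u\<bar> / 2))\<^sup>2" using cos_double_sin[of "\<bar>u\<bar> / 2"] by (cases "u \<ge> 0") auto
  ultimately show ?thesis by (simp add: power_divide)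
qed

lemma square_le_bound: "\<bar>v\<bar> \<le> B \<Longrightarrow> v\<^sup>2 \<le> B\<^sup>2" for v B :: real
  using abs_le_square_iff[of v B] by simp

context iid_walk
begin

text \<open>Symmetrisation: a spread-out law lowers the right-hand side whether or not a mean
  exists. Independence of \<open>X 1\<close> and \<open>X 2\<close> is drawn from
  \<open>expectation_stay_mult\<close> with \<open>j = 0\<close>, where \<open>stay 0 0\<close> is
  the whole space.\<close>

lemma norm_psi_squared: "(norm (psi t))\<^sup>2 = expectation (\<lambda>\<omega>. cos (t * (X 1 \<omega> - X 2 \<omega>)))"
proof -
  have S1: "partial_sum X (Suc 0) \<omega> = X (Suc 0) \<omega>" for \<omega> by (simp add: partial_sum_def)
  have p1: "expectation (\<lambda>\<omega>. iexp (t * X (Suc 0) \<omega>)) = psi t"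
    unfolding psi_def by (rule expectation_ident) simp
  have "expectation (\<lambda>\<omega>. of_real (indicator (stay 0 0) \<omega>) * iexp (t * partial_sum X (Suc 0) \<omega>) * iexp (- t * X (Suc (Suc 0)) \<omega>))
    = expectation (\<lambda>\<omega>. of_real (indicator (stay 0 0) \<omega>) * iexp (t * partial_sum X (Suc 0) \<omega>)) * expectation (\<lambda>\<omega>. iexp (- t * X 0 \<omega>))"
    by (rule expectation_stay_mult[where f="\<lambda>s. iexp (t * s)" and g="\<lambda>s. iexp (- t * s)" and K=1 and L=1])
       (auto simp: norm_exp_i_times)
  also have "expectation (\<lambda>\<omega>. of_real (indicator (stay 0 0) \<omega>) * iexp (t * partial_sum X (Suc 0) \<omega>)) = psi t"
    unfolding p1[symmetric] by (intro Bochner_Integration.integral_cong refl) (simp add: S1)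
  also have "expectation (\<lambda>\<omega>. iexp (- t * X 0 \<omega>)) = psi (- t)" by (simp add: psi_def)
  also have "expectation (\<lambda>\<omega>. of_real (indicator (stay 0 0) \<omega>) * iexp (t * partial_sum X (Suc 0) \<omega>) * iexp (- t * X (Suc (Suc 0)) \<omega>))
    = expectation (\<lambda>\<omega>. iexp (t * (X 1 \<omega> - X 2 \<omega>)))"
    by (intro Bochner_Integration.integral_cong refl)
       (simp add: S1 exp_add[symmetric] algebra_simps numeral_2_eq_2)
  finally have e: "expectation (\<lambda>\<omega>. iexp (t * (X 1 \<omega> - X 2 \<omega>))) = psi t * cnj (psi t)"
    by (simp add: psi_minus)
  have i: "integrable M (\<lambda>\<omega>. iexp (t * (X 1 \<omega> - X 2 \<omega>)))"
    by (intro integrable_const_bound[where B=1]) (auto simp: norm_exp_i_times)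
  have "expectation (\<lambda>\<omega>. cos (t * (X 1 \<omega> - X 2 \<omega>))) = Re (expectation (\<lambda>\<omega>. iexp (t * (X 1 \<omega> - X 2 \<omega>))))"
    by (subst integral_Re[symmetric, OF i]) (simp add: Re_exp)
  also have "\<dots> = (norm (psi t))\<^sup>2" unfolding e by (simp add: complex_mult_cnj cmod_power2)
  finally show ?thesis ..
qed

text \<open>In the symmetrised form \<open>1 - cos\<close> is nonnegative, so part of the space
  suffices: \<open>\<bar>X 2\<bar> \<le> b\<close>, which has probability above 1/2, and
  \<open>\<bar>X 1\<bar> \<le> B\<close> with a large truncated second moment. There, for small
  \<open>t\<close>, the argument is at most 1 and \<open>1 - cos u \<ge> u\<^sup>2 / 8\<close>,
  while \<open>(x - y)\<^sup>2 \<ge> x\<^sup>2 / 2 - y\<^sup>2\<close>.\<close>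

lemma psi_infinite_variance:
  assumes inf: "\<not> integrable M (\<lambda>\<omega>. (X 0 \<omega>)\<^sup>2)" and Q: "0 < Q"
  shows "\<forall>\<^sub>F t in at_right 0. (norm (psi t))\<^sup>2 \<le> 1 - Q * t\<^sup>2"
proof -
  have "((\<lambda>b. expectation (\<lambda>\<omega>. indicator {v. \<bar>v\<bar> \<le> b} (X 0 \<omega>))) \<longlongrightarrow> expectation (\<lambda>\<omega>. 1 :: real)) at_top"
  proof (rule integral_dominated_convergence_at_top)
    show "AE \<omega> in M. ((\<lambda>b. indicator {v. \<bar>v\<bar> \<le> b} (X 0 \<omega>)) \<longlongrightarrow> (1 :: real)) at_top"
    proof (rule AE_I2, rule tendsto_eventually)
      fix \<omega> show "\<forall>\<^sub>F b in at_top. indicator {v. \<bar>v\<bar> \<le> b} (X 0 \<omega>) = (1 :: real)"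
        using eventually_ge_at_top[of "\<bar>X 0 \<omega>\<bar>"] by eventually_elim auto
    qed
    show "\<forall>\<^sub>F b in at_top. AE \<omega> in M. norm (indicator {v. \<bar>v\<bar> \<le> b} (X 0 \<omega>) :: real) \<le> (\<lambda>_. 1) \<omega>"
      by (auto simp: indicator_def)
  qed auto
  then have "((\<lambda>b. expectation (\<lambda>\<omega>. indicator {v. \<bar>v\<bar> \<le> b} (X 0 \<omega>)) :: real) \<longlongrightarrow> 1) at_top"
    by (simp add: prob_space)
  then have "\<forall>\<^sub>F b in at_top. 1 / 2 < expectation (\<lambda>\<omega>. indicator {v. \<bar>v\<bar> \<le> b} (X 0 \<omega>) :: real)"
    by (rule order_tendstoD(1)) simp
  then obtain N where N: "\<And>b. b \<ge> N \<Longrightarrow> 1 / 2 < expectation (\<lambda>\<omega>. indicator {v. \<bar>v\<bar> \<le> b} (X 0 \<omega>) :: real)"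
    unfolding eventually_at_top_linorder by blast
  define b where "b = max N 0"
  have b: "0 \<le> b" "1 / 2 < expectation (\<lambda>\<omega>. indicator {v. \<bar>v\<bar> \<le> b} (X 0 \<omega>) :: real)"
    using N[of b] by (auto simp: b_def)
  define T where "T B = expectation (\<lambda>\<omega>. indicator {v. \<bar>v\<bar> \<le> B} (X 0 \<omega>) * (X 0 \<omega>)\<^sup>2)" for B :: real
  have iT: "integrable M (\<lambda>\<omega>. indicator {v. \<bar>v\<bar> \<le> B} (X 0 \<omega>) * (X 0 \<omega>)\<^sup>2)" for B :: real
  proof (rule integrable_const_bound[where B="B\<^sup>2"], rule AE_I2)
    fix \<omega>
    have "(X 0 \<omega>)\<^sup>2 \<le> B\<^sup>2" if "\<bar>X 0 \<omega>\<bar> \<le> B" using that by (rule square_le_bound)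
    then show "norm (indicator {v. \<bar>v\<bar> \<le> B} (X 0 \<omega>) * (X 0 \<omega>)\<^sup>2) \<le> B\<^sup>2" by (simp add: indicator_def)
  qed measurable
  have T_mono: "T B \<le> T B'" if "B \<le> B'" for B B'
    unfolding T_def by (intro integral_mono iT) (use that in \<open>auto simp: indicator_def\<close>)
  \<comment> \<open>\<open>T B \<ge> c\<close> makes
    \<open>t\<^sup>2 / 8 * (T B / 2 - b\<^sup>2)\<close> at least \<open>2 * Q * t\<^sup>2\<close>;
    at most half of this is lost to the restriction on \<open>X 2\<close>.\<close>
  define c where "c = 2 * (16 * Q + b\<^sup>2)"
  \<comment> \<open>Otherwise the truncated second moments are bounded, and monotone convergence
    would make \<open>X 0\<close> square integrable.\<close>
  have "\<exists>B\<ge>0. c \<le> T B"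
  proof (rule ccontr)
    assume "\<not> (\<exists>B\<ge>0. c \<le> T B)"
    then have bd: "T (real n) \<le> c" for n by (meson of_nat_0_le_iff linear)
    have "convergent (\<lambda>n. T (real n))"
      by (rule Bseq_mono_convergent[OF BseqI'[of _ "c"]])
         (use bd T_mono in \<open>auto simp: T_def intro!: integral_nonneg_AE\<close>)
    then obtain z where z: "(\<lambda>n. T (real n)) \<longlonglongrightarrow> z" by (auto simp: convergent_def)
    have "integrable M (\<lambda>\<omega>. (X 0 \<omega>)\<^sup>2)"
    proof (rule integrable_monotone_convergence[OF iT])
      show "AE \<omega> in M. mono (\<lambda>n. indicator {v. \<bar>v\<bar> \<le> real n} (X 0 \<omega>) * (X 0 \<omega>)\<^sup>2)"
        by (auto simp: mono_def indicator_def)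
      show "AE \<omega> in M. (\<lambda>n. indicator {v. \<bar>v\<bar> \<le> real n} (X 0 \<omega>) * (X 0 \<omega>)\<^sup>2) \<longlonglongrightarrow> (X 0 \<omega>)\<^sup>2"
      proof (rule AE_I2, rule tendsto_eventually)
        fix \<omega>
        have "\<forall>\<^sub>F n in sequentially. \<bar>X 0 \<omega>\<bar> \<le> real n"
          using filterlim_real_sequentially by (simp add: filterlim_at_top)
        then show "\<forall>\<^sub>F n in sequentially. indicator {v. \<bar>v\<bar> \<le> real n} (X 0 \<omega>) * (X 0 \<omega>)\<^sup>2 = (X 0 \<omega>)\<^sup>2"
          by eventually_elim auto
      qed
      show "(\<lambda>n. expectation (\<lambda>\<omega>. indicator {v. \<bar>v\<bar> \<le> real n} (X 0 \<omega>) * (X 0 \<omega>)\<^sup>2)) \<longlonglongrightarrow> z"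
        using z by (simp add: T_def)
    qed auto
    then show False using inf by simp
  qed
  then obtain B where B: "0 \<le> B" "c \<le> T B" by blast
  have "\<forall>\<^sub>F t in at_right 0. t < 1 / (B + b + 1)"
    using b B by (intro eventually_at_right_real[THEN eventually_mono]) auto
  moreover have "\<forall>\<^sub>F t :: real in at_right 0. 0 < t" by (rule eventually_at_right_less)
  ultimately show ?thesis
  proof eventually_elim
    case (elim t)
    have small: "t * (B + b) \<le> 1"
    proof -
      have "t * (B + b + 1) < 1" using elim b B by (simp add: field_simps)
      then show ?thesis using elim by (simp add: algebra_simps)
    qed
    define f where "f v = t\<^sup>2 / 8 * ((v\<^sup>2 / 2 - b\<^sup>2) * indicator {v. \<bar>v\<bar> \<le> B} v)" for v :: real
    define g where "g v = indicat_real {v. \<bar>v\<bar> \<le> b} v" for v :: real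
    have [measurable]: "f \<in> borel_measurable borel" "g \<in> borel_measurable borel"
      unfolding f_def g_def by measurable
    have fb: "norm (f v) \<le> t\<^sup>2 / 8 * (B\<^sup>2 + b\<^sup>2)" for v
    proof (cases "\<bar>v\<bar> \<le> B")
      case True
      then have "v\<^sup>2 \<le> B\<^sup>2" by (rule square_le_bound)
      then have "\<bar>v\<^sup>2 / 2 - b\<^sup>2\<bar> \<le> B\<^sup>2 + b\<^sup>2" using zero_le_power2[of v] zero_le_power2[of b] by linarith
      then show ?thesis using True by (simp add: f_def abs_mult mult_left_mono)
    qed (simp add: f_def)
    have S1: "partial_sum X (Suc 0) \<omega> = X (Suc 0) \<omega>" for \<omega> by (simp add: partial_sum_def)
    have "expectation (\<lambda>\<omega>. of_real (indicator (stay 0 0) \<omega>) * f (partial_sum X (Suc 0) \<omega>) * g (X (Suc (Suc 0)) \<omega>))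
      = expectation (\<lambda>\<omega>. of_real (indicator (stay 0 0) \<omega>) * f (partial_sum X (Suc 0) \<omega>)) * expectation (\<lambda>\<omega>. g (X 0 \<omega>))"
      by (rule expectation_stay_mult[where K="t\<^sup>2 / 8 * (B\<^sup>2 + b\<^sup>2)" and L=1]) (use fb in \<open>auto simp: g_def indicator_def\<close>)
    also have "expectation (\<lambda>\<omega>. of_real (indicator (stay 0 0) \<omega>) * f (partial_sum X (Suc 0) \<omega>)) = expectation (\<lambda>\<omega>. f (X (Suc 0) \<omega>))"
      by (intro Bochner_Integration.integral_cong refl) (simp add: S1)
    also have "\<dots> = expectation (\<lambda>\<omega>. f (X 0 \<omega>))" by (rule expectation_ident) simp
    also have "expectation (\<lambda>\<omega>. of_real (indicator (stay 0 0) \<omega>) * f (partial_sum X (Suc 0) \<omega>) * g (X (Suc (Suc 0)) \<omega>))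
      = expectation (\<lambda>\<omega>. f (X 1 \<omega>) * g (X 2 \<omega>))"
      by (intro Bochner_Integration.integral_cong refl) (simp add: S1 numeral_2_eq_2)
    finally have fg: "expectation (\<lambda>\<omega>. f (X 1 \<omega>) * g (X 2 \<omega>)) = expectation (\<lambda>\<omega>. f (X 0 \<omega>)) * expectation (\<lambda>\<omega>. g (X 0 \<omega>))" .
    have Ef: "2 * Q * t\<^sup>2 \<le> expectation (\<lambda>\<omega>. f (X 0 \<omega>))"
    proof -
      have "expectation (\<lambda>\<omega>. t\<^sup>2 / 8 * (1 / 2 * (indicator {v. \<bar>v\<bar> \<le> B} (X 0 \<omega>) * (X 0 \<omega>)\<^sup>2) - b\<^sup>2)) \<le> expectation (\<lambda>\<omega>. f (X 0 \<omega>))"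
      proof (rule integral_mono)
        show "integrable M (\<lambda>\<omega>. f (X 0 \<omega>))"
          using fb by (intro integrable_const_bound[where B="t\<^sup>2 / 8 * (B\<^sup>2 + b\<^sup>2)"]) auto
        fix \<omega>
        show "t\<^sup>2 / 8 * (1 / 2 * (indicator {v. \<bar>v\<bar> \<le> B} (X 0 \<omega>) * (X 0 \<omega>)\<^sup>2) - b\<^sup>2) \<le> f (X 0 \<omega>)"
          unfolding f_def by (intro mult_left_mono) (auto simp: indicator_def)
      qed (use iT in auto)
      also have "expectation (\<lambda>\<omega>. t\<^sup>2 / 8 * (1 / 2 * (indicator {v. \<bar>v\<bar> \<le> B} (X 0 \<omega>) * (X 0 \<omega>)\<^sup>2) - b\<^sup>2)) = t\<^sup>2 / 8 * (T B / 2 - b\<^sup>2)"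
        using iT by (simp add: T_def prob_space)
      finally have 1: "t\<^sup>2 / 8 * (T B / 2 - b\<^sup>2) \<le> expectation (\<lambda>\<omega>. f (X 0 \<omega>))" .
      have "t\<^sup>2 / 8 * (16 * Q) \<le> t\<^sup>2 / 8 * (T B / 2 - b\<^sup>2)"
        using B(2) by (intro mult_left_mono) (auto simp: c_def)
      then show ?thesis using 1 by simp
    qed
    have "Q * t\<^sup>2 \<le> 2 * Q * t\<^sup>2 * (1 / 2)" by simp
    also have "\<dots> \<le> expectation (\<lambda>\<omega>. f (X 0 \<omega>)) * expectation (\<lambda>\<omega>. g (X 0 \<omega>))"
    proof (rule mult_mono[OF Ef])
      show "1 / 2 \<le> expectation (\<lambda>\<omega>. g (X 0 \<omega>))" using b unfolding g_def by simp
      show "0 \<le> expectation (\<lambda>\<omega>. f (X 0 \<omega>))" using Ef Q by (meson order_trans zero_le_mult_iff zero_le_power2 less_imp_le zero_le_numeral)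
    qed simp
    also have "\<dots> \<le> expectation (\<lambda>\<omega>. 1 - cos (t * (X 1 \<omega> - X 2 \<omega>)))"
      unfolding fg[symmetric]
    proof (rule integral_mono)
      show "integrable M (\<lambda>\<omega>. f (X 1 \<omega>) * g (X 2 \<omega>))"
      proof (intro integrable_const_bound[where B="t\<^sup>2 / 8 * (B\<^sup>2 + b\<^sup>2)"] AE_I2)
        fix \<omega>
        have "norm (f (X 1 \<omega>) * g (X 2 \<omega>)) \<le> t\<^sup>2 / 8 * (B\<^sup>2 + b\<^sup>2) * 1"
          unfolding norm_mult by (intro mult_mono fb) (auto simp: g_def indicator_def)
        then show "norm (f (X 1 \<omega>) * g (X 2 \<omega>)) \<le> t\<^sup>2 / 8 * (B\<^sup>2 + b\<^sup>2)" by simp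
      qed measurable
      show "integrable M (\<lambda>\<omega>. 1 - cos (t * (X 1 \<omega> - X 2 \<omega>)))"
        by (intro Bochner_Integration.integrable_diff integrable_const integrable_const_bound[where B=1]) auto
      fix \<omega>
      let ?x = "X 1 \<omega>" and ?y = "X 2 \<omega>"
      show "f ?x * g ?y \<le> 1 - cos (t * (?x - ?y))"
      proof (cases "\<bar>?x\<bar> \<le> B \<and> \<bar>?y\<bar> \<le> b")
        case True
        have "t * \<bar>?x - ?y\<bar> \<le> t * (B + b)" using True elim by (intro mult_left_mono) auto
        then have "t * \<bar>?x - ?y\<bar> \<le> 1" using small by (rule order_trans)
        then have "\<bar>t * (?x - ?y)\<bar> \<le> 1" using elim by (simp add: abs_mult)
        then have "(t * (?x - ?y))\<^sup>2 / 8 \<le> 1 - cos (t * (?x - ?y))" by (rule one_minus_cos_ge)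
        moreover have "?x\<^sup>2 / 2 - b\<^sup>2 \<le> (?x - ?y)\<^sup>2"
        proof -
          have "?y\<^sup>2 \<le> b\<^sup>2" using True by (intro square_le_bound) auto
          moreover have "0 \<le> (?x - 2 * ?y)\<^sup>2" by simp
          ultimately show ?thesis by (simp add: power2_eq_square algebra_simps)
        qed
        then have "t\<^sup>2 / 8 * (?x\<^sup>2 / 2 - b\<^sup>2) \<le> t\<^sup>2 / 8 * (?x - ?y)\<^sup>2" by (intro mult_left_mono) auto
        ultimately show ?thesis using True by (simp add: f_def g_def power_mult_distrib)
      qed (auto simp: f_def g_def)
    qed
    also have "\<dots> = 1 - (norm (psi t))\<^sup>2"
      unfolding norm_psi_squared
      by (subst Bochner_Integration.integral_diff) (auto simp: prob_space intro!: integrable_const_bound[where B=1])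
    finally show ?case by simp
  qed
qed

text \<open>Around its mean the variable has characteristic function
  \<open>1 + O(t\<^sup>2)\<close>. The mean itself only contributes a rotation of modulus 1, which
  is factored out before the power is taken.\<close>

lemma centered_char_bound:
  assumes i1: "integrable M (X 0)" and i2: "integrable M (\<lambda>\<omega>. (X 0 \<omega>)\<^sup>2)"
  defines "\<mu> \<equiv> expectation (X 0)"
  obtains C where "0 \<le> C" "\<And>t m. norm (psi t ^ m - iexp (real m * (\<mu> * t))) \<le> real m * (C * t\<^sup>2)"
proof -
  define C where "C = expectation (\<lambda>\<omega>. (X 0 \<omega> - \<mu>)\<^sup>2) / 2"
  have C0: "0 \<le> C" unfolding C_def by (simp add: integral_nonneg_AE)
  have sq: "integrable M (\<lambda>\<omega>. (X 0 \<omega> - \<mu>)\<^sup>2)"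
    using i1 i2 by (simp add: power2_diff)
  have i: "integrable M (\<lambda>\<omega>. iexp (t * (X 0 \<omega> - \<mu>)))" for t
    by (intro integrable_const_bound[where B=1]) (auto simp: norm_exp_i_times)
  have b1: "norm (expectation (\<lambda>\<omega>. iexp (t * (X 0 \<omega> - \<mu>))) - 1) \<le> C * t\<^sup>2" for t
  proof -
    have z: "expectation (\<lambda>\<omega>. \<i> * of_real (t * (X 0 \<omega> - \<mu>))) = 0"
    proof -
      have "expectation (\<lambda>\<omega>. t * (X 0 \<omega> - \<mu>)) = 0" using i1 by (simp add: \<mu>_def prob_space)
      then show ?thesis by (simp only: integral_mult_right_zero integral_complex_of_real) simp
    qed
    have il: "integrable M (\<lambda>\<omega>. \<i> * complex_of_real (t * (X 0 \<omega> - \<mu>)))"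
      using i1 by (intro integrable_mult_right integrable_of_real) auto
    have "expectation (\<lambda>\<omega>. iexp (t * (X 0 \<omega> - \<mu>))) - 1
       = expectation (\<lambda>\<omega>. iexp (t * (X 0 \<omega> - \<mu>)) - (1 + \<i> * of_real (t * (X 0 \<omega> - \<mu>))))"
      using i[of t] il z by (simp add: prob_space)
    also have "norm \<dots> \<le> expectation (\<lambda>\<omega>. norm (iexp (t * (X 0 \<omega> - \<mu>)) - (1 + \<i> * of_real (t * (X 0 \<omega> - \<mu>)))))"
      by (rule integral_norm_bound)
    also have "\<dots> \<le> expectation (\<lambda>\<omega>. t\<^sup>2 / 2 * (X 0 \<omega> - \<mu>)\<^sup>2)"
    proof (rule integral_mono)
      show "integrable M (\<lambda>\<omega>. norm (iexp (t * (X 0 \<omega> - \<mu>)) - (1 + \<i> * of_real (t * (X 0 \<omega> - \<mu>)))))"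
        by (intro integrable_norm Bochner_Integration.integrable_diff Bochner_Integration.integrable_add i il integrable_const)
      fix \<omega>
      show "norm (iexp (t * (X 0 \<omega> - \<mu>)) - (1 + \<i> * of_real (t * (X 0 \<omega> - \<mu>)))) \<le> t\<^sup>2 / 2 * (X 0 \<omega> - \<mu>)\<^sup>2"
        using iexp_approx1[of "t * (X 0 \<omega> - \<mu>)" 1] by (simp add: power_mult_distrib numeral_2_eq_2[symmetric] del: power_Suc)
    qed (use sq in auto)
    also have "\<dots> = C * t\<^sup>2" by (simp add: C_def)
    finally show ?thesis .
  qed
  have b2: "norm (expectation (\<lambda>\<omega>. iexp (t * (X 0 \<omega> - \<mu>)))) \<le> 1" for t
    by (rule order_trans[OF integral_norm_bound]) (simp add: norm_exp_i_times prob_space)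
  have fac: "psi t = iexp (\<mu> * t) * expectation (\<lambda>\<omega>. iexp (t * (X 0 \<omega> - \<mu>)))" for t
    unfolding psi_def integral_mult_right_zero[symmetric]
    by (intro Bochner_Integration.integral_cong refl) (simp add: exp_add[symmetric] algebra_simps)
  show ?thesis
  proof (rule that[OF C0])
    fix t and m :: nat
    let ?c = "expectation (\<lambda>\<omega>. iexp (t * (X 0 \<omega> - \<mu>)))"
    have e: "iexp (real m * (\<mu> * t)) = iexp (\<mu> * t) ^ m"
      by (simp add: exp_of_nat_mult[symmetric] algebra_simps)
    have "psi t ^ m - iexp (real m * (\<mu> * t)) = iexp (\<mu> * t) ^ m * (?c ^ m - 1 ^ m)"
      unfolding e fac by (simp add: power_mult_distrib algebra_simps)
    also have "norm \<dots> = norm (?c ^ m - 1 ^ m)" by (simp add: norm_mult norm_power norm_exp_i_times)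
    also have "\<dots> \<le> real m * norm (?c - 1)" by (intro norm_power_diff b2) auto
    also have "\<dots> \<le> real m * (C * t\<^sup>2)" by (intro mult_left_mono b1) auto
    finally show "norm (psi t ^ m - iexp (real m * (\<mu> * t))) \<le> real m * (C * t\<^sup>2)" .
  qed
qed

text \<open>On the event the phase is at most \<open>\<bar>t\<bar> * x\<close> in absolute value, so
  the exponential is within that distance of 1.\<close>

lemma stay_char_close:
  assumes "0 \<le> x" shows "norm (stay_char x j t j - of_real (pstay x j)) \<le> \<bar>t\<bar> * x * pstay x j"
proof -
  have "stay_char x j t j - of_real (pstay x j)
     = expectation (\<lambda>\<omega>. of_real (indicator (stay x j) \<omega>) * iexp (t * partial_sum X j \<omega>) - of_real (indicator (stay x j) \<omega>))"
    unfolding stay_char_def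
  proof (subst Bochner_Integration.integral_diff[OF integrable_stay_iexp])
    show "integrable M (\<lambda>\<omega>. complex_of_real (indicator (stay x j) \<omega>))"
      by (intro integrable_of_real integrable_const_bound[where B=1]) (auto simp: indicator_def)
    have "expectation (\<lambda>\<omega>. complex_of_real (indicator (stay x j) \<omega>)) = of_real (pstay x j)"
      unfolding integral_complex_of_real by simp
    then show "expectation (\<lambda>\<omega>. of_real (indicator (stay x j) \<omega>) * iexp (t * partial_sum X j \<omega>)) - of_real (pstay x j)
      = expectation (\<lambda>\<omega>. of_real (indicator (stay x j) \<omega>) * iexp (t * partial_sum X j \<omega>))
        - expectation (\<lambda>\<omega>. complex_of_real (indicator (stay x j) \<omega>))" by (simp only:)
  qed
  also have "norm \<dots> \<le> expectation (\<lambda>\<omega>. norm (of_real (indicator (stay x j) \<omega>) * iexp (t * partial_sum X j \<omega>) - of_real (indicator (stay x j) \<omega>) :: complex))"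
    by (rule integral_norm_bound)
  also have "\<dots> \<le> expectation (\<lambda>\<omega>. \<bar>t\<bar> * x * indicator (stay x j) \<omega>)"
  proof (rule integral_mono)
    show "integrable M (\<lambda>\<omega>. norm (of_real (indicator (stay x j) \<omega>) * iexp (t * partial_sum X j \<omega>) - of_real (indicator (stay x j) \<omega>) :: complex))"
      by (intro integrable_norm Bochner_Integration.integrable_diff integrable_stay_iexp integrable_const_bound[where B=1])
         (auto simp: indicator_def)
    fix \<omega>
    show "norm (of_real (indicator (stay x j) \<omega>) * iexp (t * partial_sum X j \<omega>) - of_real (indicator (stay x j) \<omega>) :: complex)
       \<le> \<bar>t\<bar> * x * indicator (stay x j) \<omega>"
    proof (cases "\<omega> \<in> stay x j")
      case True
      have "norm (iexp (t * partial_sum X j \<omega>) - 1) \<le> \<bar>t * partial_sum X j \<omega>\<bar>"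
        using iexp_approx1[of "t * partial_sum X j \<omega>" 0] by simp
      also have "\<dots> \<le> \<bar>t\<bar> * x" unfolding abs_mult using stay_bound[OF True assms] by (intro mult_left_mono) auto
      finally show ?thesis using True by simp
    qed simp
  next
    show "integrable M (\<lambda>\<omega>. \<bar>t\<bar> * x * indicator (stay x j) \<omega>)"
      by (intro integrable_mult_right integrable_const_bound[where B=1]) (auto simp: indicator_def)
  qed
  finally show ?thesis by simp
qed

text \<open>The errors are proportional to the probability of staying, and hence are not dominated by \<open>cos (t s)\<close> near the
  ends of the interval. Adding \<open>d * cos (2 * t * s)\<close>, which is negative there and has a smaller eigenvalue, leaves a
  surplus that absorbs them.\<close>

lemma lower_step:
  fixes x t d v :: real
  defines "t \<equiv> pi / (2 * x)"
  defines "f \<equiv> \<lambda>s. cos (t * s) + d * cos (2 * t * s)"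
  assumes x: "0 < x" and d: "0 < d" "d \<le> 1 / 10" and v: "0 \<le> v"
    and gap: "v * t\<^sup>2 \<le> cosm t - cosm (2 * t)" "cosm t - cosm (2 * t) \<le> 2 * v * t\<^sup>2"
    and err: "\<bar>sinm t\<bar> + \<bar>sinm (2 * t)\<bar> + 2 * prob {\<omega> \<in> space M. \<bar>X 0 \<omega>\<bar> > 2 * x} \<le> d * v / 4 * t\<^sup>2"
  shows "(cosm t - 5 * d * v * t\<^sup>2) * ev x j f j \<le> ev x (Suc j) f (Suc j)"
proof -
  define w where "w = v * t\<^sup>2"
  \<comment> \<open>The part of the eigenvalue given up. Where the first cosine exceeds 1/2,
    \<open>h / 2 = 5 / 2 * d * w\<close> has to beat \<open>2 * d * w\<close> from the second
    harmonic plus \<open>d * w / 4\<close> from the errors.\<close>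
  define h where "h = 5 * d * w"
  define k where "k = cosm t - cosm (2 * t)"
  define P where "P = prob {\<omega> \<in> space M. \<bar>X 0 \<omega>\<bar> > 2 * x}"
  define A1 where "A1 = ev x j (\<lambda>s. cos (t * s)) j"
  define A2 where "A2 = ev x j (\<lambda>s. cos (2 * t * s)) j"
  define p where "p = pstay x j"
  have w0: "0 \<le> w" using v by (simp add: w_def)
  have h: "0 \<le> h" "h \<le> w / 2"
    using d w0 mult_right_mono[of d "1/10" w] by (auto simp: h_def)
  have k: "w \<le> k" "k \<le> 2 * w" using gap by (auto simp: w_def k_def)
  have [measurable]: "f \<in> borel_measurable borel" unfolding f_def by measurable
  have dc: "\<bar>d * cos u\<bar> \<le> 1 / 10" for u
    using d mult_mono[OF d(2) abs_cos_le_one[of u]] by (simp add: abs_mult)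
  have fb: "\<bar>f s\<bar> \<le> 2" for s
    unfolding f_def using dc[of "2 * t * s"] abs_cos_le_one[of "t * s"] by linarith
  have split: "ev x j f l = ev x j (\<lambda>s. cos (t * s)) l + d * ev x j (\<lambda>s. cos (2 * t * s)) l" for l
    unfolding f_def using dc
    by (subst ev_add[where K=1 and L="1 / 10"]) (auto simp: ev_cmult)
  have "exit_ev x j f \<le> - exit_ev x j (\<lambda>_. 0) + max 2 0 * (pstay x j * prob {\<omega> \<in> space M. \<bar>X 0 \<omega>\<bar> > 2 * x})"
  proof (rule exit_ev_le[where K=2 and L=0])
    fix s u :: real assume s: "\<bar>s\<bar> \<le> x" and u: "x < \<bar>u\<bar>"
    show "f u \<le> - 0 + (if 2 * x < \<bar>u - s\<bar> then 2 else 0)"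
    proof (cases "\<bar>u\<bar> \<le> 3 * x")
      case True
      define c where "c = cos (t * u)"
      have c: "c \<le> 0" unfolding c_def t_def using x u True by (intro cos_nonpos_outside) auto
      have c1: "-1 \<le> c" unfolding c_def by simp
      have "f u = c + d * (2 * c\<^sup>2 - 1)"
        unfolding f_def c_def using cos_double_cos[of "t * u"] by (simp add: mult.assoc)
      also have "\<dots> = c * (1 + 2 * d * c) - d" by (simp add: power2_eq_square algebra_simps)
      also have "\<dots> \<le> 0"
      proof -
        have "d * (- c) \<le> 1 / 10 * 1" using d c c1 by (intro mult_mono) auto
        then have "0 \<le> 1 + 2 * d * c" by simp
        then have "c * (1 + 2 * d * c) \<le> 0" using c by (rule mult_nonpos_nonneg[rotated])
        then show ?thesis using d by linarith
      qed
      finally show ?thesis by simp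
    next
      case False
      then have "2 * x < \<bar>u - s\<bar>" using s by linarith
      then show ?thesis using fb[of u] by simp
    qed
  qed (use x fb in auto)
  then have ex: "exit_ev x j f \<le> 2 * (P * p)" by (simp add: exit_ev_def P_def p_def mult.commute)
  have sb: "\<bar>sinm u * ev x j (\<lambda>s. sin (u * s)) j\<bar> \<le> \<bar>sinm u\<bar> * p" for u
  proof -
    have "\<bar>ev x j (\<lambda>s. sin (u * s)) j\<bar> \<le> 1 * pstay x j" by (rule abs_ev_le) auto
    then show ?thesis unfolding abs_mult p_def by (intro mult_left_mono) auto
  qed
  have p0: "0 \<le> p" by (simp add: p_def)
  have "ev x (Suc j) f (Suc j) = ev x j f (Suc j) - exit_ev x j f"
    by (rule ev_Suc[where K=2]) (use fb in auto)
  also have "ev x j f (Suc j) = (cosm t * A1 - sinm t * ev x j (\<lambda>s. sin (t * s)) j)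
      + d * (cosm (2 * t) * A2 - sinm (2 * t) * ev x j (\<lambda>s. sin (2 * t * s)) j)"
    unfolding split A1_def A2_def by (simp add: ev_cos_Suc)
  finally have e: "ev x (Suc j) f (Suc j) = cosm t * A1 + d * (cosm (2 * t) * A2)
      - sinm t * ev x j (\<lambda>s. sin (t * s)) j - d * (sinm (2 * t) * ev x j (\<lambda>s. sin (2 * t * s)) j) - exit_ev x j f"
    by (simp add: algebra_simps)
  have "\<bar>d * (sinm (2 * t) * ev x j (\<lambda>s. sin (2 * t * s)) j)\<bar> \<le> 1 * (\<bar>sinm (2 * t)\<bar> * p)"
    unfolding abs_mult[of d] using d sb[of "2 * t"] by (intro mult_mono) auto
  then have 1: "cosm t * A1 + d * (cosm (2 * t) * A2) - (\<bar>sinm t\<bar> + \<bar>sinm (2 * t)\<bar> + 2 * P) * p \<le> ev x (Suc j) f (Suc j)"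
    unfolding e using sb[of t] ex by (simp add: algebra_simps abs_le_iff)
  have "(\<bar>sinm t\<bar> + \<bar>sinm (2 * t)\<bar> + 2 * P) * p \<le> d * w / 4 * p"
    using err p0 by (intro mult_right_mono) (auto simp: P_def w_def)
  with 1 have 2: "cosm t * A1 + d * (cosm (2 * t) * A2) - d * w / 4 * p \<le> ev x (Suc j) f (Suc j)" by linarith
  \<comment> \<open>What is left over \<open>(cosm t - h) * f\<close> after subtracting the errors;
    it only has to be nonnegative on [-x, x]. Where the first cosine is at most 1/2, the second
    harmonic alone pays \<open>d * w / 4\<close>; elsewhere \<open>h\<close> pays.\<close>
  define F where "F s = (h * cos (t * s) + d * (h - k) * cos (2 * t * s)) + (- (d * w / 4)) * 1" for s
  have b1: "\<bar>h * cos (t * s)\<bar> \<le> \<bar>h\<bar>" "\<bar>d * (h - k) * cos (2 * t * s)\<bar> \<le> \<bar>d * (h - k)\<bar>" for s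
    using mult_left_le[OF abs_cos_le_one] by (auto simp: abs_mult)
  have b2: "\<bar>h * cos (t * s) + d * (h - k) * cos (2 * t * s)\<bar> \<le> \<bar>h\<bar> + \<bar>d * (h - k)\<bar>" for s
    using b1[of s] by linarith
  have Fb: "\<bar>F s\<bar> \<le> \<bar>h\<bar> + \<bar>d * (h - k)\<bar> + \<bar>d * w / 4\<bar>" for s
    unfolding F_def using b2[of s] by linarith
  have "ev x j (\<lambda>_. 0) j \<le> ev x j F j"
  proof (rule ev_mono[where K=0, OF _ _ _ Fb])
    fix s assume s: "\<bar>s\<bar> \<le> x"
    define c where "c = cos (t * s)"
    have c: "0 \<le> c" unfolding c_def t_def using x s by (intro cos_nonneg_inside) auto
    have c1: "c \<le> 1" unfolding c_def by simp
    have Fe: "F s = h * c + d * (k - h) * (1 - 2 * c\<^sup>2) - d * w / 4"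
    proof -
      have z: "cos (2 * t * s) = 2 * c\<^sup>2 - 1"
        unfolding c_def using cos_double_cos[of "t * s"] by (simp add: mult.assoc)
      show ?thesis unfolding F_def z c_def[symmetric] by (simp add: algebra_simps)
    qed
    have kh: "w / 2 \<le> k - h" "k - h \<le> 2 * w" using k h by auto
    have dw: "0 \<le> d * w" using d w0 by simp
    show "0 \<le> F s"
    proof (cases "c \<le> 1 / 2")
      case True
      have "c\<^sup>2 \<le> (1 / 2)\<^sup>2" using c True by (intro power_mono) auto
      then have "1 / 2 \<le> 1 - 2 * c\<^sup>2" by (simp add: power2_eq_square)
      then have "d * (w / 2) * (1 / 2) \<le> d * (k - h) * (1 - 2 * c\<^sup>2)"
        using d w0 kh by (intro mult_mono mult_left_mono) auto
      moreover have "0 \<le> h * c" using h c by simp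
      ultimately show ?thesis unfolding Fe by simp
    next
      case False
      have "h * (1 / 2) \<le> h * c" using False h by (intro mult_left_mono) auto
      moreover have "d * (k - h) * (2 * c\<^sup>2 - 1) \<le> d * (2 * w) * 1"
      proof -
        have "c\<^sup>2 \<le> 1" using c c1 by (simp add: power_le_one)
        then have "d * (k - h) * (2 * c\<^sup>2 - 1) \<le> d * (k - h) * 1"
          using d kh w0 by (intro mult_left_mono) auto
        also have "\<dots> \<le> d * (2 * w) * 1" using d kh by simp
        finally show ?thesis .
      qed
      ultimately show ?thesis unfolding Fe using dw by (simp add: h_def algebra_simps)
    qed
  qed (use x in \<open>auto simp: F_def[abs_def]\<close>)
  moreover have "ev x j F j = h * A1 + d * (h - k) * A2 - d * w / 4 * p"
    unfolding F_def A1_def A2_def p_def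
    by (subst ev_add[where K="\<bar>h\<bar> + \<bar>d * (h - k)\<bar>" and L="\<bar>d * w / 4\<bar>"], measurable, rule b2, simp,
        subst ev_add[where K="\<bar>h\<bar>" and L="\<bar>d * (h - k)\<bar>"], measurable, rule b1, rule b1,
        unfold ev_cmult ev_one, simp)
  moreover have "ev x j (\<lambda>_. 0) j = 0" by (simp add: ev_def)
  ultimately have 3: "0 \<le> h * A1 + d * (h - k) * A2 - d * w / 4 * p" by simp
  have "(cosm t - 5 * d * v * t\<^sup>2) * ev x j f j = (cosm t - h) * (A1 + d * A2)"
    unfolding split A1_def A2_def h_def w_def by (simp add: mult.assoc)
  also have "\<dots> = cosm t * A1 + d * (cosm (2 * t) * A2) - (h * A1 + d * (h - k) * A2)"
    by (simp add: k_def algebra_simps)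
  also have "\<dots> \<le> ev x (Suc j) f (Suc j)" using 2 3 by linarith
  finally show ?thesis .
qed

text \<open>The test function starts at its maximum \<open>1 + d\<close>, so this factor cancels
  between the initial value and the final comparison with the probability.\<close>

lemma lower_bound_stay:
  fixes x t d v lam :: real
  defines "t \<equiv> pi / (2 * x)"
  assumes x: "0 < x" and d: "0 < d" "d \<le> 1 / 10" and v: "0 \<le> v"
    and gap: "v * t\<^sup>2 \<le> cosm t - cosm (2 * t)" "cosm t - cosm (2 * t) \<le> 2 * v * t\<^sup>2"
    and err: "\<bar>sinm t\<bar> + \<bar>sinm (2 * t)\<bar> + 2 * prob {\<omega> \<in> space M. \<bar>X 0 \<omega>\<bar> > 2 * x} \<le> d * v / 4 * t\<^sup>2"
    and lam: "0 \<le> lam" "lam \<le> cosm t - 5 * d * v * t\<^sup>2"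
  shows "lam ^ n \<le> pstay x n"
proof -
  define f where "f = (\<lambda>s. cos (t * s) + d * cos (2 * t * s))"
  have step: "(cosm t - 5 * d * v * t\<^sup>2) * ev x j f j \<le> ev x (Suc j) f (Suc j)" for j
    unfolding f_def t_def by (rule lower_step[OF x d v gap[unfolded t_def] err[unfolded t_def]])
  have dc: "\<bar>d * cos u\<bar> \<le> d" for u using d mult_left_le[OF abs_cos_le_one, of d u] by (simp add: abs_mult)
  have low: "lam ^ n * (1 + d) \<le> ev x n f n" for n
  proof (induction n)
    case 0
    have "ev x 0 f 0 = ev x 0 (\<lambda>s. cos (t * s)) 0 + d * ev x 0 (\<lambda>s. cos (2 * t * s)) 0"
      unfolding f_def using dc by (subst ev_add[where K=1 and L=d]) (auto simp: ev_cmult)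
    then show ?case by (simp add: ev_0)
  next
    case (Suc n)
    have e0: "0 \<le> ev x n f n" using Suc lam d by (meson order_trans mult_nonneg_nonneg zero_le_power add_nonneg_nonneg zero_le_one less_imp_le)
    have "lam ^ Suc n * (1 + d) = lam * (lam ^ n * (1 + d))" by simp
    also have "\<dots> \<le> lam * ev x n f n" using lam by (intro mult_left_mono Suc)
    also have "\<dots> \<le> (cosm t - 5 * d * v * t\<^sup>2) * ev x n f n" using lam e0 by (intro mult_right_mono)
    also have "\<dots> \<le> ev x (Suc n) f (Suc n)" by (rule step)
    finally show ?case .
  qed
  have "ev x n f n \<le> ev x n (\<lambda>_. (1 + d) * 1) n"
  proof (rule ev_mono[where K="1 + d" and L="1 + d"])
    fix s
    show "\<bar>f s\<bar> \<le> 1 + d" unfolding f_def using dc[of "2 * t * s"] abs_cos_le_one[of "t * s"] by linarith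
    then show "f s \<le> (1 + d) * 1" by simp
  qed (use x d in \<open>auto simp: f_def\<close>)
  then have "ev x n f n \<le> (1 + d) * pstay x n" by (simp only: ev_cmult ev_one)
  with low[of n] have "lam ^ n * (1 + d) \<le> pstay x n * (1 + d)" by (simp add: mult.commute)
  then show ?thesis using d by (simp add: mult_le_cancel_right)
qed

end

section \<open>Excluding an infinite variance and a nonzero mean\<close>

context perturbed_walk
begin

text \<open>The blocks have at least the diffusive length: \<open>(radius p)\<^sup>2\<close> is of
  order \<open>n / ln n\<close>, like the block itself. The value of \<open>q\<close> comes from
  \<open>eps p < 2 * e0\<close>.\<close>

lemma block_radius:
  assumes A: "0 < A"
  obtains q where "0 < q" "\<forall>\<^sub>F p in G. q * (radius p)\<^sup>2 \<le> real (block A p)"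
proof -
  define q where "q = 1 / (A * \<sigma>\<^sup>2 * pi\<^sup>2 * e0\<^sup>2)"
  have q: "0 < q" using A sigma e0_pos by (simp add: q_def)
  have "\<forall>\<^sub>F p in G. eps p < 2 * e0" using eps_tendsto by (rule order_tendstoD(2)) (use e0_pos in simp)
  with block_ge[OF A] n_ge[of 3] eps_pos have "\<forall>\<^sub>F p in G. q * (radius p)\<^sup>2 \<le> real (block A p)"
  proof eventually_elim
    case (elim p)
    let ?n = "real (fst p)"
    have l0: "0 < ln ?n" using elim by simp
    have "(radius p)\<^sup>2 = \<sigma>\<^sup>2 * (phi ?n)\<^sup>2 * (eps p)\<^sup>2" by (simp add: radius_def power_mult_distrib)
    also have "(phi ?n)\<^sup>2 = pi\<^sup>2 * ?n / (8 * ln ?n)" using elim by (subst phi_squared) (auto simp: lg_eq_ln)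
    also have "\<sigma>\<^sup>2 * (pi\<^sup>2 * ?n / (8 * ln ?n)) * (eps p)\<^sup>2 \<le> \<sigma>\<^sup>2 * (pi\<^sup>2 * ?n / (8 * ln ?n)) * (2 * e0)\<^sup>2"
      using elim l0 by (intro mult_left_mono power_mono) auto
    finally have "q * (radius p)\<^sup>2 \<le> q * (\<sigma>\<^sup>2 * (pi\<^sup>2 * ?n / (8 * ln ?n)) * (2 * e0)\<^sup>2)"
      using q by (intro mult_left_mono) auto
    also have "\<dots> = ?n / (2 * A * ln ?n)"
      unfolding q_def using A sigma e0_pos l0 by (simp add: power_mult_distrib field_simps)
    finally show ?case using elim by linarith
  qed
  then show ?thesis using q by (intro that)
qed

lemma inverse_radius_at_right: "0 < c \<Longrightarrow> filterlim (\<lambda>p. c / radius p) (at_right 0) G"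
proof -
  assume "0 < c"
  then have "filterlim (\<lambda>x :: real. c / x) (at_right 0) at_top" by real_asymp
  then show ?thesis using radius_at_top by (rule filterlim_compose)
qed

lemma square_integrable_of_asymptotics:
  assumes "precise_asymptotics M X \<sigma> r a \<tau> b"
  shows "integrable M (\<lambda>\<omega>. (X 0 \<omega>)\<^sup>2)"
proof (rule ccontr)
  assume inf: "\<not> integrable M (\<lambda>\<omega>. (X 0 \<omega>)\<^sup>2)"
  have "\<not> precise_asymptotics M X \<sigma> r a \<tau> b"
  proof (rule no_asymptotics_if_blocks_contract)
    fix A :: real assume A: "0 < A"
    obtain q where q: "0 < q" "\<forall>\<^sub>F p in G. q * (radius p)\<^sup>2 \<le> real (block A p)" by (rule block_radius[OF A])
    have "\<forall>\<^sub>F p in G. (norm (psi (1 / radius p)))\<^sup>2 \<le> 1 - 6 / q * (1 / radius p)\<^sup>2"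
      by (rule eventually_compose_filterlim[OF psi_infinite_variance[OF inf] inverse_radius_at_right]) (use q in auto)
    with q(2) radius_pos show "\<forall>\<^sub>F p in G. \<forall>j. pstay (radius p) (j + block A p) \<le> 3 / 4 * pstay (radius p) j"
    proof eventually_elim
      case (elim p)
      let ?x = "radius p" and ?m = "block A p"
      let ?t = "1 / ?x"
      have "(norm (psi ?t) ^ ?m)\<^sup>2 = ((norm (psi ?t))\<^sup>2) ^ ?m" by (simp add: power_mult[symmetric] mult.commute)
      also have "\<dots> \<le> (1 - 6 / q * ?t\<^sup>2) ^ ?m" using elim by (intro power_mono) auto
      also have "\<dots> \<le> exp (- (real ?m * (6 / q * ?t\<^sup>2)))"
      proof (rule one_minus_power_le_exp)
        have "0 \<le> 1 - 6 / q * ?t\<^sup>2" using elim zero_le_power2 order_trans by blast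
        then show "6 / q * ?t\<^sup>2 \<le> 1" by simp
      qed
      also have "\<dots> \<le> exp (- 6)"
      proof -
        have "q * ?x\<^sup>2 * (6 / q * ?t\<^sup>2) \<le> real ?m * (6 / q * ?t\<^sup>2)" using elim q by (intro mult_right_mono) auto
        moreover have "q * ?x\<^sup>2 * (6 / q * ?t\<^sup>2) = 6" using q elim by (simp add: power_divide)
        ultimately show ?thesis by simp
      qed
      also have "\<dots> \<le> (1 / 8)\<^sup>2"
      proof -
        have "(2 :: real) ^ 6 \<le> exp 1 ^ 6" using exp_ge_add_one_self[of "1 :: real"] by (intro power_mono) auto
        then have "64 \<le> exp (6 :: real)" by (simp add: exp_of_nat_mult[symmetric])
        then show ?thesis by (simp add: exp_minus power2_eq_square field_simps)
      qed
      \<comment> \<open>The 6 in \<open>6 / q\<close> was chosen so that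
        \<open>exp 6 \<ge> 64\<close> yields 1/8 here; with \<open>1 + cos 1 \<ge> 3 / 2\<close> the
        block factor becomes \<open>(1 + 1 / 8) / (3 / 2) = 3 / 4\<close>.\<close>
      finally have small: "norm (psi ?t) ^ ?m \<le> 1 / 8" by (rule power2_le_imp_le) simp
      have c1: "1 / 2 \<le> cos (?t * ?x)" using one_minus_cos_le[of 1] elim by simp
      show ?case
      proof
        fix j
        have "pstay ?x (j + ?m) * (3 / 2) \<le> pstay ?x (j + ?m) * (1 + cos (?t * ?x))"
          using c1 by (intro mult_left_mono) auto
        also have "\<dots> \<le> pstay ?x j + Re (stay_char ?x j ?t j * psi ?t ^ ?m)"
          using elim pi_gt3 by (intro prob_stay_block_le) auto
        also have "Re (stay_char ?x j ?t j * psi ?t ^ ?m) \<le> norm (stay_char ?x j ?t j * psi ?t ^ ?m)"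
          by (rule complex_Re_le_cmod)
        also have "\<dots> \<le> pstay ?x j * (1 / 8)"
          unfolding norm_mult norm_power by (intro mult_mono norm_stay_char_le small) auto
        finally show "pstay ?x (j + ?m) \<le> 3 / 4 * pstay ?x j" by simp
      qed
    qed
  qed
  with assms show False by contradiction
qed

text \<open>A drift rotates the characteristic function: for \<open>t\<close> with
  \<open>m * \<mu> * t = pi\<close>, \<open>psi t ^ m\<close> is near -1 by
  \<open>centered_char_bound\<close>. As the block length \<open>m\<close> is at least of order
  \<open>(radius p)\<^sup>2\<close>, \<open>t * radius p\<close> is small and
  \<open>stay_char\<close> is near the probability itself, so the two terms on the right of
  \<open>prob_stay_block_le\<close> nearly cancel.\<close>

lemma mean_zero_of_asymptotics:
  assumes asym: "precise_asymptotics M X \<sigma> r a \<tau> b"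
    and i1: "integrable M (X 0)" and i2: "integrable M (\<lambda>\<omega>. (X 0 \<omega>)\<^sup>2)"
  shows "expectation (X 0) = 0"
proof (rule ccontr)
  define \<mu> where "\<mu> = expectation (X 0)"
  assume "expectation (X 0) \<noteq> 0"
  then have mu: "\<mu> \<noteq> 0" by (simp add: \<mu>_def)
  obtain C where C: "0 \<le> C" "\<And>t m. norm (psi t ^ m - iexp (real m * (\<mu> * t))) \<le> real m * (C * t\<^sup>2)"
    by (rule centered_char_bound[OF i1 i2, folded \<mu>_def]) (rule that)
  have "\<not> precise_asymptotics M X \<sigma> r a \<tau> b"
  proof (rule no_asymptotics_if_blocks_contract)
    fix A :: real assume A: "0 < A"
    obtain q where q: "0 < q" "\<forall>\<^sub>F p in G. q * (radius p)\<^sup>2 \<le> real (block A p)" by (rule block_radius[OF A])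
    define B where "B = pi / (\<bar>\<mu>\<bar> * q)"
    have B: "0 < B" using mu q by (simp add: B_def)
    define D where "D = C * pi\<^sup>2 / (\<mu>\<^sup>2 * q)"
    have D: "0 \<le> D" using C q by (simp add: D_def)
    have "((\<lambda>x :: real. D / x\<^sup>2) \<longlongrightarrow> 0) at_top" by real_asymp
    then have "((\<lambda>p. D / (radius p)\<^sup>2) \<longlongrightarrow> 0) G" using radius_at_top by (rule filterlim_compose)
    then have "\<forall>\<^sub>F p in G. D / (radius p)\<^sup>2 < 1 / 4" by (rule order_tendstoD(2)) simp
    moreover have "((\<lambda>p. B / radius p) \<longlongrightarrow> 0) G" using inverse_radius_at_right[OF B] by (simp add: filterlim_at)
    then have "\<forall>\<^sub>F p in G. B / radius p < 1 / 2" by (rule order_tendstoD(2)) simp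
    ultimately show "\<forall>\<^sub>F p in G. \<forall>j. pstay (radius p) (j + block A p) \<le> 3 / 4 * pstay (radius p) j"
      using q(2) radius_pos
    proof eventually_elim
      case (elim p)
      let ?x = "radius p" and ?m = "block A p"
      define t where "t = pi / (real ?m * \<mu>)"
      have qx: "0 < q * ?x\<^sup>2" using q elim by simp
      then have m0: "0 < real ?m" using elim by linarith
      have tx: "\<bar>t\<bar> * ?x \<le> B / ?x"
      proof -
        have "\<bar>t\<bar> * ?x = pi * ?x / (real ?m * \<bar>\<mu>\<bar>)" by (simp add: t_def abs_mult)
        also have "\<dots> \<le> pi * ?x / (q * ?x\<^sup>2 * \<bar>\<mu>\<bar>)"
          using elim qx mu m0 by (intro divide_left_mono mult_right_mono) auto
        also have "\<dots> = B / ?x" using elim q mu by (simp add: B_def power2_eq_square)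
        finally show ?thesis .
      qed
      have tx2: "\<bar>t\<bar> * ?x \<le> 1 / 2" using tx elim(2) by linarith
      have mt: "real ?m * (C * t\<^sup>2) \<le> D / ?x\<^sup>2"
      proof -
        have "real ?m * (C * t\<^sup>2) = C * pi\<^sup>2 / (real ?m * \<mu>\<^sup>2)" using m0 by (simp add: t_def power_divide power_mult_distrib power2_eq_square)
        also have "\<dots> \<le> C * pi\<^sup>2 / (q * ?x\<^sup>2 * \<mu>\<^sup>2)"
          using elim qx mu m0 C by (intro divide_left_mono mult_right_mono) auto
        also have "\<dots> = D / ?x\<^sup>2" by (simp add: D_def mult_ac)
        finally show ?thesis .
      qed
      have "real ?m * (\<mu> * t) = pi" using m0 mu by (simp add: t_def)
      then have psi1: "norm (psi t ^ ?m + 1) \<le> D / ?x\<^sup>2"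
        using C(2)[of t ?m] mt exp_pi_i by (simp add: mult.commute)
      have ctx: "0 \<le> cos (t * ?x)"
      proof (rule cos_ge_zero)
        have "\<bar>t * ?x\<bar> \<le> 1 / 2" using tx2 elim(4) by (simp add: abs_mult)
        then show "- (pi / 2) \<le> t * ?x" "t * ?x \<le> pi / 2" using pi_gt3 by linarith+
      qed
      show ?case
      proof
        fix j
        let ?Z = "stay_char ?x j t j" and ?p = "pstay ?x j"
        have "pstay ?x (j + ?m) * 1 \<le> pstay ?x (j + ?m) * (1 + cos (t * ?x))"
          using ctx by (intro mult_left_mono) auto
        also have "\<dots> \<le> ?p + Re (?Z * psi t ^ ?m)"
        proof (rule prob_stay_block_le)
          show "0 \<le> ?x" using elim(4) by simp
          have "\<bar>t * ?x\<bar> \<le> 1 / 2" using tx2 elim(4) by (simp add: abs_mult)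
          then show "\<bar>t * ?x\<bar> \<le> pi" using pi_gt3 by linarith
        qed
        also have "?p + Re (?Z * psi t ^ ?m) = Re (of_real ?p - ?Z + ?Z * (psi t ^ ?m + 1))"
          by (simp add: algebra_simps)
        also have "\<dots> \<le> norm (of_real ?p - ?Z + ?Z * (psi t ^ ?m + 1))" by (rule complex_Re_le_cmod)
        also have "\<dots> \<le> norm (of_real ?p - ?Z) + norm (?Z * (psi t ^ ?m + 1))" by (rule norm_triangle_ineq)
        also have "\<dots> \<le> \<bar>t\<bar> * ?x * ?p + ?p * (D / ?x\<^sup>2)"
          unfolding norm_mult using stay_char_close[of ?x j t] elim
          by (intro add_mono mult_mono norm_stay_char_le psi1) (auto simp: norm_minus_commute)
        also have "\<dots> \<le> 1 / 2 * ?p + ?p * (1 / 4)"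
          by (intro add_mono mult_right_mono mult_left_mono tx2 less_imp_le[OF elim(1)]) auto
        finally show "pstay ?x (j + ?m) \<le> 3 / 4 * ?p" by simp
      qed
    qed
  qed
  with asym show False by contradiction
qed

section \<open>Excluding a wrong finite variance\<close>

lemma inverse_eps_squared_tendsto: "((\<lambda>p. c / (eps p)\<^sup>2) \<longlongrightarrow> c * (r - 1)) G"
proof -
  have "((\<lambda>p. c / (eps p)\<^sup>2) \<longlongrightarrow> c / e0\<^sup>2) G"
    using e0_pos by (intro tendsto_intros eps_tendsto) auto
  then show ?thesis using e0_squared by (metis times_divide_eq_right mult.right_neutral)
qed

lemma n_theta_squared:
  "3 \<le> real (fst p) \<Longrightarrow> 0 < eps p \<Longrightarrow>
    real (fst p) * (\<sigma>\<^sup>2 / 2 * c * (pi / (2 * radius p))\<^sup>2) = c / (eps p)\<^sup>2 * ln (real (fst p))"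
  using sigma by (subst theta_squared) (auto simp: lg_eq_ln field_simps)

context
  fixes v :: real
  assumes i1: "integrable M (X 0)" and m0: "expectation (X 0) = 0"
    and i2: "integrable M (\<lambda>\<omega>. (X 0 \<omega>)\<^sup>2)" and var: "expectation (\<lambda>\<omega>. (X 0 \<omega>)\<^sup>2) = v"
begin

lemma cosm_le_at_right: "c < v / 2 \<Longrightarrow> \<forall>\<^sub>F t in at_right 0. cosm t \<le> 1 - c * t\<^sup>2"
proof -
  assume "c < v / 2"
  with cosm_second_order[OF i1 m0 i2 var] have "\<forall>\<^sub>F t in at_right 0. c < (1 - cosm t) / t\<^sup>2" by (rule order_tendstoD(1))
  then show ?thesis using eventually_at_right_less[of 0]
    by eventually_elim (simp add: pos_less_divide_eq)
qed

lemma cosm_ge_at_right: "v / 2 < c \<Longrightarrow> \<forall>\<^sub>F t in at_right 0. 1 - c * t\<^sup>2 \<le> cosm t"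
proof -
  assume "v / 2 < c"
  with cosm_second_order[OF i1 m0 i2 var] have "\<forall>\<^sub>F t in at_right 0. (1 - cosm t) / t\<^sup>2 < c" by (rule order_tendstoD(2))
  then show ?thesis using eventually_at_right_less[of 0]
    by eventually_elim (simp add: pos_divide_less_eq)
qed

lemma sinm_le_at_right: "0 < c \<Longrightarrow> \<forall>\<^sub>F t in at_right 0. \<bar>sinm t\<bar> \<le> c * t\<^sup>2"
proof -
  assume "0 < c"
  with sinm_second_order[OF i1 m0 i2 var] have "\<forall>\<^sub>F t in at_right 0. dist (sinm t / t\<^sup>2) 0 < c" by (rule tendstoD)
  then show ?thesis using eventually_at_right_less[of 0]
    by eventually_elim (simp add: abs_divide pos_divide_less_eq)
qed

lemma tail_le_eventually:
  assumes "0 < y" "0 < c"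
  shows "\<forall>\<^sub>F p in G. prob {\<omega> \<in> space M. \<bar>X 0 \<omega>\<bar> > y * radius p} \<le> c / (radius p)\<^sup>2"
proof -
  have "filterlim (\<lambda>p. y * radius p) at_top G"
    using assms by (intro filterlim_tendsto_pos_mult_at_top[OF tendsto_const _ radius_at_top])
  with tail_second_order[OF i1 m0 i2 var]
  have "((\<lambda>p. (y * radius p)\<^sup>2 * prob {\<omega> \<in> space M. \<bar>X 0 \<omega>\<bar> > y * radius p}) \<longlongrightarrow> 0) G"
    by (rule filterlim_compose)
  then have "\<forall>\<^sub>F p in G. (y * radius p)\<^sup>2 * prob {\<omega> \<in> space M. \<bar>X 0 \<omega>\<bar> > y * radius p} < y\<^sup>2 * c"
    by (rule order_tendstoD(2)) (use assms in simp)
  then show ?thesis using radius_pos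
  proof eventually_elim
    case (elim p)
    then have "(radius p)\<^sup>2 * prob {\<omega> \<in> space M. \<bar>X 0 \<omega>\<bar> > y * radius p} < c"
      using assms by (simp add: power_mult_distrib mult.assoc)
    then show ?case using elim by (simp add: field_simps)
  qed
qed

text \<open>A fixed widening by the factor \<open>1 + D\<close> turns all errors into
  \<open>o(t\<^sup>2)\<close>. It lowers the exponent, but for small \<open>D\<close> the excess of
  \<open>v\<close> over \<open>\<sigma>\<^sup>2\<close> outweighs this.\<close>

lemma no_asymptotics_if_variance_large:
  assumes "\<sigma>\<^sup>2 < v" shows "\<not> precise_asymptotics M X \<sigma> r a \<tau> b"
proof -
  have "((\<lambda>d. \<sigma>\<^sup>2 * (1 + d) ^ 3) \<longlongrightarrow> \<sigma>\<^sup>2 * (1 + 0) ^ 3) (at_right 0)" by (intro tendsto_intros)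
  then have "\<forall>\<^sub>F d in at_right 0. \<sigma>\<^sup>2 * (1 + d) ^ 3 < v" by (rule order_tendstoD(2)) (use assms in simp)
  then have "\<forall>\<^sub>F d :: real in at_right 0. 0 < d \<and> \<sigma>\<^sup>2 * (1 + d) ^ 3 < v"
    using eventually_at_right_less[of 0] by (rule eventually_conj[rotated])
  then obtain D where D: "0 < D" "\<sigma>\<^sup>2 * (1 + D) ^ 3 < v"
    using eventually_happens'[OF trivial_limit_at_right_real] by blast
  \<comment> \<open>Two of the three factors \<open>1 + D\<close> compensate the lower frequency
    \<open>t\<close> of the wider interval, the third is the gain: \<open>\<rho> * t\<^sup>2 =
    \<sigma>\<^sup>2 / 2 * (1 + D) * (pi / (2 * radius p))\<^sup>2\<close>.\<close>
  define \<rho> where "\<rho> = \<sigma>\<^sup>2 * (1 + D) ^ 3 / 2"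
  obtain \<rho>1 where r1: "\<rho> < \<rho>1" "\<rho>1 < v / 2" using dense[of \<rho> "v / 2"] D by (auto simp: \<rho>_def)
  define k where "k = pi / (2 * (1 + D))"
  define c where "c = cos k"
  have k0: "0 < k" using D by (simp add: k_def)
  have "k < pi / 2" using D by (simp add: k_def field_simps)
  then have c0: "0 < c" unfolding c_def using k0 by (intro cos_gt_zero) auto
  \<comment> \<open>Sine and tail, of size \<open>z * t\<^sup>2\<close> each, use up after division
    by \<open>c\<close> exactly the gap between \<open>\<rho>\<close> and
    \<open>\<rho>1\<close>.\<close>
  define z where "z = c * (\<rho>1 - \<rho>) / 2"
  have z: "0 < z" using c0 r1 by (simp add: z_def)
  define \<gamma> where "\<gamma> = D * (r - 1) / 2"
  have \<gamma>: "0 < \<gamma>" using D r by (simp add: \<gamma>_def)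
  note at = inverse_radius_at_right[OF k0]
  have "\<forall>\<^sub>F p in G. (r - 1) + \<gamma> < (1 + D) / (eps p)\<^sup>2"
  proof (rule order_tendstoD(1)[OF inverse_eps_squared_tendsto])
    have half: "x + e / 2 < x + e" if "0 < e" for x e :: real using that by simp
    have "0 < D * (r - 1)" using D r by simp
    from half[OF this, of "r - 1"] show "(r - 1) + \<gamma> < (1 + D) * (r - 1)"
      unfolding \<gamma>_def distrib_right by (simp only: mult_1)
  qed
  moreover have "\<forall>\<^sub>F p in G. cosm (k / radius p) \<le> 1 - \<rho>1 * (k / radius p)\<^sup>2"
    by (rule eventually_compose_filterlim[OF cosm_le_at_right[OF r1(2)] at])
  moreover have "\<forall>\<^sub>F p in G. \<bar>sinm (k / radius p)\<bar> \<le> z * (k / radius p)\<^sup>2"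
    by (rule eventually_compose_filterlim[OF sinm_le_at_right[OF z] at])
  moreover have "\<forall>\<^sub>F p in G. prob {\<omega> \<in> space M. \<bar>X 0 \<omega>\<bar> > D * radius p} \<le> z * k\<^sup>2 / (radius p)\<^sup>2"
    using D z k0 by (intro tail_le_eventually) auto
  moreover have "\<forall>\<^sub>F p in G. \<rho> * (k / radius p)\<^sup>2 < 1"
  proof -
    have "((\<lambda>p. \<rho> * (k / radius p)\<^sup>2) \<longlongrightarrow> \<rho> * 0\<^sup>2) G"
      using at by (intro tendsto_intros) (simp add: filterlim_at)
    then show ?thesis by (rule order_tendstoD(2)) simp
  qed
  ultimately have "\<forall>\<^sub>F p in G. pstay (radius p) (fst p) \<le> 1 / c * real (fst p) powr (- (r - 1) - \<gamma>)"
    using radius_pos n_ge[of 3] eps_pos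
  proof eventually_elim
    case (elim p)
    let ?x = "radius p" and ?n = "real (fst p)"
    define t where "t = k / ?x"
    have t: "pi / (2 * (?x * (1 + D))) = t" using D elim by (simp add: t_def k_def field_simps)
    have tx: "t * ?x = k" using elim by (simp add: t_def)
    have Dx: "?x * (1 + D) - ?x = D * ?x" by (simp add: algebra_simps)
    have lam: "cosm t + (\<bar>sinm t\<bar> + prob {\<omega> \<in> space M. \<bar>X 0 \<omega>\<bar> > D * ?x}) / c \<le> 1 - \<rho> * t\<^sup>2"
    proof -
      have "\<bar>sinm t\<bar> + prob {\<omega> \<in> space M. \<bar>X 0 \<omega>\<bar> > D * ?x} \<le> 2 * z * t\<^sup>2"
      proof -
        have "z * k\<^sup>2 / ?x\<^sup>2 = z * t\<^sup>2" by (simp add: t_def power_divide)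
        then have "\<bar>sinm t\<bar> + prob {\<omega> \<in> space M. \<bar>X 0 \<omega>\<bar> > D * ?x} \<le> z * t\<^sup>2 + z * t\<^sup>2"
          using elim(3,4) unfolding t_def[symmetric] by (intro add_mono) auto
        then show ?thesis by simp
      qed
      then have "(\<bar>sinm t\<bar> + prob {\<omega> \<in> space M. \<bar>X 0 \<omega>\<bar> > D * ?x}) / c \<le> 2 * z * t\<^sup>2 / c"
        using c0 by (intro divide_right_mono) auto
      also have "\<dots> = (\<rho>1 - \<rho>) * t\<^sup>2" using c0 by (simp add: z_def)
      finally show ?thesis using elim(2) unfolding t_def[symmetric] by (simp add: algebra_simps)
    qed
    have "0 < ?x" "?x < ?x * (1 + D)" using elim D by auto
    note rec = upper_recursion[OF this, unfolded t Dx tx, folded c_def, OF lam]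
    have "c * pstay ?x (fst p) \<le> (1 - \<rho> * t\<^sup>2) ^ fst p" using rec(1,2)[of "fst p"] by linarith
    also have "\<dots> \<le> exp (- (?n * (\<rho> * t\<^sup>2)))" using elim(5) unfolding t_def[symmetric] by (intro one_minus_power_le_exp) auto
    also have "\<rho> * t\<^sup>2 = \<sigma>\<^sup>2 / 2 * (1 + D) * (pi / (2 * ?x))\<^sup>2"
    proof -
      have *: "s * e ^ 3 / 2 * (u / e)\<^sup>2 = s / 2 * e * u\<^sup>2" if "e \<noteq> 0" for s e u :: real
        using that by (simp add: power_divide power2_eq_square power3_eq_cube)
      have "t = pi / (2 * ?x) / (1 + D)" by (simp add: t_def k_def mult.commute)
      then show ?thesis unfolding \<rho>_def using *[of "1 + D" "\<sigma>\<^sup>2" "pi / (2 * ?x)"] D by simp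
    qed
    also have "?n * \<dots> = (1 + D) / (eps p)\<^sup>2 * ln ?n" using elim by (intro n_theta_squared) auto
    also have "exp (- ((1 + D) / (eps p)\<^sup>2 * ln ?n)) \<le> exp (- (((r - 1) + \<gamma>) * ln ?n))"
      unfolding exp_le_cancel_iff neg_le_iff_le
      by (intro mult_right_mono less_imp_le[OF elim(1)]) (use elim in simp)
    also have "\<dots> = ?n powr (- (r - 1) - \<gamma>)" using elim by (simp add: powr_def algebra_simps)
    finally show ?case using c0 by (simp add: field_simps)
  qed
  then show ?thesis by (rule no_asymptotics_if_small[OF \<gamma>])
qed

text \<open>\<open>lower_bound_stay\<close> with a small weight \<open>d\<close> loses only a
  relative amount of order \<open>d\<close> in the exponent, less than the gap between
  \<open>v\<close> and \<open>\<sigma>\<^sup>2\<close>.\<close>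

lemma no_asymptotics_if_variance_small:
  assumes "0 < v" "v < \<sigma>\<^sup>2" shows "\<not> precise_asymptotics M X \<sigma> r a \<tau> b"
proof -
  have s2: "0 < \<sigma>\<^sup>2" using sigma by simp
  have "((\<lambda>d. v / \<sigma>\<^sup>2 * ((1 + 11 * d) * (1 + d))) \<longlongrightarrow> v / \<sigma>\<^sup>2 * ((1 + 11 * 0) * (1 + 0))) (at_right 0)" by (intro tendsto_intros)
  then have "\<forall>\<^sub>F d in at_right 0. v / \<sigma>\<^sup>2 * ((1 + 11 * d) * (1 + d)) < 1"
    by (rule order_tendstoD(2)) (use assms s2 in \<open>simp add: divide_less_eq\<close>)
  moreover have "\<forall>\<^sub>F d :: real in at_right 0. d < 1 / 10"
    using eventually_at_right_real[of 0 "1 / 10"] by (auto elim: eventually_mono)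
  ultimately have "\<forall>\<^sub>F d in at_right 0. 0 < d \<and> d \<le> 1 / 10 \<and> v / \<sigma>\<^sup>2 * ((1 + 11 * d) * (1 + d)) < 1"
    using eventually_at_right_less[of 0] by eventually_elim auto
  then obtain d where d: "0 < d" "d \<le> 1 / 10" and R1: "v / \<sigma>\<^sup>2 * ((1 + 11 * d) * (1 + d)) < 1"
    using eventually_happens'[OF trivial_limit_at_right_real] by blast
  \<comment> \<open>In \<open>1 + 11 * d\<close> one \<open>d\<close> is for approximating
    \<open>cosm\<close> and ten are for the loss \<open>5 * d * v * t\<^sup>2\<close> in
    \<open>lower_bound_stay\<close>; the factor \<open>1 + d\<close> pays for passing from
    \<open>1 - y\<close> to an exponential.\<close>
  define R where "R = v / \<sigma>\<^sup>2 * ((1 + 11 * d) * (1 + d))"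
  define B where "B = v / 2 * (1 + 11 * d)"
  have B: "0 < B" using assms d by (simp add: B_def)
  define \<gamma> where "\<gamma> = (1 - R) * (r - 1) / 2"
  have \<gamma>: "0 < \<gamma>" using R1 r by (simp add: \<gamma>_def R_def)
  have k0: "0 < pi / 2" and k1: "0 < pi" by auto
  \<comment> \<open>The budget \<open>d * v / 4 * t\<^sup>2\<close> is four times
    \<open>z * t\<^sup>2\<close>: one share for each of the two sine terms and two for the doubled
    tail.\<close>
  define z where "z = d * v / 16"
  have z: "0 < z" using d assms by (simp add: z_def)
  note at = inverse_radius_at_right[OF k0] and at2 = inverse_radius_at_right[OF k1]
  have "\<forall>\<^sub>F p in G. R / (eps p)\<^sup>2 < (r - 1) - \<gamma>"
  proof -
    have half: "x - e < x - e / 2" if "0 < e" for x e :: real using that by simp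
    have "R < 1" using R1 by (simp only: R_def)
    then have "0 < (1 - R) * (r - 1)" using r by simp
    from half[OF this, of "r - 1"] have "R * (r - 1) < (r - 1) - \<gamma>"
      unfolding \<gamma>_def left_diff_distrib[of 1 R "r - 1"] by simp
    with inverse_eps_squared_tendsto show ?thesis by (rule order_tendstoD(2))
  qed
  \<comment> \<open>The difference \<open>cosm t - cosm (2 * t)\<close> is about
    \<open>3 / 2 * v * t\<^sup>2\<close>. The constants 3/8, 15/32 and 19/32 around the limiting 1/2
    keep it between \<open>v * t\<^sup>2\<close> and \<open>2 * v * t\<^sup>2\<close>.\<close>
  moreover have "\<forall>\<^sub>F p in G. cosm (pi / 2 / radius p) \<le> 1 - v * (3 / 8) * (pi / 2 / radius p)\<^sup>2"
    by (rule eventually_compose_filterlim[OF cosm_le_at_right at]) (use assms in simp)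
  moreover have "\<forall>\<^sub>F p in G. 1 - v / 2 * (1 + d) * (pi / 2 / radius p)\<^sup>2 \<le> cosm (pi / 2 / radius p)"
    by (rule eventually_compose_filterlim[OF cosm_ge_at_right at]) (use assms d in simp)
  moreover have "\<forall>\<^sub>F p in G. cosm (pi / radius p) \<le> 1 - v * (15 / 32) * (pi / radius p)\<^sup>2"
    by (rule eventually_compose_filterlim[OF cosm_le_at_right at2]) (use assms in simp)
  moreover have "\<forall>\<^sub>F p in G. 1 - v * (19 / 32) * (pi / radius p)\<^sup>2 \<le> cosm (pi / radius p)"
    by (rule eventually_compose_filterlim[OF cosm_ge_at_right at2]) (use assms in simp)
  moreover have "\<forall>\<^sub>F p in G. \<bar>sinm (pi / 2 / radius p)\<bar> \<le> z * (pi / 2 / radius p)\<^sup>2"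
    by (rule eventually_compose_filterlim[OF sinm_le_at_right[OF z] at])
  moreover have "\<forall>\<^sub>F p in G. \<bar>sinm (pi / radius p)\<bar> \<le> z / 4 * (pi / radius p)\<^sup>2"
    by (rule eventually_compose_filterlim[OF sinm_le_at_right at2]) (use z in simp)
  moreover have "\<forall>\<^sub>F p in G. prob {\<omega> \<in> space M. \<bar>X 0 \<omega>\<bar> > 2 * radius p} \<le> z * (pi / 2)\<^sup>2 / (radius p)\<^sup>2"
    using z by (intro tail_le_eventually) auto
  moreover have "\<forall>\<^sub>F p in G. B * (pi / 2 / radius p)\<^sup>2 < d / 2"
  proof -
    have "((\<lambda>p. B * (pi / 2 / radius p)\<^sup>2) \<longlongrightarrow> B * 0\<^sup>2) G"
      using at by (intro tendsto_intros) (simp add: filterlim_at)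
    then show ?thesis by (rule order_tendstoD(2)) (use d in simp)
  qed
  ultimately have "\<forall>\<^sub>F p in G. real (fst p) powr (- (r - 1) + \<gamma>) \<le> pstay (radius p) (fst p)"
    using radius_pos n_ge[of 3] eps_pos
  proof eventually_elim
    case (elim p)
    let ?x = "radius p" and ?n = "real (fst p)"
    define t where "t = pi / (2 * ?x)"
    have t: "pi / 2 / ?x = t" "pi / ?x = 2 * t" using elim by (auto simp: t_def)
    have tt: "(2 * t)\<^sup>2 = 4 * t\<^sup>2" by (simp add: power_mult_distrib)
    define w where "w = v * t\<^sup>2"
    have w0: "0 \<le> w" using assms by (simp add: w_def)
    note el = elim(2-9)[unfolded t tt]
    have dw: "0 \<le> d * w" "d * w \<le> w / 10" using d w0 mult_right_mono[OF d(2) w0] by auto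
    have 1: "v * t\<^sup>2 \<le> cosm t - cosm (2 * t)"
    proof -
      have "v / 2 * (1 + d) * t\<^sup>2 = w / 2 + d * w / 2" by (simp add: w_def field_simps)
      moreover have "v * (15 / 32) * (4 * t\<^sup>2) = 15 / 8 * w" by (simp add: w_def)
      ultimately show ?thesis using el(2,3) dw w0 unfolding w_def[symmetric] by linarith
    qed
    have 2: "cosm t - cosm (2 * t) \<le> 2 * v * t\<^sup>2"
    proof -
      have "v * (3 / 8) * t\<^sup>2 = 3 / 8 * w" "v * (19 / 32) * (4 * t\<^sup>2) = 19 / 8 * w" "2 * v * t\<^sup>2 = 2 * w"
        by (simp_all add: w_def)
      then show ?thesis using el(1,4) by linarith
    qed
    have zw: "z * t\<^sup>2 = d * w / 16" by (simp add: z_def w_def)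
    have tail: "prob {\<omega> \<in> space M. \<bar>X 0 \<omega>\<bar> > 2 * ?x} \<le> z * t\<^sup>2"
    proof -
      have "z * (pi / 2)\<^sup>2 / ?x\<^sup>2 = z * t\<^sup>2" unfolding t(1)[symmetric] by (simp add: power_divide)
      then show ?thesis using el(7) by simp
    qed
    have 3: "\<bar>sinm t\<bar> + \<bar>sinm (2 * t)\<bar> + 2 * prob {\<omega> \<in> space M. \<bar>X 0 \<omega>\<bar> > 2 * ?x} \<le> d * v / 4 * t\<^sup>2"
    proof -
      have "d * v / 4 * t\<^sup>2 = 4 * (z * t\<^sup>2)" by (simp add: z_def)
      then show ?thesis using el(5,6) tail by linarith
    qed
    define y where "y = B * t\<^sup>2"
    have y0: "0 \<le> y" using B by (simp add: y_def)
    have yd: "y < d / 2" using el(8) by (simp add: y_def)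
    have lam: "1 - y \<le> cosm t - 5 * d * v * t\<^sup>2"
    proof -
      have "v / 2 * (1 + d) * t\<^sup>2 = w / 2 + d * w / 2" "y = w / 2 + 11 / 2 * (d * w)" "5 * d * v * t\<^sup>2 = 5 * (d * w)"
        by (simp_all add: w_def y_def B_def field_simps)
      then show ?thesis using el(2) by linarith
    qed
    have "(1 - y) ^ fst p \<le> pstay ?x (fst p)"
      by (rule lower_bound_stay[OF _ d less_imp_le[OF assms(1)], of ?x, folded t_def, OF _ 1 2 3 _ lam])
         (use elim yd d in auto)
    moreover have "?n powr (- (r - 1) + \<gamma>) \<le> (1 - y) ^ fst p"
    proof -
      have "exp (- (y * (1 + d))) \<le> 1 - y"
      proof -
        have "- y - 2 * y\<^sup>2 \<le> ln (1 - y)" using y0 yd d by (intro ln_one_minus_pos_lower_bound) auto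
        moreover have "2 * y\<^sup>2 \<le> d * y" using yd y0 mult_right_mono[of "2 * y" d y] by (simp add: power2_eq_square)
        ultimately have "- (y * (1 + d)) \<le> ln (1 - y)" by (simp add: algebra_simps)
        then have "exp (- (y * (1 + d))) \<le> exp (ln (1 - y))" by simp
        also have "\<dots> = 1 - y" using yd d by simp
        finally show ?thesis .
      qed
      then have "exp (- (y * (1 + d))) ^ fst p \<le> (1 - y) ^ fst p" by (intro power_mono) auto
      then have "exp (- (?n * (y * (1 + d)))) \<le> (1 - y) ^ fst p" by (simp add: exp_of_nat_mult[symmetric])
      moreover have "y * (1 + d) = \<sigma>\<^sup>2 / 2 * R * (pi / (2 * ?x))\<^sup>2"
        using s2 by (simp add: y_def B_def R_def t_def)
      moreover have "?n * (\<sigma>\<^sup>2 / 2 * R * (pi / (2 * ?x))\<^sup>2) = R / (eps p)\<^sup>2 * ln ?n"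
        using elim by (intro n_theta_squared) auto
      ultimately have "exp (- (R / (eps p)\<^sup>2 * ln ?n)) \<le> (1 - y) ^ fst p" by simp
      moreover have "exp (- (((r - 1) - \<gamma>) * ln ?n)) \<le> exp (- (R / (eps p)\<^sup>2 * ln ?n))"
        unfolding exp_le_cancel_iff neg_le_iff_le
        by (intro mult_right_mono less_imp_le[OF elim(1)]) (use elim in simp)
      moreover have "?n powr (- (r - 1) + \<gamma>) = exp (- (((r - 1) - \<gamma>) * ln ?n))"
        using elim by (simp add: powr_def algebra_simps)
      ultimately show ?thesis by linarith
    qed
    ultimately show ?case by linarith
  qed
  then show ?thesis by (rule no_asymptotics_if_large[OF \<gamma>])
qed

text \<open>All steps vanish almost surely, so the walk never leaves and the probability is 1, far
  above the critical power of \<open>n\<close>.\<close>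

lemma no_asymptotics_if_variance_zero:
  assumes "v = 0" shows "\<not> precise_asymptotics M X \<sigma> r a \<tau> b"
proof -
  have "AE \<omega> in M. (X 0 \<omega>)\<^sup>2 = 0"
    using var assms by (subst integral_nonneg_eq_0_iff_AE[OF i2, symmetric]) auto
  then have "expectation (\<lambda>\<omega>. indicator {0} (X 0 \<omega>)) = expectation (\<lambda>\<omega>. 1 :: real)"
    by (intro integral_cong_AE) (auto simp: indicator_def elim: eventually_mono)
  then have one: "expectation (\<lambda>\<omega>. indicator {0} (X k \<omega>) :: real) = 1" for k
    using expectation_ident[of "indicat_real {0}" k] by (simp add: prob_space)
  have "AE \<omega> in M. X k \<omega> = 0" for k
  proof -
    have "prob {\<omega> \<in> space M. X k \<omega> = 0} = expectation (indicat_real {\<omega> \<in> space M. X k \<omega> = 0})"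
      by (simp add: Int_def conj_commute)
    also have "\<dots> = expectation (\<lambda>\<omega>. indicator {0} (X k \<omega>))"
      by (intro Bochner_Integration.integral_cong refl) (simp add: indicator_def)
    finally have "prob {\<omega> \<in> space M. X k \<omega> = 0} = 1" using one by simp
    then have "AE \<omega> in M. \<omega> \<in> {\<omega> \<in> space M. X k \<omega> = 0}" by (subst (asm) prob_eq_1) auto
    then show ?thesis by (auto elim: eventually_mono)
  qed
  then have ae: "AE \<omega> in M. \<forall>k. X k \<omega> = 0" by (simp add: AE_all_countable)
  have full: "pstay x n = 1" if "0 \<le> x" for x n
  proof -
    have "AE \<omega> in M. \<omega> \<in> stay x n"
      using ae AE_space by eventually_elim (use that in \<open>auto simp: stay_def partial_sum_def\<close>)
    then show ?thesis by (subst prob_eq_1) auto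
  qed
  have "\<forall>\<^sub>F p in G. real (fst p) powr (- (r - 1) + (r - 1) / 2) \<le> pstay (radius p) (fst p)"
    using radius_pos n_ge[of 3]
  proof eventually_elim
    case (elim p)
    have "- (r - 1) + (r - 1) / 2 \<le> 0" using r by (simp add: field_simps)
    then have "real (fst p) powr (- (r - 1) + (r - 1) / 2) \<le> real (fst p) powr 0"
      using elim by (intro powr_mono) auto
    then show ?case using elim full[of "radius p" "fst p"] by simp
  qed
  then show ?thesis by (rule no_asymptotics_if_large[rotated]) (use r in simp)
qed

end

theorem moments_of_precise_asymptotics:
  assumes asym: "precise_asymptotics M X \<sigma> r a \<tau> b"
  shows "integrable M (X 0)" "expectation (X 0) = 0" "integrable M (\<lambda>\<omega>. (X 0 \<omega>)\<^sup>2)" "variance (X 0) = \<sigma>\<^sup>2"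
proof -
  show i2: "integrable M (\<lambda>\<omega>. (X 0 \<omega>)\<^sup>2)" by (rule square_integrable_of_asymptotics[OF asym])
  show i1: "integrable M (X 0)" by (rule square_integrable_imp_integrable[OF X_measurable i2])
  show m0: "expectation (X 0) = 0" by (rule mean_zero_of_asymptotics[OF asym i1 i2])
  define v where "v = expectation (\<lambda>\<omega>. (X 0 \<omega>)\<^sup>2)"
  have "0 \<le> v" unfolding v_def by (simp add: integral_nonneg_AE)
  note v = i1 m0 i2 v_def[symmetric]
  have "\<not> \<sigma>\<^sup>2 < v" "\<not> (0 < v \<and> v < \<sigma>\<^sup>2)" "v \<noteq> 0"
    using asym no_asymptotics_if_variance_large[OF v] no_asymptotics_if_variance_small[OF v]
      no_asymptotics_if_variance_zero[OF v] by blast+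
  with \<open>0 \<le> v\<close> have "v = \<sigma>\<^sup>2" by linarith
  then show "variance (X 0) = \<sigma>\<^sup>2" using m0 by (simp add: v_def)
qed

end

theorem theorem1p2:
  fixes M :: "'a measure" and X :: "nat \<Rightarrow> 'a \<Rightarrow> real" and \<sigma> :: real
  assumes "prob_space M"
    and "prob_space.indep_vars M (\<lambda>_. borel) X UNIV"
    and "\<And>k. distr M borel (X k) = distr M borel (X 0)"
    and "0 < \<sigma>"
  shows
    "(\<forall>r a \<tau> b.
        r > 1 \<and> a > -1 \<and> perturbation r \<tau> b \<and>
        integrable M (X 0) \<and> prob_space.expectation M (X 0) = 0 \<and>
        integrable M (\<lambda>\<omega>. (X 0 \<omega>)\<^sup>2) \<and> prob_space.expectation M (\<lambda>\<omega>. (X 0 \<omega>)\<^sup>2) = \<sigma>\<^sup>2 \<and>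
        (\<exists>\<eta>. 0 < \<eta> \<and> \<eta> < 1 \<and> integrable M (\<lambda>\<omega>. \<bar>X 0 \<omega>\<bar> powr (2 + \<eta>)))
        \<longrightarrow> precise_asymptotics M X \<sigma> r a \<tau> b)
     \<and>
     ((\<exists>r a \<tau> b.
        r > 1 \<and> a > -1 \<and> perturbation r \<tau> b \<and> precise_asymptotics M X \<sigma> r a \<tau> b)
        \<longrightarrow> integrable M (X 0) \<and> prob_space.expectation M (X 0) = 0 \<and>
            integrable M (\<lambda>\<omega>. (X 0 \<omega>)\<^sup>2) \<and> prob_space.variance M (X 0) = \<sigma>\<^sup>2)"
proof -
  interpret prob_space M by fact
  interpret iid_walk M X
    by unfold_locales (use assms in auto)
  have pw: "perturbed_walk M X \<sigma> r a \<tau> b" if "r > 1" "a > -1" "perturbation r \<tau> b" for r a \<tau> b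
    by unfold_locales (use that assms(4) in auto)
  show ?thesis
  proof (intro conjI allI impI; (elim conjE exE)?)
    fix r a \<tau> :: real and b \<eta>
    assume "r > 1" "a > -1" "perturbation r \<tau> b" "integrable M (X 0)" "expectation (X 0) = 0"
      "integrable M (\<lambda>\<omega>. (X 0 \<omega>)\<^sup>2)" "expectation (\<lambda>\<omega>. (X 0 \<omega>)\<^sup>2) = \<sigma>\<^sup>2" "0 < \<eta>" "\<eta> < 1"
      "integrable M (\<lambda>\<omega>. \<bar>X 0 \<omega>\<bar> powr (2 + \<eta>))"
    then show "precise_asymptotics M X \<sigma> r a \<tau> b"
      using perturbed_walk.precise_asymptotics_of_moments[OF pw] by blast
  next
    fix r a \<tau> :: real and b
    assume "r > 1" "a > -1" "perturbation r \<tau> b" "precise_asymptotics M X \<sigma> r a \<tau> b"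
    note perturbed_walk.moments_of_precise_asymptotics[OF pw[OF this(1-3)] this(4)]
    then show "integrable M (X 0)" "expectation (X 0) = 0" "integrable M (\<lambda>\<omega>. (X 0 \<omega>)\<^sup>2)" "variance (X 0) = \<sigma>\<^sup>2"
      by blast+
  qed
qed

end
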